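(* Let $\Gamma$ be a nonuniform lattice in $G=\mathrm{SL}_2(\mathbf{R})$ that contains $-I$. Let $\Lambda_1,\Lambda_2\subset\mathbf{R}^2$ be (not necessarily distinct) scaled discrete $\Gamma$-orbits, and let $f$ be a bounded semicontinuous function of compact support on $\mathbf{R}^2\times\mathbf{R}^2$. Then $\Theta_{\Lambda_1,\Lambda_2;f}\in L^\infty(G/\Gamma)$ and $$\int_{G/\Gamma}\Theta_{\Lambda_1,\Lambda_2;f}(g)\,d\mu(g)=c_\Gamma\sum_{c\in\mathcal{N}\setminus\{0\}}\frac{\varphi(c)}{|c|}\int_{\mathbf{R}}\int_{\mathbf{R}^2}f(\mathbf{x},t\mathbf{x}+c\mathbf{x}^* )\,d\mathbf{x}\,dt+\delta_{\Lambda_1,\Lambda_2}\,c_\Gamma\int_{\mathbf{R}^2}\left(f(\mathbf{x},-\mathbf{x})+f(\mathbf{x},\mathbf{x})\right)d\mathbf{x},$$ where for each nonzero $\mathbf{x}$ the vector $\mathbf{x}^*$ is such that $\det(\mathbf{x}\,|\,\mathbf{x}^* )=1$, and $\delta_{\Lambda_1,\Lambda_2}=1$ if $\Lambda_1$ and $\Lambda_2$ are homothetic and is $0$ otherwise.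
   Context: $\Gamma$ acts linearly on $\mathbf{R}^2$; a discrete $\Gamma$-orbit is an orbit $\Gamma\mathbf{x}$, $\mathbf{x}\ne\mathbf{0}$, that is a discrete subset of $\mathbf{R}^2$. $\mu$ is the $G$-invariant probability measure on $G/\Gamma$. Semicontinuous means lower semicontinuous or upper semicontinuous (real-valued). $V$ is the hyperbolic area of $\Gamma\backslash\mathbf{H}^2$ and $c_\Gamma=\frac{2}{\pi V}$. By Veech's theorem, for each discrete $\Gamma$-orbit $\Lambda$ there is a constant $c_\Lambda>0$ with $\int_{G/\Gamma}\sum_{\mathbf{x}\in\Lambda}h(g\mathbf{x})\,d\mu(g)=c_\Lambda\int_{\mathbf{R}^2}h(\mathbf{x})\,d\mathbf{x}$ for all bounded compactly supported Borel $h$. $\Lambda$ is called scaled if $c_\Lambda=c_\Gamma$; every discrete orbit is homothetic (equal up to multiplication by some $\lambda\ne0$) to a scaled one. The Siegel–Veech transform is $\Theta_{\Lambda_1,\Lambda_2;f}(g)=\sum_{\mathbf{x}\in\Lambda_1}\sum_{\mathbf{y}\in\Lambda_2}f(g\mathbf{x},g\mathbf{y})$, $g\in G/\Gamma$. $\mathcal{N}=\{\det(\mathbf{x}\,|\,\mathbf{y}):(\mathbf{x},\mathbf{y})\in\Lambda_1\times\Lambda_2\}$. Pairs $(\mathbf{x}_1,\mathbf{y}_1),(\mathbf{x}_2,\mathbf{y}_2)\in\Lambda_1\times\Lambda_2$ are equivalent if $(\mathbf{x}_1,\mathbf{y}_1)=(\gamma\mathbf{x}_2,\gamma\mathbf{y}_2)$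 for some $\gamma\in\Gamma$, and $\varphi(c)$ is the number of equivalence classes of pairs $(\mathbf{x},\mathbf{y})\in\Lambda_1\times\Lambda_2$ with $\det(\mathbf{x}\,|\,\mathbf{y})=c$. *)

theory Defs
  imports "HOL-Analysis.Analysis" "HOL-Algebra.Left_Coset"
begin

section \<open>The group and its lattices\<close>

definition SL2 :: "(real^2^2) monoid"
  where "SL2 = \<lparr>carrier = {A. det A = 1}, mult = (**), one = mat 1\<rparr>"

lemma group_SL2: "group SL2"
proof (rule groupI)
  fix A assume "A \<in> carrier SL2"
  then have d: "det A = 1" by (simp add: SL2_def)
  then obtain B where B: "A ** B = mat 1" "B ** A = mat 1"
    using invertible_det_nz[of A] by (auto simp: invertible_def)
  have "det B = 1"
    using d arg_cong[OF B(2), of det] by (simp add: det_mul)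
  with B show "\<exists>y\<in>carrier SL2. y \<otimes>\<^bsub>SL2\<^esub> A = \<one>\<^bsub>SL2\<^esub>"
    by (auto simp: SL2_def)
qed (auto simp: SL2_def det_mul matrix_mul_assoc)

text \<open>The quotient topology on the set of left cosets. The union of a set of cosets is its
  preimage under the projection, see \<open>quotient_map_coset\<close>.\<close>

definition coset_topology :: "(real^2^2) set \<Rightarrow> (real^2^2) set topology"
  where "coset_topology \<Gamma> =
    topology (\<lambda>U. U \<subseteq> lcosets\<^bsub>SL2\<^esub> \<Gamma> \<and> openin (top_of_set (carrier SL2)) (\<Union>U))"

text \<open>The measures on \<open>G/\<Gamma>\<close> are Borel measures for the quotient topology.\<close>

definition invariant_probability :: "(real^2^2) set \<Rightarrow> (real^2^2) set measure \<Rightarrow> bool"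
  where "invariant_probability \<Gamma> \<mu> \<longleftrightarrow>
    sets \<mu> = sigma_sets (lcosets\<^bsub>SL2\<^esub> \<Gamma>) {U. openin (coset_topology \<Gamma>) U} \<and>
    emeasure \<mu> (space \<mu>) = 1 \<and>
    (\<forall>g\<in>carrier SL2. \<forall>A\<in>sets \<mu>. emeasure \<mu> ((\<lambda>C. g <#\<^bsub>SL2\<^esub> C) ` A) = emeasure \<mu> A)"

definition lattice_SL2 :: "(real^2^2) set \<Rightarrow> bool"
  where "lattice_SL2 \<Gamma> \<longleftrightarrow>
    subgroup \<Gamma> SL2 \<and> discrete \<Gamma> \<and> (\<exists>\<mu>. invariant_probability \<Gamma> \<mu>)"

definition nonuniform :: "(real^2^2) set \<Rightarrow> bool"
  where "nonuniform \<Gamma> \<longleftrightarrow> \<not> compact_space (coset_topology \<Gamma>)"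


section \<open>The area of the quotient of the hyperbolic plane\<close>

definition upper_half_plane :: "complex set"
  where "upper_half_plane = {z. 0 < Im z}"

definition act :: "real^2^2 \<Rightarrow> complex \<Rightarrow> complex"
  where "act g = moebius (of_real (g $ 1 $ 1)) (of_real (g $ 1 $ 2))
                         (of_real (g $ 2 $ 1)) (of_real (g $ 2 $ 2))"

definition hyperbolic_area :: "complex measure"
  where "hyperbolic_area =
    density lborel (\<lambda>z. ennreal (indicator upper_half_plane z / (Im z)\<^sup>2))"

text \<open>A Borel set of representatives of the orbits in the upper half-plane. All these sets have
  the same area, which is by definition the area of the quotient.\<close>

definition strict_fundamental_domain :: "(real^2^2) set \<Rightarrow> complex set \<Rightarrow> bool"
  where "strict_fundamental_domain \<Gamma> F \<longleftrightarrow>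
    F \<in> sets borel \<and> F \<subseteq> upper_half_plane \<and>
    (\<forall>z\<in>upper_half_plane. \<exists>!w. w \<in> F \<and> (\<exists>\<gamma>\<in>\<Gamma>. w = act \<gamma> z))"

definition quotient_area :: "(real^2^2) set \<Rightarrow> real"
  where "quotient_area \<Gamma> = measure hyperbolic_area (SOME F. strict_fundamental_domain \<Gamma> F)"

definition c_lattice :: "(real^2^2) set \<Rightarrow> real"
  where "c_lattice \<Gamma> = 2 / (pi * quotient_area \<Gamma>)"


section \<open>Discrete orbits and Siegel--Veech transforms\<close>

definition discrete_orbit :: "(real^2^2) set \<Rightarrow> (real^2) set \<Rightarrow> bool"
  where "discrete_orbit \<Gamma> \<Lambda> \<longleftrightarrow> (\<exists>x. x \<noteq> 0 \<and> \<Lambda> = (\<lambda>\<gamma>. \<gamma> *v x) ` \<Gamma>) \<and> discrete \<Lambda>"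

text \<open>The transforms are functions of a coset \<open>C\<close>, evaluated at an arbitrary representative of
  it. For \<open>\<Gamma>\<close>-orbits the choice is immaterial, see \<open>siegel_transform_coset\<close> and
  \<open>siegel_veech_transform_coset\<close>.\<close>

definition siegel_transform :: "(real^2) set \<Rightarrow> (real^2 \<Rightarrow> real) \<Rightarrow> (real^2^2) set \<Rightarrow> real"
  where "siegel_transform \<Lambda> h C = (let g = (SOME g. g \<in> C) in \<Sum>\<^sub>\<infinity>x\<in>\<Lambda>. h (g *v x))"

definition siegel_veech_transform ::
    "(real^2) set \<Rightarrow> (real^2) set \<Rightarrow> ((real^2) \<times> (real^2) \<Rightarrow> real) \<Rightarrow> (real^2^2) set \<Rightarrow> real"
  where "siegel_veech_transform \<Lambda>1 \<Lambda>2 f C =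
    (let g = (SOME g. g \<in> C) in \<Sum>\<^sub>\<infinity>x\<in>\<Lambda>1. \<Sum>\<^sub>\<infinity>y\<in>\<Lambda>2. f (g *v x, g *v y))"

definition compactly_supported :: "('a::topological_space \<Rightarrow> real) \<Rightarrow> bool"
  where "compactly_supported h \<longleftrightarrow> compact (closure {x. h x \<noteq> 0})"

text \<open>\<open>siegel_veech_constant \<Gamma> \<mu> \<Lambda> c\<close> says that \<open>c\<close> is the constant \<open>c\<^sub>\<Lambda>\<close> of Veech's mean
  value formula.\<close>

definition siegel_veech_constant ::
    "(real^2^2) set \<Rightarrow> (real^2^2) set measure \<Rightarrow> (real^2) set \<Rightarrow> real \<Rightarrow> bool"
  where "siegel_veech_constant \<Gamma> \<mu> \<Lambda> c \<longleftrightarrow> c > 0 \<and>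
    (\<forall>h. h \<in> borel_measurable borel \<longrightarrow> bounded (range h) \<longrightarrow> compactly_supported h \<longrightarrow>
      (\<integral>C. siegel_transform \<Lambda> h C \<partial>\<mu>) = c * (\<integral>x. h x \<partial>lborel))"

definition scaled_orbit ::
    "(real^2^2) set \<Rightarrow> (real^2^2) set measure \<Rightarrow> (real^2) set \<Rightarrow> bool"
  where "scaled_orbit \<Gamma> \<mu> \<Lambda> \<longleftrightarrow>
    discrete_orbit \<Gamma> \<Lambda> \<and> siegel_veech_constant \<Gamma> \<mu> \<Lambda> (c_lattice \<Gamma>)"

definition homothetic :: "(real^2) set \<Rightarrow> (real^2) set \<Rightarrow> bool"
  where "homothetic \<Lambda>1 \<Lambda>2 \<longleftrightarrow> (\<exists>r::real. r \<noteq> 0 \<and> \<Lambda>2 = (\<lambda>x. r *\<^sub>R x) ` \<Lambda>1)"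


section \<open>Determinants of pairs\<close>

definition det_cols :: "real^2 \<Rightarrow> real^2 \<Rightarrow> real"
  where "det_cols x y = det (transpose (vector [x, y] :: real^2^2))"

lemma det_cols_eq: "det_cols x y = x $ 1 * y $ 2 - y $ 1 * x $ 2"
  by (simp add: det_cols_def det_2 transpose_def)

definition det_values :: "(real^2) set \<Rightarrow> (real^2) set \<Rightarrow> real set"
  where "det_values \<Lambda>1 \<Lambda>2 = {det_cols x y | x y. (x, y) \<in> \<Lambda>1 \<times> \<Lambda>2}"

definition pair_equiv ::
    "(real^2^2) set \<Rightarrow> (real^2) set \<Rightarrow> (real^2) set \<Rightarrow> (((real^2) \<times> (real^2)) \<times> ((real^2) \<times> (real^2))) set"
  where "pair_equiv \<Gamma> \<Lambda>1 \<Lambda>2 =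
    {((x1, y1), (x2, y2)). (x1, y1) \<in> \<Lambda>1 \<times> \<Lambda>2 \<and> (x2, y2) \<in> \<Lambda>1 \<times> \<Lambda>2 \<and>
       (\<exists>\<gamma>\<in>\<Gamma>. (x1, y1) = (\<gamma> *v x2, \<gamma> *v y2))}"

definition pair_count :: "(real^2^2) set \<Rightarrow> (real^2) set \<Rightarrow> (real^2) set \<Rightarrow> real \<Rightarrow> nat"
  where "pair_count \<Gamma> \<Lambda>1 \<Lambda>2 c =
    card ({(x, y). (x, y) \<in> \<Lambda>1 \<times> \<Lambda>2 \<and> det_cols x y = c} // pair_equiv \<Gamma> \<Lambda>1 \<Lambda>2)"


section \<open>Function classes\<close>

definition lower_semicontinuous :: "('a::topological_space \<Rightarrow> real) \<Rightarrow> bool"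
  where "lower_semicontinuous f \<longleftrightarrow> (\<forall>a. open {x. a < f x})"

definition upper_semicontinuous :: "('a::topological_space \<Rightarrow> real) \<Rightarrow> bool"
  where "upper_semicontinuous f \<longleftrightarrow> (\<forall>a. open {x. f x < a})"

definition L_infinity :: "'a measure \<Rightarrow> ('a \<Rightarrow> real) set"
  where "L_infinity M = {\<phi> \<in> borel_measurable M. \<exists>B. AE x in M. \<bar>\<phi> x\<bar> \<le> B}"


section \<open>Well-definedness\<close>

lemma Union_lcosets:
  assumes "subgroup \<Gamma> SL2" and "U \<subseteq> lcosets\<^bsub>SL2\<^esub> \<Gamma>"
  shows "\<Union>U = {g \<in> carrier SL2. g <#\<^bsub>SL2\<^esub> \<Gamma> \<in> U}"
proof -
  interpret group SL2 by (rule group_SL2)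
  interpret subgroup \<Gamma> SL2 by fact
  show ?thesis
  proof (intro equalityI subsetI)
    fix g assume "g \<in> \<Union>U"
    then obtain C where C: "C \<in> U" "g \<in> C" by auto
    then obtain a where a: "a \<in> carrier SL2" "C = a <#\<^bsub>SL2\<^esub> \<Gamma>"
      using assms(2) by (auto simp: LCOSETS_def)
    have "a <#\<^bsub>SL2\<^esub> \<Gamma> = g <#\<^bsub>SL2\<^esub> \<Gamma>"
      using C a assms(1) by (intro l_repr_independence) auto
    moreover have "g \<in> carrier SL2"
      using elemlcos_carrier[OF group_SL2 a(1)] C a by auto
    ultimately show "g \<in> {g \<in> carrier SL2. g <#\<^bsub>SL2\<^esub> \<Gamma> \<in> U}" using C a by simp
  qed (use lcos_self assms(1) in auto)
qed

lemma openin_coset_topology: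
  assumes "subgroup \<Gamma> SL2"
  shows "openin (coset_topology \<Gamma>) U \<longleftrightarrow>
    U \<subseteq> lcosets\<^bsub>SL2\<^esub> \<Gamma> \<and> openin (top_of_set (carrier SL2)) (\<Union>U)"
proof -
  let ?P = "\<lambda>U. U \<subseteq> lcosets\<^bsub>SL2\<^esub> \<Gamma> \<and> openin (top_of_set (carrier SL2)) (\<Union>U)"
  have "?P (S \<inter> T)" if S: "?P S" and T: "?P T" for S T
  proof -
    have "S \<inter> T \<subseteq> lcosets\<^bsub>SL2\<^esub> \<Gamma>" using S by auto
    then have "\<Union>(S \<inter> T) = \<Union>S \<inter> \<Union>T"
      using S T by (auto simp: Union_lcosets[OF assms])
    with S T show ?thesis by (auto intro: openin_Int)
  qed
  moreover have "?P (\<Union>K)" if K: "\<forall>S\<in>K. ?P S" for K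
  proof -
    have "\<Union>(\<Union>K) = \<Union>(Union ` K)" by auto
    with K show ?thesis by auto
  qed
  ultimately have "istopology ?P" unfolding istopology_def by blast
  then show ?thesis by (simp add: coset_topology_def topology_inverse')
qed

lemma quotient_map_coset:
  assumes "subgroup \<Gamma> SL2"
  shows "quotient_map (top_of_set (carrier SL2)) (coset_topology \<Gamma>) (\<lambda>g. g <#\<^bsub>SL2\<^esub> \<Gamma>)"
proof -
  have "\<Union>(lcosets\<^bsub>SL2\<^esub> \<Gamma>) = carrier SL2"
    by (subst Union_lcosets[OF assms]) (auto simp: LCOSETS_def)
  then have "openin (coset_topology \<Gamma>) (lcosets\<^bsub>SL2\<^esub> \<Gamma>)"
    by (simp add: openin_coset_topology[OF assms])
  then have top: "topspace (coset_topology \<Gamma>) = lcosets\<^bsub>SL2\<^esub> \<Gamma>"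
    using openin_coset_topology[OF assms]
    by (metis openin_subset openin_topspace subset_antisym)
  show ?thesis
    unfolding quotient_map_def top openin_coset_topology[OF assms]
    using Union_lcosets[OF assms] by (auto simp: LCOSETS_def)
qed

lemma orbit_sum_reindex:
  assumes "subgroup \<Gamma> SL2" and "discrete_orbit \<Gamma> \<Lambda>" and "\<gamma> \<in> \<Gamma>"
  shows "(\<Sum>\<^sub>\<infinity>x\<in>\<Lambda>. F (\<gamma> *v x)) = (\<Sum>\<^sub>\<infinity>x\<in>\<Lambda>. (F x :: real))"
proof -
  interpret group SL2 by (rule group_SL2)
  interpret subgroup \<Gamma> SL2 by fact
  obtain x where x: "\<Lambda> = (\<lambda>\<gamma>. \<gamma> *v x) ` \<Gamma>"
    using assms(2) by (auto simp: discrete_orbit_def)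
  define \<delta> where "\<delta> = inv\<^bsub>SL2\<^esub> \<gamma>"
  have \<delta>: "\<delta> \<in> \<Gamma>" "\<gamma> ** \<delta> = mat 1" "\<delta> ** \<gamma> = mat 1"
    using assms(3) r_inv[OF mem_carrier] l_inv[OF mem_carrier]
    by (auto simp: \<delta>_def SL2_def[THEN arg_cong, of mult] SL2_def[THEN arg_cong, of one])
  have mem: "\<alpha> *v y \<in> \<Lambda>" if "\<alpha> \<in> \<Gamma>" "y \<in> \<Lambda>" for \<alpha> y
    using that m_closed[of \<alpha>] by (auto simp: x SL2_def matrix_vector_mul_assoc)
  have "bij_betw (\<lambda>y. \<gamma> *v y) \<Lambda> \<Lambda>"
    by (rule bij_betwI[where g = "\<lambda>y. \<delta> *v y"])
       (use mem \<delta> assms(3) in \<open>auto simp: matrix_vector_mul_assoc\<close>)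
  then show ?thesis by (rule infsum_reindex_bij_betw)
qed

lemma some_in_coset:
  assumes "subgroup \<Gamma> SL2" and "g \<in> carrier SL2"
  obtains \<gamma> where "\<gamma> \<in> \<Gamma>" "(SOME a. a \<in> g <#\<^bsub>SL2\<^esub> \<Gamma>) = g ** \<gamma>"
proof -
  have "g \<in> g <#\<^bsub>SL2\<^esub> \<Gamma>"
    using assms group.lcos_self[OF group_SL2] by auto
  then have "(SOME a. a \<in> g <#\<^bsub>SL2\<^esub> \<Gamma>) \<in> g <#\<^bsub>SL2\<^esub> \<Gamma>" by (rule someI)
  then show ?thesis using that by (auto simp: l_coset_def SL2_def)
qed

lemma siegel_transform_coset:
  assumes "subgroup \<Gamma> SL2" and "discrete_orbit \<Gamma> \<Lambda>" and "g \<in> carrier SL2"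
  shows "siegel_transform \<Lambda> h (g <#\<^bsub>SL2\<^esub> \<Gamma>) = (\<Sum>\<^sub>\<infinity>x\<in>\<Lambda>. h (g *v x))"
proof -
  obtain \<gamma> where \<gamma>: "\<gamma> \<in> \<Gamma>" "(SOME a. a \<in> g <#\<^bsub>SL2\<^esub> \<Gamma>) = g ** \<gamma>"
    using some_in_coset assms by blast
  show ?thesis
    using orbit_sum_reindex[OF assms(1,2) \<gamma>(1), of "\<lambda>x. h (g *v x)"]
    by (simp add: siegel_transform_def \<gamma>(2) matrix_vector_mul_assoc)
qed

lemma siegel_veech_transform_coset:
  assumes "subgroup \<Gamma> SL2" and "discrete_orbit \<Gamma> \<Lambda>1" and "discrete_orbit \<Gamma> \<Lambda>2"
    and "g \<in> carrier SL2"
  shows "siegel_veech_transform \<Lambda>1 \<Lambda>2 f (g <#\<^bsub>SL2\<^esub> \<Gamma>) =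
    (\<Sum>\<^sub>\<infinity>x\<in>\<Lambda>1. \<Sum>\<^sub>\<infinity>y\<in>\<Lambda>2. f (g *v x, g *v y))"
proof -
  obtain \<gamma> where \<gamma>: "\<gamma> \<in> \<Gamma>" "(SOME a. a \<in> g <#\<^bsub>SL2\<^esub> \<Gamma>) = g ** \<gamma>"
    using some_in_coset assms by blast
  have "(\<Sum>\<^sub>\<infinity>y\<in>\<Lambda>2. f (g *v (\<gamma> *v x), g *v (\<gamma> *v y))) =
      (\<Sum>\<^sub>\<infinity>y\<in>\<Lambda>2. f (g *v (\<gamma> *v x), g *v y))" for x
    using orbit_sum_reindex[OF assms(1,3) \<gamma>(1), of "\<lambda>y. f (g *v (\<gamma> *v x), g *v y)"] .
  moreover have "(\<Sum>\<^sub>\<infinity>x\<in>\<Lambda>1. \<Sum>\<^sub>\<infinity>y\<in>\<Lambda>2. f (g *v (\<gamma> *v x), g *v y)) =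
      (\<Sum>\<^sub>\<infinity>x\<in>\<Lambda>1. \<Sum>\<^sub>\<infinity>y\<in>\<Lambda>2. f (g *v x, g *v y))"
    using orbit_sum_reindex[OF assms(1,2) \<gamma>(1), of "\<lambda>x. \<Sum>\<^sub>\<infinity>y\<in>\<Lambda>2. f (g *v x, g *v y)"] .
  ultimately show ?thesis
    by (simp add: siegel_veech_transform_def \<gamma>(2) flip: matrix_vector_mul_assoc)
qed

end

(*
  Let m be the measure on G obtained by unfolding mu along G -> G/Gamma. It is left invariant, so by
  uniqueness of Haar measure it is a multiple of dx dt in the coordinates g = (x | t x + x'), where
  det (x | x') = 1.
  In these coordinates g^-1 i = -t + i/|x|^2, so that the image of dx dt in the upper half-plane
  is pi times the hyperbolic area; evaluating m on the preimage of a fundamental domain shows that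
  the multiple is c_Gamma.

  Pairs (x, y) with det (x | y) = c <> 0 have trivial stabiliser, and unfolding the sum over one
  equivalence class gives c_Gamma/|c| times the integral of f (x, t x + c x'). Scaled orbits that
  contain collinear points x, y coincide and y = x or y = -x, so the pairs with determinant 0
  contribute a Siegel transform, whose mean is given by Veech's formula.

  For boundedness, Veech's formula first forces a discrete orbit Lambda to be locally finite and its
  points to have nontrivial, hence unipotent, stabilisers. Reducing modulo such a unipotent element
  shows that only finitely many classes of pairs have nonzero determinant at most D. The nonzero
  determinants of pairs in Lambda are therefore bounded away from 0, which bounds the number of
  points of g Lambda in a ball uniformly in g.
*)

theory Submission
  imports Defs
begin

section \<open>Two-dimensional Lebesgue measure and matrices\<close>

text \<open>The orbits are discrete only as subsets of the plane, so they might accumulate outside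
  themselves; local finiteness has to be extracted from the mean value formula. There the default
  value 0 of divergent integrals, sums and cardinalities becomes an argument: a nonzero mean proves
  integrability, and a disc with infinitely many hits counts as 0, which additivity of the means
  forbids as soon as a small open subset is hit exactly once. Fubini's proof that Haar measure is
  unique needs dx dt to be invariant under right translation and inversion as well. Both follow from
  invariance under transposition, which is visible in a chart by matrix entries. All unfolding is
  carried out for nonnegative extended real functions, where exchanging sums and integrals costs
  nothing. Convergence comes last and from the other side: the transform is bounded on a probability
  space, hence the series over determinants is finite. Only then is a signed f split into its
  positive and negative parts.\<close>

lemma borel_vec2I:
  fixes f :: "'a \<Rightarrow> real^2"
  assumes "(\<lambda>z. f z $ 1) \<in> borel_measurable M" "(\<lambda>z. f z $ 2) \<in> borel_measurable M"
  shows "f \<in> borel_measurable M"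
  using assms by (subst borel_measurable_euclidean_space) (auto simp: Basis_vec_def UNIV_2 inner_axis)

lemma borel_vec2 [measurable (raw)]:
  "a \<in> borel_measurable M \<Longrightarrow> b \<in> borel_measurable M \<Longrightarrow> (\<lambda>z. vector [a z, b z] :: real^2) \<in> borel_measurable M"
  by (rule borel_vec2I) simp_all

lemma lborel_vec2: "distr (lborel \<Otimes>\<^sub>M lborel) borel (\<lambda>(a::real,b::real). vector [a,b] :: real^2) = lborel"
proof (rule lborel_eqI[symmetric])
  fix l u :: "real^2" assume le: "\<And>b. b \<in> Basis \<Longrightarrow> l \<bullet> b \<le> u \<bullet> b"
  have le': "l $ i \<le> u $ i" for i using le[of "axis i 1"] by (simp add: axis_in_Basis_iff inner_axis)
  have "(\<lambda>(a::real,b::real). vector [a,b] :: real^2) -` box l u = {l$1<..<u$1} \<times> {l$2<..<u$2}"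
    by (auto simp: mem_box_cart forall_2)
  then have "emeasure (distr (lborel \<Otimes>\<^sub>M lborel) borel (\<lambda>(a::real,b::real). vector [a,b] :: real^2)) (box l u)
    = ennreal ((u$1 - l$1) * (u$2 - l$2))"
    using le' by (simp add: emeasure_distr space_pair_measure lborel.emeasure_pair_measure_Times ennreal_mult)
  also have "(u$1 - l$1) * (u$2 - l$2) = (\<Prod>b\<in>Basis. (u - l) \<bullet> b)"
    by (simp add: Basis_vec_def axis_eq_axis UNIV_2 inner_axis algebra_simps)
  finally show "emeasure (distr (lborel \<Otimes>\<^sub>M lborel) borel (\<lambda>(a::real,b::real). vector [a,b] :: real^2)) (box l u)
    = (\<Prod>b\<in>Basis. (u - l) \<bullet> b)" .
qed simp

lemma borel_Complex [measurable (raw)]: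
  assumes [measurable]: "f \<in> borel_measurable M" "g \<in> borel_measurable M"
  shows "(\<lambda>p. Complex (f p) (g p)) \<in> borel_measurable M"
  unfolding Complex_eq by measurable

lemma lborel_complex: "distr (lborel \<Otimes>\<^sub>M lborel) borel (\<lambda>(a,b). Complex a b) = lborel"
proof (rule lborel_eqI[symmetric])
  fix l u :: complex assume le: "\<And>b. b \<in> Basis \<Longrightarrow> l \<bullet> b \<le> u \<bullet> b"
  have le': "Re l \<le> Re u" "Im l \<le> Im u" using le[of 1] le[of \<i>] by (auto simp: Basis_complex_def)
  have "(\<lambda>(a,b). Complex a b) -` box l u = {Re l<..<Re u} \<times> {Im l<..<Im u}"
    by (auto simp: box_def Basis_complex_def)
  then have "emeasure (distr (lborel \<Otimes>\<^sub>M lborel) borel (\<lambda>(a,b). Complex a b)) (box l u)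
    = ennreal ((Re u - Re l) * (Im u - Im l))"
    using le' by (simp add: emeasure_distr space_pair_measure lborel.emeasure_pair_measure_Times ennreal_mult)
  also have "(Re u - Re l) * (Im u - Im l) = (\<Prod>b\<in>Basis. (u - l) \<bullet> b)"
    by (simp add: Basis_complex_def)
  finally show "emeasure (distr (lborel \<Otimes>\<^sub>M lborel) borel (\<lambda>(a,b). Complex a b)) (box l u)
    = (\<Prod>b\<in>Basis. (u - l) \<bullet> b)" .
qed simp

lemma borel_vec_nth [measurable (raw)]:
  fixes f :: "'a \<Rightarrow> ('b::euclidean_space)^'n"
  assumes "f \<in> borel_measurable M"
  shows "(\<lambda>z. f z $ i) \<in> borel_measurable M"
  by (rule measurable_compose[OF assms borel_measurable_continuous_onI]) (intro continuous_intros)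

definition col_matrix :: "real^2 \<Rightarrow> real^2 \<Rightarrow> real^2^2"
  where "col_matrix x y = transpose (vector [x, y])"

lemma col_matrix_nth [simp]:
  "col_matrix x y $ i $ 1 = x $ i" "col_matrix x y $ i $ 2 = y $ i"
  by (simp_all add: col_matrix_def transpose_def)

lemma det_col_matrix [simp]: "det (col_matrix x y) = det_cols x y"
  by (simp add: col_matrix_def det_cols_def)

lemma mat2_eq_iff: "(A::real^2^2) = B \<longleftrightarrow> A$1$1 = B$1$1 \<and> A$1$2 = B$1$2 \<and> A$2$1 = B$2$1 \<and> A$2$2 = B$2$2"
  by (auto simp: vec_eq_iff forall_2)

lemma vec2_eq_iff: "(x::'a^2) = y \<longleftrightarrow> x$1 = y$1 \<and> x$2 = y$2"
  by (auto simp: vec_eq_iff forall_2)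

lemma mat2_mult [simp]: "((A::real^2^2) ** B) $ i $ j = A$i$1 * B$1$j + A$i$2 * B$2$j"
  by (simp add: matrix_matrix_mult_def sum_2)

lemma mat2_vec [simp]: "((A::real^2^2) *v x) $ i = A$i$1 * x$1 + A$i$2 * x$2"
  by (simp add: matrix_vector_mult_def sum_2)

lemma mat2_one [simp]: "(mat 1::real^2^2)$1$1 = 1" "(mat 1::real^2^2)$1$2 = 0" "(mat 1::real^2^2)$2$1 = 0" "(mat 1::real^2^2)$2$2 = 1"
  by (simp_all add: mat_def)

lemma borel_mat2I:
  fixes f :: "'a \<Rightarrow> real^2^2"
  assumes "\<And>i j. (\<lambda>z. f z $ i $ j) \<in> borel_measurable M"
  shows "f \<in> borel_measurable M"
  using assms by (subst borel_measurable_euclidean_space) (auto simp: Basis_vec_def UNIV_2 inner_axis)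

lemma borel_col_matrix [measurable (raw)]:
  assumes [measurable]: "f \<in> borel_measurable M" "g \<in> borel_measurable M"
  shows "(\<lambda>z. col_matrix (f z) (g z)) \<in> borel_measurable M"
proof (rule borel_mat2I)
  fix i j :: 2 show "(\<lambda>z. col_matrix (f z) (g z) $ i $ j) \<in> borel_measurable M"
    by (cases j rule: exhaust_2[THEN disjE]) simp_all
qed

lemma borel_mat2_mult [measurable (raw)]:
  fixes f g :: "'a \<Rightarrow> real^2^2"
  assumes [measurable]: "f \<in> borel_measurable M" "g \<in> borel_measurable M"
  shows "(\<lambda>z. f z ** g z) \<in> borel_measurable M"
  by (rule borel_mat2I) simp

lemma borel_mat2_vec [measurable (raw)]:
  fixes f :: "'a \<Rightarrow> real^2^2"
  assumes [measurable]: "f \<in> borel_measurable M" "g \<in> borel_measurable M"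
  shows "(\<lambda>z. f z *v g z) \<in> borel_measurable M"
  by (rule borel_vec2I) simp_all

lemma borel_transpose [measurable (raw)]:
  fixes f :: "'a \<Rightarrow> real^2^2"
  assumes [measurable]: "f \<in> borel_measurable M"
  shows "(\<lambda>z. transpose (f z)) \<in> borel_measurable M"
  by (rule borel_mat2I) (simp add: transpose_def)

text \<open>The adjugate, which is the inverse on matrices of determinant 1. Its entries are linear
  in those of the argument, so continuity and measurability hold on all matrices without a side
  condition.\<close>

definition adj2 :: "real^2^2 \<Rightarrow> real^2^2"
  where "adj2 A = col_matrix (vector [A$2$2, - A$2$1]) (vector [- A$1$2, A$1$1])"

lemma adj2_nth [simp]: "adj2 A $ 1 $ 1 = A$2$2" "adj2 A $ 1 $ 2 = - A$1$2"
  "adj2 A $ 2 $ 1 = - A$2$1" "adj2 A $ 2 $ 2 = A$1$1"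
  by (simp_all add: adj2_def)

lemma borel_adj2 [measurable (raw)]:
  assumes [measurable]: "f \<in> borel_measurable M"
  shows "(\<lambda>z. adj2 (f z)) \<in> borel_measurable M"
  unfolding adj2_def by measurable

lemma adj2_mult [simp]:
  assumes "det A = 1" shows "adj2 A ** A = mat 1" "A ** adj2 A = mat 1"
  using assms by (simp_all add: mat2_eq_iff det_2 algebra_simps)

lemma det_adj2 [simp]: "det (adj2 A) = det A"
  by (simp add: det_2)

lemma adj2_adj2 [simp]: "adj2 (adj2 A) = A"
  by (simp add: mat2_eq_iff)

lemma adj2_prod: "adj2 (A ** B) = adj2 B ** adj2 A"
  by (simp add: mat2_eq_iff algebra_simps)

lemma det_cols_mat: "det_cols (g *v x) (g *v y) = det g * det_cols x y"
  by (simp add: det_cols_eq det_2 algebra_simps)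

lemma mat_mult_col_matrix: "g ** col_matrix x y = col_matrix (g *v x) (g *v y)"
  by (simp add: mat2_eq_iff)

text \<open>The preimage of a box under \<open>g\<close> is its image under the inverse
  \<open>h\<close>, which has determinant 1 and so preserves area.
  \<open>measure_linear_image\<close> speaks about \<open>lebesgue\<close>; the image being Borel
  leads back to \<open>lborel\<close>.\<close>

lemma lborel_distr_SL2:
  fixes g :: "real^2^2"
  assumes "det g = 1"
  shows "distr lborel borel (\<lambda>x. g *v x) = lborel"
proof (rule lborel_eqI[symmetric])
  fix l u :: "real^2" assume le: "\<And>b. b \<in> Basis \<Longrightarrow> l \<bullet> b \<le> u \<bullet> b"
  obtain h where h: "g ** h = mat 1" "h ** g = mat 1" using assms invertible_det_nz[of g] by (auto simp: invertible_def)
  have dh: "det h = 1" using assms arg_cong[OF h(1), of det] by (simp add: det_mul)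
  have eq: "(\<lambda>x. g *v x) -` box l u = (\<lambda>x. h *v x) ` box l u"
    using h by (force simp: matrix_vector_mul_assoc image_iff)
  have "measure lebesgue ((\<lambda>x. h *v x) ` box l u) = measure lebesgue (box l u)"
    by (subst measure_linear_image) (simp_all add: dh)
  moreover have "(\<lambda>x. h *v x) ` box l u \<in> lmeasurable" by (rule measurable_linear_image) auto
  moreover have b: "(\<lambda>x. h *v x) ` box l u \<in> sets borel"
    unfolding eq[symmetric]
    by (intro borel_open open_vimage open_box matrix_vector_mult_linear_continuous_on)
  ultimately have "emeasure lebesgue ((\<lambda>x. h *v x) ` box l u) = measure lborel (box l u)"
    by (simp add: emeasure_eq_measure2 measure_completion)
  then have "emeasure lborel ((\<lambda>x. h *v x) ` box l u) = measure lborel (box l u)"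
    using b by simp
  then show "emeasure (distr lborel borel (\<lambda>x. g *v x)) (box l u) = (\<Prod>b\<in>Basis. (u - l) \<bullet> b)"
    using le by (simp add: emeasure_distr eq measure_lborel_box_eq)
qed simp
text \<open>A measurable choice of \<open>x\<^sup>*\<close>; the junk value at the origin is \<open>0\<close>.\<close>

definition dual_vec :: "real^2 \<Rightarrow> real^2"
  where "dual_vec x = vector [- x$2, x$1] /\<^sub>R ((x$1)\<^sup>2 + (x$2)\<^sup>2)"

lemma vec2_nonzero: "(x::real^2) \<noteq> 0 \<longleftrightarrow> 0 < (x$1)\<^sup>2 + (x$2)\<^sup>2"
  by (simp add: vec2_eq_iff sum_power2_gt_zero_iff)

lemma det_dual_vec: "x \<noteq> 0 \<Longrightarrow> det_cols x (dual_vec x) = 1"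
  using vec2_nonzero[of x]
  by (auto simp: det_cols_eq dual_vec_def power2_eq_square divide_inverse[symmetric] mult_ac
      vec2_eq_iff simp flip: add_divide_distrib)

lemma dual_vec_borel [measurable]: "dual_vec \<in> borel_measurable borel"
  unfolding dual_vec_def by measurable

text \<open>Cramer's rule for the unimodular basis \<open>x\<close>, \<open>z\<close>.\<close>

lemma vec2_decomp:
  assumes "det_cols x z = 1" shows "y = det_cols y z *\<^sub>R x + det_cols x y *\<^sub>R z"
proof -
  have "y $ 1 * det_cols x z = y$1" "y $ 2 * det_cols x z = y$2" using assms by simp_all
  then show ?thesis by (simp add: vec2_eq_iff det_cols_eq algebra_simps)
qed

section \<open>Haar measure in coordinates\<close>

lemma nn_integral_lborel_shift:
  fixes F :: "real \<Rightarrow> ennreal"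
  assumes "F \<in> borel_measurable borel"
  shows "(\<integral>\<^sup>+t. F (t + c) \<partial>lborel) = (\<integral>\<^sup>+t. F t \<partial>lborel)"
  using nn_integral_real_affine[OF assms, of 1 c] by (simp add: add.commute)

text \<open>The matrices of determinant 1 with first column \<open>x\<close> form an affine line,
  with \<open>t\<close> as coordinate. A functional on functions of all matrices avoids a separate
  measure space for the group; only the values at determinant 1 count, see
  \<open>haar_cong\<close>.\<close>

definition haar :: "(real^2^2 \<Rightarrow> ennreal) \<Rightarrow> ennreal"
  where "haar F = (\<integral>\<^sup>+x. \<integral>\<^sup>+t. F (col_matrix x (t *\<^sub>R x + dual_vec x)) \<partial>lborel \<partial>lborel)"

lemma AE_vec2_nonzero: "AE x::real^2 in lborel. x \<noteq> 0"
  by (rule AE_lborel_singleton)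

text \<open>Two vectors of determinant 1 against \<open>x\<close> differ by a multiple of
  \<open>x\<close>, which a translation of \<open>t\<close> absorbs. The freedom in the choice of
  \<sigma> drives both the invariance and the chart below; the chart uses a choice that fails on a
  null set.\<close>

lemma haar_dual_indep:
  assumes [measurable]: "F \<in> borel_measurable borel"
    and "AE x in lborel. det_cols x (\<sigma> x) = 1"
  shows "haar F = (\<integral>\<^sup>+x. \<integral>\<^sup>+t. F (col_matrix x (t *\<^sub>R x + \<sigma> x)) \<partial>lborel \<partial>lborel)"
  unfolding haar_def
proof (rule nn_integral_cong_AE)
  show "AE x in lborel. (\<integral>\<^sup>+t. F (col_matrix x (t *\<^sub>R x + dual_vec x)) \<partial>lborel) =
      (\<integral>\<^sup>+t. F (col_matrix x (t *\<^sub>R x + \<sigma> x)) \<partial>lborel)"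
    using assms(2) AE_vec2_nonzero
  proof eventually_elim
    case (elim x)
    define c where "c = det_cols (dual_vec x) (\<sigma> x)"
    have "dual_vec x = c *\<^sub>R x + \<sigma> x"
      using vec2_decomp[OF elim(1), of "dual_vec x"] det_dual_vec[OF elim(2)] by (simp add: c_def)
    then have "(\<integral>\<^sup>+t. F (col_matrix x (t *\<^sub>R x + dual_vec x)) \<partial>lborel) =
        (\<integral>\<^sup>+t. F (col_matrix x ((t + c) *\<^sub>R x + \<sigma> x)) \<partial>lborel)"
      by (simp add: scaleR_add_left algebra_simps)
    also have "\<dots> = (\<integral>\<^sup>+t. F (col_matrix x (t *\<^sub>R x + \<sigma> x)) \<partial>lborel)"
      by (rule nn_integral_lborel_shift) measurable
    finally show ?case .
  qed
qed

text \<open>Left translation acts on both columns: the area-preserving map \<open>g\<close> moves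
  \<open>x\<close>, and the dual vector, carried along by \<open>g\<close>, is another admissible
  choice over the new point.\<close>

lemma haar_left:
  assumes [measurable]: "F \<in> borel_measurable borel" and g: "det g = 1"
  shows "haar (\<lambda>A. F (g ** A)) = haar F"
proof -
  define \<sigma> where "\<sigma> x = g *v dual_vec (adj2 g *v x)" for x
  have inv: "adj2 g *v (g *v x) = x" "g *v (adj2 g *v x) = x" for x
    using g by (simp_all add: matrix_vector_mul_assoc)
  have [measurable]: "\<sigma> \<in> borel_measurable borel" unfolding \<sigma>_def by measurable
  have "haar (\<lambda>A. F (g ** A)) =
      (\<integral>\<^sup>+x. \<integral>\<^sup>+t. F (col_matrix (g *v x) (t *\<^sub>R (g *v x) + \<sigma> (g *v x))) \<partial>lborel \<partial>lborel)"
    by (simp add: haar_def mat_mult_col_matrix \<sigma>_def inv matrix_vector_right_distrib matrix_vector_mult_scaleR)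
  also have "\<dots> = (\<integral>\<^sup>+x. \<integral>\<^sup>+t. F (col_matrix x (t *\<^sub>R x + \<sigma> x)) \<partial>lborel \<partial>distr lborel borel (\<lambda>x. g *v x))"
    by (subst nn_integral_distr) measurable
  also have "\<dots> = (\<integral>\<^sup>+x. \<integral>\<^sup>+t. F (col_matrix x (t *\<^sub>R x + \<sigma> x)) \<partial>lborel \<partial>lborel)"
    by (simp add: lborel_distr_SL2[OF g])
  also have "\<dots> = haar F"
  proof (rule haar_dual_indep[symmetric])
    show "AE x in lborel. det_cols x (\<sigma> x) = 1"
      using AE_vec2_nonzero
    proof eventually_elim
      case (elim x)
      then have "adj2 g *v x \<noteq> 0" using inv(2)[of x] by auto
      then have "det_cols (g *v (adj2 g *v x)) (\<sigma> x) = 1"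
        using g by (simp add: \<sigma>_def det_cols_mat det_dual_vec)
      then show ?case by (simp add: inv)
    qed
  qed simp
  finally show ?thesis .
qed

lemma nn_integral_vec2:
  assumes [measurable]: "H \<in> borel_measurable borel"
  shows "(\<integral>\<^sup>+x. H (x::real^2) \<partial>lborel) = (\<integral>\<^sup>+a. \<integral>\<^sup>+b. H (vector [a, b]) \<partial>lborel \<partial>lborel)"
  by (subst lborel_vec2[symmetric]) (simp add: nn_integral_distr lborel.nn_integral_fst[symmetric] split_def)

lemma nn_integral_complex:
  assumes [measurable]: "H \<in> borel_measurable borel"
  shows "(\<integral>\<^sup>+z. H z \<partial>lborel) = (\<integral>\<^sup>+a. \<integral>\<^sup>+b. H (Complex a b) \<partial>lborel \<partial>lborel)"
  by (subst lborel_complex[symmetric]) (simp add: nn_integral_distr lborel.nn_integral_fst[symmetric] split_def)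

text \<open>The dual vector \<open>(0, 1 / a)\<close> exists off the null line \<open>a = 0\<close>.
  With it the top entry of the second column is \<open>p = a * t\<close>, whence the Jacobian factor
  \<open>1 / \<bar>a\<bar>\<close>; the last entry is forced by the determinant.\<close>

lemma haar_chart:
  assumes [measurable]: "F \<in> borel_measurable borel"
  shows "haar F = (\<integral>\<^sup>+a. \<integral>\<^sup>+b. \<integral>\<^sup>+p. ennreal \<bar>1 / a\<bar> *
    F (col_matrix (vector [a, b]) (vector [p, (1 + b * p) / a])) \<partial>lborel \<partial>lborel \<partial>lborel)"
proof -
  define \<sigma> :: "real^2 \<Rightarrow> real^2" where "\<sigma> x = vector [0, 1 / x $ 1]" for x
  have [measurable]: "\<sigma> \<in> borel_measurable borel" unfolding \<sigma>_def by measurable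
  have null: "emeasure lborel {x::real^2. x $ 1 = 0} = 0"
  proof -
    have "emeasure lborel {x::real^2. x $ 1 = 0} = (\<integral>\<^sup>+x. indicator {0} (x $ 1) \<partial>(lborel::(real^2) measure))"
      by (subst nn_integral_indicator[symmetric], simp) (rule nn_integral_cong, simp add: indicator_def)
    also have "\<dots> = (\<integral>\<^sup>+a. \<integral>\<^sup>+(b::real). indicator {0} (a::real) \<partial>lborel \<partial>lborel)"
      by (subst nn_integral_vec2) simp_all
    also have "\<dots> = (\<integral>\<^sup>+(a::real). 0 \<partial>lborel)"
      by (rule nn_integral_cong_AE, use AE_lborel_singleton[of "0::real"] in eventually_elim) simp
    finally show ?thesis by simp
  qed
  have "haar F = (\<integral>\<^sup>+x. \<integral>\<^sup>+t. F (col_matrix x (t *\<^sub>R x + \<sigma> x)) \<partial>lborel \<partial>lborel)"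
  proof (rule haar_dual_indep)
    have "AE x::real^2 in lborel. x $ 1 \<noteq> 0"
      by (rule AE_I[OF _ null]) auto
    then show "AE x in lborel. det_cols x (\<sigma> x) = 1"
      by eventually_elim (simp add: det_cols_eq \<sigma>_def)
  qed simp
  also have "\<dots> = (\<integral>\<^sup>+a. \<integral>\<^sup>+b. \<integral>\<^sup>+t. F (col_matrix (vector [a, b]) (t *\<^sub>R vector [a, b] + \<sigma> (vector [a, b]))) \<partial>lborel \<partial>lborel \<partial>lborel)"
    by (rule nn_integral_vec2) measurable
  also have "\<dots> = (\<integral>\<^sup>+a. \<integral>\<^sup>+b. \<integral>\<^sup>+p. ennreal \<bar>1 / a\<bar> *
    F (col_matrix (vector [a, b]) (vector [p, (1 + b * p) / a])) \<partial>lborel \<partial>lborel \<partial>lborel)"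
  proof (rule nn_integral_cong_AE, use AE_lborel_singleton[of "0::real"] in eventually_elim)
    case (elim a)
    show ?case
    proof (rule nn_integral_cong)
      fix b :: real
      have eq: "t *\<^sub>R vector [a, b] + \<sigma> (vector [a, b]) = vector [a * t, (1 + b * (a * t)) / a]" for t
        using elim by (simp add: vec2_eq_iff \<sigma>_def field_simps)
      have "(\<integral>\<^sup>+p. ennreal \<bar>1 / a\<bar> * F (col_matrix (vector [a, b]) (vector [p, (1 + b * p) / a])) \<partial>lborel) =
        ennreal \<bar>a\<bar> * (\<integral>\<^sup>+t. ennreal \<bar>1 / a\<bar> * F (col_matrix (vector [a, b]) (vector [a * t, (1 + b * (a * t)) / a])) \<partial>lborel)"
        using elim by (subst nn_integral_real_affine[of _ a 0]) simp_all
      also have "\<dots> = (\<integral>\<^sup>+t. F (col_matrix (vector [a, b]) (vector [a * t, (1 + b * (a * t)) / a])) \<partial>lborel)"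
        using elim by (simp add: nn_integral_cmult mult.assoc[symmetric] ennreal_mult[symmetric] abs_mult[symmetric])
      finally show "(\<integral>\<^sup>+t. F (col_matrix (vector [a, b]) (t *\<^sub>R vector [a, b] + \<sigma> (vector [a, b]))) \<partial>lborel) =
        (\<integral>\<^sup>+p. ennreal \<bar>1 / a\<bar> * F (col_matrix (vector [a, b]) (vector [p, (1 + b * p) / a])) \<partial>lborel)"
        by (simp add: eq)
    qed
  qed
  finally show ?thesis .
qed

text \<open>In the entries \<open>a\<close>, \<open>b\<close>, \<open>p\<close> of the first column and the first row, the measure is
  \<open>da db dp / |a|\<close>, which is symmetric in \<open>b\<close> and \<open>p\<close>.\<close>

lemma haar_transpose:
  assumes [measurable]: "F \<in> borel_measurable borel"
  shows "haar (\<lambda>A. F (transpose A)) = haar F"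
proof -
  have tr: "transpose (col_matrix (vector [a, b]) (vector [p, q])) = col_matrix (vector [a, p]) (vector [b, q])" for a b p q :: real
    by (simp add: mat2_eq_iff transpose_def)
  have "haar (\<lambda>A. F (transpose A)) = (\<integral>\<^sup>+a. \<integral>\<^sup>+b. \<integral>\<^sup>+p. ennreal \<bar>1 / a\<bar> *
    F (transpose (col_matrix (vector [a, b]) (vector [p, (1 + b * p) / a]))) \<partial>lborel \<partial>lborel \<partial>lborel)"
    by (rule haar_chart) measurable
  also have "\<dots> = (\<integral>\<^sup>+a. \<integral>\<^sup>+b. \<integral>\<^sup>+p. ennreal \<bar>1 / a\<bar> *
    F (col_matrix (vector [a, p]) (vector [b, (1 + b * p) / a])) \<partial>lborel \<partial>lborel \<partial>lborel)"
    by (simp only: tr)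
  also have "\<dots> = (\<integral>\<^sup>+a. \<integral>\<^sup>+p. \<integral>\<^sup>+b. ennreal \<bar>1 / a\<bar> *
    F (col_matrix (vector [a, p]) (vector [b, (1 + b * p) / a])) \<partial>lborel \<partial>lborel \<partial>lborel)"
    by (intro nn_integral_cong lborel_pair.Fubini') measurable
  also have "\<dots> = haar F"
    unfolding haar_chart[OF assms] by (simp only: mult.commute)
  finally show ?thesis .
qed

text \<open>Transposition exchanges right and left translations.\<close>

lemma haar_right:
  assumes F [measurable]: "F \<in> borel_measurable borel" and g: "det g = 1"
  shows "haar (\<lambda>A. F (A ** g)) = haar F"
proof -
  have "haar (\<lambda>A. F (A ** g)) = haar (\<lambda>A. F (transpose (transpose g ** transpose A)))"
    by (simp add: matrix_transpose_mul)
  also have "\<dots> = haar (\<lambda>A. F (transpose (transpose g ** A)))"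
    by (rule haar_transpose[where F = "\<lambda>A. F (transpose (transpose g ** A))"]) measurable
  also have "\<dots> = haar (\<lambda>A. F (transpose A))"
    by (rule haar_left[where F = "\<lambda>A. F (transpose A)"]) (measurable, simp add: g)
  also have "\<dots> = haar F"
    by (rule haar_transpose) measurable
  finally show ?thesis .
qed

text \<open>Inversion on \<open>SL\<^sub>2\<close> is transposition conjugated by the rotation by a right angle.\<close>

lemma haar_adj2:
  assumes F [measurable]: "F \<in> borel_measurable borel"
  shows "haar (\<lambda>A. F (adj2 A)) = haar F"
proof -
  define J :: "real^2^2" where "J = col_matrix (vector [0, 1]) (vector [-1, 0])"
  have J: "det J = 1" "det (adj2 J) = 1" by (simp_all add: J_def det_cols_eq)
  have "adj2 A = adj2 J ** (transpose A ** J)" for A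
    by (simp add: mat2_eq_iff J_def transpose_def)
  then have "haar (\<lambda>A. F (adj2 A)) = haar (\<lambda>A. F (adj2 J ** (transpose A ** J)))"
    by (intro arg_cong[where f = haar] ext arg_cong[where f = F])
  also have "\<dots> = haar (\<lambda>A. F (adj2 J ** (A ** J)))"
    by (rule haar_transpose[where F = "\<lambda>A. F (adj2 J ** (A ** J))"]) measurable
  also have "\<dots> = haar (\<lambda>A. F (adj2 J ** A))"
    by (rule haar_right[where F = "\<lambda>A. F (adj2 J ** A)"]) (measurable, simp add: J)
  also have "\<dots> = haar F"
    by (rule haar_left[OF F J(2)])
  finally show ?thesis .
qed


section \<open>Unfolding the invariant measure\<close>

lemma continuous_mat2I:
  fixes f :: "'a::topological_space \<Rightarrow> real^2^2"
  assumes "\<And>i j. continuous_on S (\<lambda>z. f z $ i $ j)"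
  shows "continuous_on S f"
proof -
  have "continuous_on S (\<lambda>z. \<chi> i j. f z $ i $ j)"
    by (intro continuous_on_vec_lambda assms)
  then show ?thesis by simp
qed

lemma continuous_mat2_mult [continuous_intros]:
  fixes f g :: "'a::topological_space \<Rightarrow> real^2^2"
  assumes "continuous_on S f" "continuous_on S g"
  shows "continuous_on S (\<lambda>z. f z ** g z)"
  by (rule continuous_mat2I) (simp, intro continuous_intros assms)

lemma continuous_adj2 [continuous_intros]:
  fixes f :: "'a::topological_space \<Rightarrow> real^2^2"
  assumes "continuous_on S f"
  shows "continuous_on S (\<lambda>z. adj2 (f z))"
proof (rule continuous_mat2I)
  fix i j :: 2
  show "continuous_on S (\<lambda>z. adj2 (f z) $ i $ j)"
    by (cases i rule: exhaust_2[THEN disjE]; cases j rule: exhaust_2[THEN disjE])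
       (auto intro!: continuous_intros assms)
qed

lemma closed_SL2: "closed {A::real^2^2. det A = 1}"
  unfolding det_2 by (intro closed_Collect_eq continuous_intros)

lemma carrier_SL2 [simp]: "A \<in> carrier SL2 \<longleftrightarrow> det A = 1"
  by (simp add: SL2_def)

lemma mult_SL2 [simp]: "A \<otimes>\<^bsub>SL2\<^esub> B = A ** B"
  by (simp add: SL2_def)

lemma one_SL2 [simp]: "\<one>\<^bsub>SL2\<^esub> = mat 1"
  by (simp add: SL2_def)

lemma adj2_cancel:
  assumes "det g = 1"
  shows "adj2 g ** (g ** A) = A" "g ** (adj2 g ** A) = A"
  using assms by (simp_all add: matrix_mul_assoc)

lemma coset_image: "g <#\<^bsub>SL2\<^esub> \<Gamma> = (\<lambda>\<gamma>. g ** \<gamma>) ` \<Gamma>"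
  by (auto simp: l_coset_def)

locale lattice_measure =
  fixes \<Gamma> :: "(real^2^2) set" and \<mu> :: "(real^2^2) set measure"
  assumes subgroup: "subgroup \<Gamma> SL2" and discrete: "discrete \<Gamma>"
    and invariant: "invariant_probability \<Gamma> \<mu>"
begin

lemma det_Gamma: "\<gamma> \<in> \<Gamma> \<Longrightarrow> det \<gamma> = 1"
  using subgroup.subset[OF subgroup] by auto

lemma one_Gamma: "mat 1 \<in> \<Gamma>"
  using subgroup.one_closed[OF subgroup] by simp

lemma mult_Gamma: "\<gamma> \<in> \<Gamma> \<Longrightarrow> \<delta> \<in> \<Gamma> \<Longrightarrow> \<gamma> ** \<delta> \<in> \<Gamma>"
  using subgroup.m_closed[OF subgroup] by simp

lemma adj2_Gamma:
  assumes "\<gamma> \<in> \<Gamma>" shows "adj2 \<gamma> \<in> \<Gamma>"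
proof -
  have "inv\<^bsub>SL2\<^esub> \<gamma> = adj2 \<gamma>"
    using det_Gamma[OF assms] by (intro group.inv_equality[OF group_SL2]) auto
  then show ?thesis using subgroup.m_inv_closed[OF subgroup assms] by simp
qed

lemma cancel_Gamma:
  assumes "\<gamma> \<in> \<Gamma>"
  shows "A ** \<gamma> ** adj2 \<gamma> = A" "A ** adj2 \<gamma> ** \<gamma> = A"
  using det_Gamma[OF assms] by (simp_all flip: matrix_mul_assoc)

lemma bij_left: "\<gamma> \<in> \<Gamma> \<Longrightarrow> bij_betw (\<lambda>\<delta>. \<gamma> ** \<delta>) \<Gamma> \<Gamma>"
  by (rule bij_betwI[where g = "\<lambda>\<delta>. adj2 \<gamma> ** \<delta>"])
     (auto simp: mult_Gamma adj2_Gamma adj2_cancel det_Gamma)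

text \<open>The map \<open>(X, Y) \<mapsto> adj2 X ** Y\<close> is continuous and sends
  \<open>(A, A)\<close> to \<open>mat 1\<close>, an isolated point of \<Gamma>. \<open>A\<close>
  ranges over the whole group, which later also excludes limit points outside \<Gamma>.\<close>

lemma local_injectivity:
  assumes A: "det A = 1"
  obtains U where "open U" "A \<in> U"
    "\<And>X Y. X \<in> U \<Longrightarrow> Y \<in> U \<Longrightarrow> det X = 1 \<Longrightarrow> adj2 X ** Y \<in> \<Gamma> \<Longrightarrow> X = Y"
proof -
  obtain e where e: "e > 0" "\<And>\<gamma>. \<gamma> \<in> \<Gamma> \<Longrightarrow> dist (mat 1) \<gamma> < e \<Longrightarrow> \<gamma> = mat 1"
    using isolated_inE_dist[OF discreteD[OF discrete one_Gamma]] by metis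
  let ?W = "(\<lambda>p. adj2 (fst p) ** snd p) -` ball (mat 1) e"
  have "open ?W"
    by (intro open_vimage open_ball continuous_intros)
  moreover have "(A, A) \<in> ?W" using A e by simp
  ultimately obtain S T where ST: "open S" "open T" "A \<in> S" "A \<in> T" "S \<times> T \<subseteq> ?W"
    by (rule open_prod_elim) auto
  show ?thesis
  proof (rule that[of "S \<inter> T"])
    fix X Y assume *: "X \<in> S \<inter> T" "Y \<in> S \<inter> T" "det X = 1" "adj2 X ** Y \<in> \<Gamma>"
    then have "(X, Y) \<in> ?W" using ST by blast
    then have "adj2 X ** Y = mat 1" using e * by auto
    then have "X ** (adj2 X ** Y) = X" by simp
    then show "X = Y" using * by (simp add: adj2_cancel)
  qed (use ST in auto)
qed

text \<open>Discreteness is intrinsic to \<Gamma>, so a limit point could a priori lie outside it.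
  Such a point belongs to the closed set of determinant 1, and near it two distinct members of
  \<Gamma>, whose quotient is in \<Gamma>, would violate \<open>local_injectivity\<close>.\<close>

lemma finite_Gamma_bounded:
  assumes "bounded S" shows "finite (\<Gamma> \<inter> S)"
proof (rule ccontr)
  assume inf: "infinite (\<Gamma> \<inter> S)"
  have "bounded (\<Gamma> \<inter> S)" using assms by (rule bounded_subset) auto
  then have "compact (closure (\<Gamma> \<inter> S))" by simp
  then obtain A where A: "A islimpt (\<Gamma> \<inter> S)"
    using inf closure_subset[of "\<Gamma> \<inter> S"] unfolding compact_eq_Bolzano_Weierstrass by blast
  have "A \<in> {A. det A = 1}"
    using A closed_limpt[THEN iffD1, OF closed_SL2] islimpt_subset[OF A, of "{A. det A = 1}"] det_Gamma by auto
  then have "det A = 1" by simp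
  then obtain U where U: "open U" "A \<in> U"
    "\<And>X Y. X \<in> U \<Longrightarrow> Y \<in> U \<Longrightarrow> det X = 1 \<Longrightarrow> adj2 X ** Y \<in> \<Gamma> \<Longrightarrow> X = Y"
    using local_injectivity by blast
  have "infinite (\<Gamma> \<inter> S \<inter> U)"
    using A U by (metis Int_commute islimpt_eq_acc_point)
  then obtain X Y where "X \<in> \<Gamma> \<inter> S \<inter> U" "Y \<in> \<Gamma> \<inter> S \<inter> U" "X \<noteq> Y"
    by (metis finite.emptyI finite_insert finite_subset insertCI subsetI)
  then show False
    using U(3)[of X Y] det_Gamma adj2_Gamma mult_Gamma by auto
qed

lemma countable_Gamma: "countable \<Gamma>"
proof -
  have "\<Gamma> = (\<Union>n::nat. \<Gamma> \<inter> ball 0 (real n))"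
    using reals_Archimedean2 by auto
  then show ?thesis
    by (metis countable_UN countable_finite finite_Gamma_bounded bounded_ball countableI_type)
qed

lemma space_mu: "space \<mu> = lcosets\<^bsub>SL2\<^esub> \<Gamma>"
  and sets_mu: "sets \<mu> = sigma_sets (lcosets\<^bsub>SL2\<^esub> \<Gamma>) {U. openin (coset_topology \<Gamma>) U}"
proof -
  show s: "sets \<mu> = sigma_sets (lcosets\<^bsub>SL2\<^esub> \<Gamma>) {U. openin (coset_topology \<Gamma>) U}"
    using invariant by (simp add: invariant_probability_def)
  have "{U. openin (coset_topology \<Gamma>) U} \<subseteq> Pow (lcosets\<^bsub>SL2\<^esub> \<Gamma>)"
    using openin_coset_topology[OF subgroup] by auto
  then have "sets \<mu> = sets (sigma (lcosets\<^bsub>SL2\<^esub> \<Gamma>) {U. openin (coset_topology \<Gamma>) U})"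
    using s by simp
  then have "space \<mu> = space (sigma (lcosets\<^bsub>SL2\<^esub> \<Gamma>) {U. openin (coset_topology \<Gamma>) U})"
    by (rule sets_eq_imp_space_eq)
  then show "space \<mu> = lcosets\<^bsub>SL2\<^esub> \<Gamma>" by (simp add: space_measure_of_conv)
qed

lemma emeasure_space_mu: "emeasure \<mu> (space \<mu>) = 1"
  using invariant by (simp add: invariant_probability_def)

lemma finite_measure_mu: "finite_measure \<mu>"
  by (rule finite_measureI) (simp add: emeasure_space_mu)

sublocale finite_measure \<mu> by (rule finite_measure_mu)

lemma AE_obtain:
  assumes "AE C in \<mu>. P C" obtains C where "C \<in> space \<mu>" "P C"
proof -
  have "\<not> (\<forall>C\<in>space \<mu>. \<not> P C)"
  proof
    assume *: "\<forall>C\<in>space \<mu>. \<not> P C"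
    from assms AE_space have "AE C in \<mu>. False" by eventually_elim (use * in blast)
    then have "emeasure \<mu> (space \<mu>) = 0"
      using AE_iff_measurable[of "space \<mu>" \<mu> "\<lambda>_. False"] by simp
    then show False by (simp add: emeasure_space_mu)
  qed
  then show ?thesis using that by blast
qed

lemma coset_cases:
  assumes "C \<in> space \<mu>"
  obtains g where "det g = 1" "C = (\<lambda>\<gamma>. g ** \<gamma>) ` \<Gamma>"
  using assms by (auto simp: space_mu LCOSETS_def coset_image)

lemma coset_self: "det g = 1 \<Longrightarrow> g \<in> (\<lambda>\<gamma>. g ** \<gamma>) ` \<Gamma>"
  using one_Gamma by (auto intro: image_eqI[of _ _ "mat 1"])

lemma coset_space: "det g = 1 \<Longrightarrow> (\<lambda>\<gamma>. g ** \<gamma>) ` \<Gamma> \<in> space \<mu>"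
  by (auto simp: space_mu LCOSETS_def coset_image)

lemma coset_det: "C \<in> space \<mu> \<Longrightarrow> X \<in> C \<Longrightarrow> det X = 1"
  by (auto elim!: coset_cases simp: det_mul det_Gamma)

lemma coset_diff:
  assumes "C \<in> space \<mu>" "X \<in> C" "Y \<in> C" shows "adj2 X ** Y \<in> \<Gamma>"
proof -
  obtain g where g: "det g = 1" "C = (\<lambda>\<gamma>. g ** \<gamma>) ` \<Gamma>" using assms by (auto elim: coset_cases)
  then obtain \<gamma> \<delta> where *: "\<gamma> \<in> \<Gamma>" "\<delta> \<in> \<Gamma>" "X = g ** \<gamma>" "Y = g ** \<delta>" using assms by auto
  then have "adj2 X ** Y = adj2 \<gamma> ** \<delta>"
    using g by (simp add: adj2_prod adj2_cancel flip: matrix_mul_assoc)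
  then show ?thesis using * adj2_Gamma mult_Gamma by simp
qed

lemma coset_eq:
  assumes "C \<in> space \<mu>" "X \<in> C" shows "C = (\<lambda>\<gamma>. X ** \<gamma>) ` \<Gamma>"
proof
  show "C \<subseteq> (\<lambda>\<gamma>. X ** \<gamma>) ` \<Gamma>"
  proof
    fix Y assume "Y \<in> C"
    then have "Y = X ** (adj2 X ** Y)" "adj2 X ** Y \<in> \<Gamma>"
      using assms coset_diff coset_det by (simp_all add: adj2_cancel)
    then show "Y \<in> (\<lambda>\<gamma>. X ** \<gamma>) ` \<Gamma>" by blast
  qed
  obtain g where g: "det g = 1" "C = (\<lambda>\<gamma>. g ** \<gamma>) ` \<Gamma>" using assms by (auto elim: coset_cases)
  then show "(\<lambda>\<gamma>. X ** \<gamma>) ` \<Gamma> \<subseteq> C" using assms mult_Gamma by (auto simp flip: matrix_mul_assoc)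
qed

text \<open>Since \<open>\<Gamma>\<close> is discrete, the projection onto the cosets is injective on small open sets. Taking
  the first member of a countable cover by such sets yields a Borel section.\<close>

definition meets :: "(real^2^2) set \<Rightarrow> (real^2^2) set set"
  where "meets B = {C \<in> space \<mu>. C \<inter> B \<noteq> {}}"

lemma meets_open:
  assumes "open U" shows "meets U \<in> sets \<mu>"
proof -
  have "\<Union>(meets U) = {A. det A = 1} \<inter> (\<Union>\<gamma>\<in>\<Gamma>. (\<lambda>A. A ** \<gamma>) -` U)"
  proof safe
    fix A C assume "C \<in> meets U" "A \<in> C"
    then show "det A = 1" "A \<in> (\<Union>\<gamma>\<in>\<Gamma>. (\<lambda>A. A ** \<gamma>) -` U)"
      using coset_eq[of C A] coset_det by (auto simp: meets_def)
  next
    fix A \<gamma> assume "det A = 1" "\<gamma> \<in> \<Gamma>" "A ** \<gamma> \<in> U"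
    then show "A \<in> \<Union>(meets U)"
      using coset_space[of A] coset_self[of A] by (force simp: meets_def)
  qed
  moreover have "open (\<Union>\<gamma>\<in>\<Gamma>. (\<lambda>A. A ** \<gamma>) -` U)"
    by (intro open_UN ballI open_vimage assms continuous_intros)
  moreover have "carrier SL2 = {A. det A = 1}" by auto
  ultimately have "openin (coset_topology \<Gamma>) (meets U)"
    unfolding openin_coset_topology[OF subgroup]
    by (auto simp: openin_open meets_def space_mu)
  then show ?thesis by (simp add: sets_mu sigma_sets.Basic)
qed

definition slice :: "(real^2^2) set \<Rightarrow> bool"
  where "slice U \<longleftrightarrow> open U \<and> (\<forall>X\<in>U. \<forall>Y\<in>U. det X = 1 \<longrightarrow> adj2 X ** Y \<in> \<Gamma> \<longrightarrow> X = Y)"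

text \<open>Induction over the Borel sets. The complement is the critical case: a coset has at most
  one point in the slice, so it meets the complement there exactly if it meets the slice but not the
  set.\<close>

lemma meets_slice:
  assumes U: "slice U" and "B \<in> sets borel" shows "meets (B \<inter> U) \<in> sets \<mu>"
proof -
  have o: "open U" using U by (simp add: slice_def)
  have uniq: "X = Y" if "C \<in> space \<mu>" "X \<in> C" "Y \<in> C" "X \<in> U" "Y \<in> U" for C X Y
    using U coset_diff coset_det that by (auto simp: slice_def)
  have "B \<in> sigma_sets UNIV {S. open S}" using assms(2) by (simp add: borel_def)
  then show ?thesis
  proof induction
    case (Basic S) then show ?case using o by (auto intro!: meets_open)
  next
    case Empty show ?case by (simp add: meets_def)
  next
    case (Compl B)
    have "meets ((UNIV - B) \<inter> U) = meets U - meets (B \<inter> U)"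
      using uniq by (auto simp: meets_def)
    then show ?case using Compl meets_open[OF o] by auto
  next
    case (Union B)
    have "meets (\<Union>(range B) \<inter> U) = (\<Union>i. meets (B i \<inter> U))" by (auto simp: meets_def)
    then show ?case using Union by auto
  qed
qed

lemma ex_slices: "\<exists>W. (\<forall>n::nat. slice (W n)) \<and> {A. det A = 1} \<subseteq> (\<Union>n. W n)"
proof -
  have "open U" if "U \<in> {U. slice U}" for U using that by (simp add: slice_def)
  then obtain F where F: "F \<subseteq> {U. slice U}" "countable F" "\<Union>F = \<Union>{U. slice U}"
    by (rule Lindelof)
  have e: "slice {}" by (simp add: slice_def)
  have AF: "A \<in> \<Union>F" if d: "det A = 1" for A
  proof -
    obtain U where "open U" "A \<in> U"
      "\<And>X Y. X \<in> U \<Longrightarrow> Y \<in> U \<Longrightarrow> det X = 1 \<Longrightarrow> adj2 X ** Y \<in> \<Gamma> \<Longrightarrow> X = Y"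
      using local_injectivity[OF d] by blast
    then have "A \<in> U" "slice U" by (auto simp: slice_def)
    then show ?thesis using F by auto
  qed
  \<comment> \<open>The empty slice keeps the enumerated set nonempty, as
    \<open>range_from_nat_into\<close> requires.\<close>
  define W where "W = from_nat_into (insert {} F)"
  have W: "range W = insert {} F"
    using F unfolding W_def by (intro range_from_nat_into) auto
  have "slice (W n)" for n
  proof -
    have "W n \<in> insert {} F" using rangeI[of W n] unfolding W .
    then show ?thesis using F(1) e by auto
  qed
  moreover have "{A. det A = 1} \<subseteq> (\<Union>n. W n)"
  proof
    fix A :: "real^2^2" assume "A \<in> {A. det A = 1}"
    then have "A \<in> \<Union>F" using AF by simp
    then obtain U where "U \<in> F" "A \<in> U" by blast
    moreover from this have "U \<in> range W" unfolding W by simp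
    ultimately show "A \<in> (\<Union>n. W n)" by blast
  qed
  ultimately show ?thesis by blast
qed

definition slices :: "nat \<Rightarrow> (real^2^2) set"
  where "slices = (SOME W. (\<forall>n::nat. slice (W n)) \<and> {A. det A = 1} \<subseteq> (\<Union>n. W n))"

lemma slices: "slice (slices n)" "det A = 1 \<Longrightarrow> \<exists>n. A \<in> slices n"
proof -
  have "(\<forall>n. slice (slices n)) \<and> {A. det A = 1} \<subseteq> (\<Union>n. slices n)"
    unfolding slices_def by (rule someI_ex[OF ex_slices])
  then show "slice (slices n)" "det A = 1 \<Longrightarrow> \<exists>n. A \<in> slices n" by blast+
qed

definition sec :: "(real^2^2) set \<Rightarrow> real^2^2"
  where "sec C = (SOME A. A \<in> C \<inter> slices (LEAST n. C \<inter> slices n \<noteq> {}))"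

lemma sec_first:
  assumes "C \<in> space \<mu>" shows "sec C \<in> C \<inter> slices (LEAST n. C \<inter> slices n \<noteq> {})"
proof -
  obtain g where "det g = 1" "C = (\<lambda>\<gamma>. g ** \<gamma>) ` \<Gamma>" using assms by (auto elim: coset_cases)
  then have "\<exists>n. C \<inter> slices n \<noteq> {}" using slices(2)[of g] coset_self by blast
  then have "C \<inter> slices (LEAST n. C \<inter> slices n \<noteq> {}) \<noteq> {}" by (rule LeastI_ex)
  then have "\<exists>A. A \<in> C \<inter> slices (LEAST n. C \<inter> slices n \<noteq> {})" by blast
  then show ?thesis unfolding sec_def by (rule someI_ex)
qed

lemma sec_in: "C \<in> space \<mu> \<Longrightarrow> sec C \<in> C"
  using sec_first by auto

lemma det_sec: "C \<in> space \<mu> \<Longrightarrow> det (sec C) = 1"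
  using sec_in coset_det by blast

lemma sec_measurable [measurable]: "sec \<in> borel_measurable \<mu>"
proof (rule measurableI)
  fix B :: "(real^2^2) set" assume B: "B \<in> sets borel"
  \<comment> \<open>The cosets are sorted by the first slice \<open>n\<close> that they meet. The
    only point of the coset in that slice is \<open>sec C\<close>, so \<open>sec C \<in> B\<close>
    amounts to meeting \<open>B \<inter> slices n\<close>.\<close>
  have "sec -` B \<inter> space \<mu> = (\<Union>n. meets (B \<inter> slices n) - (\<Union>j<n. meets (UNIV \<inter> slices j)))" (is "?L = ?R")
  proof (intro equalityI subsetI)
    fix C assume "C \<in> ?L"
    then have C: "C \<in> space \<mu>" "sec C \<in> B" by auto
    define n where "n = (LEAST n. C \<inter> slices n \<noteq> {})"
    have "sec C \<in> C \<inter> slices n" using sec_first[OF C(1)] by (simp add: n_def)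
    moreover have "C \<inter> slices j = {}" if "j < n" for j
      using not_less_Least that unfolding n_def by blast
    ultimately show "C \<in> ?R" using C by (auto simp: meets_def)
  next
    fix C assume "C \<in> ?R"
    then obtain n A where C: "C \<in> space \<mu>" "A \<in> C" "A \<in> B" "A \<in> slices n" "\<And>j. j < n \<Longrightarrow> C \<inter> slices j = {}"
      by (auto simp: meets_def)
    have "(LEAST n. C \<inter> slices n \<noteq> {}) = n"
      using C by (intro Least_equality) (auto simp: not_less[symmetric])
    then have "sec C \<in> C \<inter> slices n" using sec_first C by auto
    then have "sec C = A"
      using slices(1)[of n] C coset_det coset_diff by (auto simp: slice_def)
    then show "C \<in> ?L" using C by simp
  qed
  also have "\<dots> \<in> sets \<mu>"
    using meets_slice[OF slices(1) B] meets_slice[OF slices(1), of UNIV]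
    by (intro sets.countable_UN' sets.Diff sets.finite_UN ballI) (auto intro!: sets.Diff sets.finite_UN)
  finally show "sec -` B \<inter> space \<mu> \<in> sets \<mu>" .
qed simp

section \<open>The unfolded measure on the group and its invariance\<close>

text \<open>The sum over \<Gamma> does not depend on the representative, since another point of the
  coset permutes the summands; \<open>sec\<close> is a measurable choice.\<close>

definition gint :: "(real^2^2 \<Rightarrow> ennreal) \<Rightarrow> ennreal"
  where "gint F = (\<integral>\<^sup>+C. \<integral>\<^sup>+\<gamma>. F (sec C ** \<gamma>) \<partial>count_space \<Gamma> \<partial>\<mu>)"

lemma sigma_finite_count: "sigma_finite_measure (count_space \<Gamma>)"
  by (rule sigma_finite_measure_count_space_countable[OF countable_Gamma])

lemma sec_mult_measurable: "(\<lambda>p. sec (fst p) ** snd p) \<in> borel_measurable (\<mu> \<Otimes>\<^sub>M count_space \<Gamma>)"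
proof -
  have "snd \<in> \<mu> \<Otimes>\<^sub>M count_space \<Gamma> \<rightarrow>\<^sub>M borel"
    by (rule measurable_compose[OF measurable_snd]) simp
  from borel_mat2_mult[OF measurable_compose[OF measurable_fst sec_measurable] this]
  show ?thesis .
qed

lemma fold_measurable:
  assumes [measurable]: "F \<in> borel_measurable borel"
  shows "(\<lambda>C. \<integral>\<^sup>+\<gamma>. F (sec C ** \<gamma>) \<partial>count_space \<Gamma>) \<in> borel_measurable \<mu>"
proof -
  interpret sigma_finite_measure "count_space \<Gamma>" by (rule sigma_finite_count)
  show ?thesis
    using measurable_compose[OF sec_mult_measurable assms]
    by (intro borel_measurable_nn_integral) (simp add: split_def)
qed

lemma gint_cong: "(\<And>A. det A = 1 \<Longrightarrow> F A = G A) \<Longrightarrow> gint F = gint G"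
  unfolding gint_def by (intro nn_integral_cong) (simp add: det_mul det_sec det_Gamma)

text \<open>It suffices to test open sets of cosets. Taking unions turns them into open sets of
  matrices, on which left multiplication is continuous.\<close>

lemma translate_measurable:
  assumes g: "det g = 1" shows "(\<lambda>C. g <#\<^bsub>SL2\<^esub> C) \<in> \<mu> \<rightarrow>\<^sub>M \<mu>"
proof (rule measurable_sigma_sets[OF sets_mu])
  show "{U. openin (coset_topology \<Gamma>) U} \<subseteq> Pow (lcosets\<^bsub>SL2\<^esub> \<Gamma>)"
    using openin_coset_topology[OF subgroup] by auto
  show "(\<lambda>C. g <#\<^bsub>SL2\<^esub> C) \<in> space \<mu> \<rightarrow> lcosets\<^bsub>SL2\<^esub> \<Gamma>"
  proof
    fix C assume "C \<in> space \<mu>"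
    then obtain h where h: "det h = 1" "C = (\<lambda>\<gamma>. h ** \<gamma>) ` \<Gamma>" by (rule coset_cases)
    then have "g <#\<^bsub>SL2\<^esub> C = (\<lambda>\<gamma>. (g ** h) ** \<gamma>) ` \<Gamma>"
      by (simp add: coset_image image_image matrix_mul_assoc)
    then show "g <#\<^bsub>SL2\<^esub> C \<in> lcosets\<^bsub>SL2\<^esub> \<Gamma>"
      using coset_space[of "g ** h"] g h by (simp add: det_mul space_mu)
  qed
  fix U assume "U \<in> {U. openin (coset_topology \<Gamma>) U}"
  then have U: "U \<subseteq> space \<mu>" "openin (top_of_set (carrier SL2)) (\<Union>U)"
    using openin_coset_topology[OF subgroup] by (auto simp: space_mu)
  then obtain T where T: "open T" "\<Union>U = {A. det A = 1} \<inter> T" by (auto simp: openin_open SL2_def)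
  let ?P = "(\<lambda>C. g <#\<^bsub>SL2\<^esub> C) -` U \<inter> space \<mu>"
  have "\<Union>?P = {A. det A = 1} \<inter> (\<lambda>A. g ** A) -` T"
  proof (intro equalityI subsetI)
    fix A assume "A \<in> \<Union>?P"
    then obtain C where C: "C \<in> space \<mu>" "g <#\<^bsub>SL2\<^esub> C \<in> U" "A \<in> C" by auto
    then have "g ** A \<in> \<Union>U" by (auto simp: coset_image)
    then show "A \<in> {A. det A = 1} \<inter> (\<lambda>A. g ** A) -` T" using T C coset_det by auto
  next
    fix A assume A: "A \<in> {A. det A = 1} \<inter> (\<lambda>A. g ** A) -` T"
    then have "g ** A \<in> \<Union>U" using T g by (simp add: det_mul)
    then obtain D where D: "D \<in> U" "g ** A \<in> D" by auto
    then have "D = (\<lambda>\<gamma>. g ** A ** \<gamma>) ` \<Gamma>" using coset_eq U by blast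
    then have "g <#\<^bsub>SL2\<^esub> ((\<lambda>\<gamma>. A ** \<gamma>) ` \<Gamma>) = D"
      by (simp add: coset_image image_image matrix_mul_assoc)
    then show "A \<in> \<Union>?P" using A D coset_space[of A] coset_self[of A] by blast
  qed
  moreover have "open ((\<lambda>A. g ** A) -` T)" by (intro open_vimage T continuous_intros)
  ultimately have "openin (coset_topology \<Gamma>) ?P"
    unfolding openin_coset_topology[OF subgroup] by (auto simp: openin_open SL2_def space_mu)
  then show "?P \<in> sets \<mu>" by (simp add: sets_mu sigma_sets.Basic)
qed

lemma translate_cancel: "det g = 1 \<Longrightarrow> C \<in> space \<mu> \<Longrightarrow> adj2 g <#\<^bsub>SL2\<^esub> (g <#\<^bsub>SL2\<^esub> C) = C"
  by (simp add: coset_image image_image adj2_cancel)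

text \<open>Invariance is assumed for direct images, whereas \<open>distr\<close> uses preimages;
  the preimage under \<open>g\<close> is the image under \<open>adj2 g\<close>.\<close>

lemma distr_translate:
  assumes g: "det g = 1" shows "distr \<mu> \<mu> (\<lambda>C. g <#\<^bsub>SL2\<^esub> C) = \<mu>"
proof (rule measure_eqI)
  fix A assume "A \<in> sets (distr \<mu> \<mu> (\<lambda>C. g <#\<^bsub>SL2\<^esub> C))"
  then have A: "A \<in> sets \<mu>" by simp
  have sp: "(\<lambda>C. h <#\<^bsub>SL2\<^esub> C) ` A \<subseteq> space \<mu>" if "det h = 1" for h
    using measurable_space[OF translate_measurable[OF that]] sets.sets_into_space[OF A] by auto
  have "(\<lambda>C. g <#\<^bsub>SL2\<^esub> C) -` A \<inter> space \<mu> = (\<lambda>C. adj2 g <#\<^bsub>SL2\<^esub> C) ` A"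
  proof (intro equalityI subsetI)
    fix C assume "C \<in> (\<lambda>C. g <#\<^bsub>SL2\<^esub> C) -` A \<inter> space \<mu>"
    then show "C \<in> (\<lambda>C. adj2 g <#\<^bsub>SL2\<^esub> C) ` A"
      using translate_cancel[OF g, of C] by (auto intro!: image_eqI[of _ _ "g <#\<^bsub>SL2\<^esub> C"])
  next
    fix C assume "C \<in> (\<lambda>C. adj2 g <#\<^bsub>SL2\<^esub> C) ` A"
    then show "C \<in> (\<lambda>C. g <#\<^bsub>SL2\<^esub> C) -` A \<inter> space \<mu>"
      using sp[of "adj2 g"] g translate_cancel[of "adj2 g"] sets.sets_into_space[OF A] by auto
  qed
  moreover have "emeasure \<mu> ((\<lambda>C. adj2 g <#\<^bsub>SL2\<^esub> C) ` A) = emeasure \<mu> A"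
    using invariant A g by (simp add: invariant_probability_def)
  ultimately show "emeasure (distr \<mu> \<mu> (\<lambda>C. g <#\<^bsub>SL2\<^esub> C)) A = emeasure \<mu> A"
    using A by (simp add: emeasure_distr translate_measurable[OF g])
qed simp

lemma nn_integral_Gamma_translate:
  assumes "\<gamma> \<in> \<Gamma>" shows "(\<integral>\<^sup>+\<delta>. F (\<gamma> ** \<delta>) \<partial>count_space \<Gamma>) = (\<integral>\<^sup>+\<delta>. F \<delta> \<partial>count_space \<Gamma>)"
  by (rule nn_integral_bij_count_space[OF bij_left[OF assms]])

text \<open>The representative \<open>sec\<close> of the translated coset and
  \<open>g ** sec C\<close> differ by an element of \<Gamma> on the right, which the sum over
  \<Gamma> absorbs. What remains is the invariance of \<mu>.\<close>

lemma gint_left: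
  assumes [measurable]: "F \<in> borel_measurable borel" and g: "det g = 1"
  shows "gint (\<lambda>A. F (g ** A)) = gint F"
proof -
  let ?\<Phi> = "\<lambda>A. \<integral>\<^sup>+\<gamma>. F (A ** \<gamma>) \<partial>count_space \<Gamma>"
  have "gint (\<lambda>A. F (g ** A)) = (\<integral>\<^sup>+C. ?\<Phi> (sec (g <#\<^bsub>SL2\<^esub> C)) \<partial>\<mu>)"
    unfolding gint_def
  proof (rule nn_integral_cong)
    fix C assume C: "C \<in> space \<mu>"
    then have gC: "g <#\<^bsub>SL2\<^esub> C \<in> space \<mu>" by (rule measurable_space[OF translate_measurable[OF g]])
    have "g ** sec C \<in> g <#\<^bsub>SL2\<^esub> C" using sec_in[OF C] by (auto simp: coset_image)
    then obtain \<gamma> where \<gamma>: "\<gamma> \<in> \<Gamma>" "sec (g <#\<^bsub>SL2\<^esub> C) = g ** sec C ** \<gamma>"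
      using coset_eq[OF gC] sec_in[OF gC] by blast
    have "?\<Phi> (sec (g <#\<^bsub>SL2\<^esub> C)) = ?\<Phi> (g ** sec C)"
      using nn_integral_Gamma_translate[OF \<gamma>(1), of "\<lambda>\<gamma>. F (g ** sec C ** \<gamma>)"]
      by (simp add: \<gamma>(2) matrix_mul_assoc)
    then show "(\<integral>\<^sup>+\<gamma>. F (g ** (sec C ** \<gamma>)) \<partial>count_space \<Gamma>) = ?\<Phi> (sec (g <#\<^bsub>SL2\<^esub> C))"
      by (simp add: matrix_mul_assoc)
  qed
  also have "\<dots> = (\<integral>\<^sup>+C. ?\<Phi> (sec C) \<partial>distr \<mu> \<mu> (\<lambda>C. g <#\<^bsub>SL2\<^esub> C))"
    by (rule nn_integral_distr[symmetric, OF translate_measurable[OF g]]) (simp add: fold_measurable)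
  also have "\<dots> = gint F"
    by (simp add: distr_translate[OF g] gint_def)
  finally show ?thesis .
qed

text \<open>Both functionals integrate the pullback along a measurable map, \<open>a\<close> or
  \<open>b\<close>, from a sigma-finite product space, so Tonelli's theorem applies. Countability of
  \<Gamma> makes its counting measure sigma-finite.\<close>

lemma gint_haar_swap:
  assumes [measurable]: "(\<lambda>(X, Y). H X Y) \<in> borel_measurable (borel \<Otimes>\<^sub>M borel)"
  shows "gint (\<lambda>X. haar (\<lambda>Y. H X Y)) = haar (\<lambda>Y. gint (\<lambda>X. H X Y))"
proof -
  let ?K = "\<mu> \<Otimes>\<^sub>M count_space \<Gamma>" and ?L = "lborel \<Otimes>\<^sub>M lborel :: ((real^2) \<times> real) measure"
  define a where "a p = sec (fst p) ** snd p" for p :: "(real^2^2) set \<times> (real^2^2)"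
  define b where "b q = col_matrix (fst q) (snd q *\<^sub>R fst q + dual_vec (fst q))" for q :: "(real^2) \<times> real"
  interpret c: sigma_finite_measure "count_space \<Gamma>" by (rule sigma_finite_count)
  interpret mc: pair_sigma_finite \<mu> "count_space \<Gamma>" ..
  interpret K: sigma_finite_measure ?K ..
  interpret L: sigma_finite_measure ?L ..
  interpret KL: pair_sigma_finite ?K ?L ..
  have a [measurable]: "a \<in> borel_measurable ?K"
    using sec_mult_measurable by (simp add: a_def[abs_def])
  have b [measurable]: "b \<in> borel_measurable ?L"
    unfolding b_def by measurable
  have gint: "gint F = (\<integral>\<^sup>+p. F (a p) \<partial>?K)" if [measurable]: "F \<in> borel_measurable borel" for F
  proof -
    have "(\<lambda>p. F (a p)) \<in> borel_measurable ?K" by measurable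
    from c.nn_integral_fst[OF this] show ?thesis by (simp add: gint_def a_def)
  qed
  have haar: "haar F = (\<integral>\<^sup>+q. F (b q) \<partial>?L)" if [measurable]: "F \<in> borel_measurable borel" for F
    by (subst lborel.nn_integral_fst[symmetric]) (simp_all add: haar_def b_def)
  have "gint (\<lambda>X. haar (\<lambda>Y. H X Y)) = (\<integral>\<^sup>+p. \<integral>\<^sup>+q. H (a p) (b q) \<partial>?L \<partial>?K)"
    by (simp add: haar gint)
  also have "\<dots> = (\<integral>\<^sup>+q. \<integral>\<^sup>+p. H (a p) (b q) \<partial>?K \<partial>?L)"
    by (rule KL.Fubini'[symmetric]) measurable
  also have "\<dots> = haar (\<lambda>Y. gint (\<lambda>X. H X Y))"
    by (simp add: haar gint)
  finally show ?thesis .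
qed

end

lemma haar_cong:
  assumes "\<And>A. det A = 1 \<Longrightarrow> F A = G A" shows "haar F = haar G"
  unfolding haar_def
proof (rule nn_integral_cong_AE, use AE_vec2_nonzero in eventually_elim)
  case (elim x)
  have "det_cols x (t *\<^sub>R x + dual_vec x) = 1" for t
    using det_dual_vec[OF elim] by (simp add: det_cols_eq algebra_simps)
  then show ?case using assms by simp
qed

lemma haar_cmult:
  assumes [measurable]: "F \<in> borel_measurable borel"
  shows "haar (\<lambda>A. c * F A) = c * haar F"
  unfolding haar_def by (simp add: nn_integral_cmult)

context lattice_measure
begin

lemma gint_multc:
  assumes [measurable]: "F \<in> borel_measurable borel"
  shows "gint (\<lambda>A. F A * c) = gint F * c"
  unfolding gint_def by (simp add: nn_integral_multc fold_measurable)

text \<open>Uniqueness of Haar measure, by Fubini's theorem applied to \<open>\<phi> x * \<psi> (y x)\<close>.\<close>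

theorem gint_haar_unique:
  assumes [measurable]: "\<phi> \<in> borel_measurable borel" "\<psi> \<in> borel_measurable borel"
  shows "gint \<phi> * haar \<psi> = gint \<psi> * haar \<phi>"
proof -
  have "gint \<phi> * haar \<psi> = gint (\<lambda>X. \<phi> X * haar \<psi>)"
    by (simp add: gint_multc)
  \<comment> \<open>Right invariance of \<open>haar\<close> introduces the shift by
    \<open>X\<close>. Below, left invariance of \<open>gint\<close> moves it from \<psi> to \<phi>,
    where inversion and right invariance of \<open>haar\<close> remove it.\<close>
  also have "\<dots> = gint (\<lambda>X. haar (\<lambda>Y. \<phi> X * \<psi> (Y ** X)))"
    by (rule gint_cong) (simp add: haar_cmult haar_right)
  also have "\<dots> = haar (\<lambda>Y. gint (\<lambda>X. \<phi> X * \<psi> (Y ** X)))"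
    by (rule gint_haar_swap) measurable
  also have "\<dots> = haar (\<lambda>Y. gint (\<lambda>X. \<phi> (adj2 Y ** X) * \<psi> X))"
  proof (rule haar_cong)
    fix Y :: "real^2^2" assume Y: "det Y = 1"
    have "gint (\<lambda>X. \<phi> (adj2 Y ** (Y ** X)) * \<psi> (Y ** X)) = gint (\<lambda>X. \<phi> (adj2 Y ** X) * \<psi> X)"
      by (rule gint_left[OF _ Y]) measurable
    then show "gint (\<lambda>X. \<phi> X * \<psi> (Y ** X)) = gint (\<lambda>X. \<phi> (adj2 Y ** X) * \<psi> X)"
      by (simp add: adj2_cancel[OF Y])
  qed
  also have "\<dots> = gint (\<lambda>X. haar (\<lambda>Y. \<phi> (adj2 Y ** X) * \<psi> X))"
    by (rule gint_haar_swap[symmetric]) measurable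
  also have "\<dots> = gint (\<lambda>X. \<psi> X * haar \<phi>)"
  proof (rule gint_cong)
    fix X :: "real^2^2" assume X: "det X = 1"
    have "haar (\<lambda>Y. \<phi> (adj2 Y ** X)) = haar (\<lambda>Y. \<phi> (Y ** X))"
      by (rule haar_adj2[where F = "\<lambda>Y. \<phi> (Y ** X)"]) measurable
    also have "\<dots> = haar \<phi>" by (rule haar_right[OF _ X]) measurable
    finally show "haar (\<lambda>Y. \<phi> (adj2 Y ** X) * \<psi> X) = \<psi> X * haar \<phi>"
      by (simp add: haar_cmult mult.commute[of _ "\<psi> X"])
  qed
  also have "\<dots> = gint \<psi> * haar \<phi>" by (rule gint_multc) measurable
  finally show ?thesis .
qed

end


section \<open>Haar measure and hyperbolic area\<close>

lemma act_eq: "act A z = (of_real (A$1$1) * z + of_real (A$1$2)) / (of_real (A$2$1) * z + of_real (A$2$2))"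
  by (simp add: act_def moebius_def)

lemma act_denom_nonzero:
  fixes A :: "real^2^2"
  assumes "det A = 1" "Im z > 0" shows "of_real (A$2$1) * z + of_real (A$2$2) \<noteq> 0"
proof
  assume *: "of_real (A$2$1) * z + of_real (A$2$2) = 0"
  from arg_cong[OF *, of Im] have c: "A$2$1 = 0" using assms by simp
  with arg_cong[OF *, of Re] have "A$2$2 = 0" by simp
  with c assms(1) show False by (simp add: det_2)
qed

lemma Im_act:
  assumes "det A = 1" "Im z > 0"
  shows "Im (act A z) = Im z / (cmod (of_real (A$2$1) * z + of_real (A$2$2)))\<^sup>2"
proof -
  have "Im ((of_real (A$1$1) * z + of_real (A$1$2)) * cnj (of_real (A$2$1) * z + of_real (A$2$2))) = det A * Im z"
    by (simp add: det_2 algebra_simps)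
  then show ?thesis
    using assms(1) by (subst act_eq, subst complex_div_cnj) simp
qed

lemma Im_act_pos: "det A = 1 \<Longrightarrow> Im z > 0 \<Longrightarrow> Im (act A z) > 0"
  using act_denom_nonzero by (simp add: Im_act)

lemma act_mult:
  assumes "det A = 1" "det B = 1" "Im z > 0" shows "act (A ** B) z = act A (act B z)"
proof -
  let ?n = "of_real (B$1$1) * z + of_real (B$1$2)" and ?d = "of_real (B$2$1) * z + of_real (B$2$2)"
  have d: "?d \<noteq> 0" by (rule act_denom_nonzero[OF assms(2,3)])
  have e: "of_real (A$i$1) * (?n / ?d) + of_real (A$i$2) = (of_real ((A ** B)$i$1) * z + of_real ((A ** B)$i$2)) / ?d" for i
    using d by (simp add: field_simps)
  show ?thesis
    using d by (simp only: act_eq e) simp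
qed

lemma act_one [simp]: "act (mat 1) z = z"
  by (simp add: act_eq)

lemma act_uminus [simp]: "act (- A) z = act A z"
proof -
  have "act (- A) z = (- (of_real (A$1$1) * z + of_real (A$1$2))) / (- (of_real (A$2$1) * z + of_real (A$2$2)))"
    by (simp add: act_eq)
  then show ?thesis by (simp only: minus_divide_divide act_eq)
qed

lemma act_measurable [measurable (raw)]:
  assumes [measurable]: "f \<in> borel_measurable M" "g \<in> borel_measurable M"
  shows "(\<lambda>w. act (f w) (g w)) \<in> borel_measurable M"
  unfolding act_eq by measurable

lemma act_base_point:
  assumes "x \<noteq> 0"
  shows "act (adj2 (col_matrix x (t *\<^sub>R x + dual_vec x))) \<i> = Complex (- t) (1 / ((x$1)\<^sup>2 + (x$2)\<^sup>2))"
proof -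
  define r where "r = (x$1)\<^sup>2 + (x$2)\<^sup>2"
  have r: "r > 0" using assms vec2_nonzero by (simp add: r_def)
  have nz: "of_real (- x$2) * \<i> + of_real (x$1) \<noteq> 0"
    using assms by (auto simp: complex_eq_iff vec2_eq_iff)
  have "of_real (t * x$2 + x$1 / r) * \<i> + of_real (- (t * x$1 - x$2 / r)) =
      Complex (- t) (1 / r) * (of_real (- x$2) * \<i> + of_real (x$1))"
    using r by (simp add: complex_eq_iff field_simps)
  then have "(of_real (t * x$2 + x$1 / r) * \<i> + of_real (- (t * x$1 - x$2 / r))) / (of_real (- x$2) * \<i> + of_real (x$1)) = Complex (- t) (1 / r)"
    using nz by (simp add: divide_simps)
  moreover have "adj2 (col_matrix x (t *\<^sub>R x + dual_vec x)) $ 1 $ 1 = t * x$2 + x$1 / r"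
    "adj2 (col_matrix x (t *\<^sub>R x + dual_vec x)) $ 1 $ 2 = - (t * x$1 - x$2 / r)"
    by (simp_all add: dual_vec_def r_def divide_inverse mult.commute)
  ultimately show ?thesis by (simp add: act_eq r_def)
qed

text \<open>The measures may be infinite near 0, so the uniqueness theorem does not apply to them
  directly. Restricted to the ray above \<open>1 / (n + 1)\<close> they are finite and agree on all
  rays; the supremum over \<open>n\<close> recovers them up to the null set of nonpositive
  numbers.\<close>

lemma measure_eqI_greaterThan_pos:
  fixes M N :: "real measure"
  assumes sets [simp, measurable_cong]: "sets M = sets borel" "sets N = sets borel"
    and eq: "\<And>c. c > 0 \<Longrightarrow> emeasure M {c<..} = emeasure N {c<..}"
    and fin: "\<And>c. c > 0 \<Longrightarrow> emeasure M {c<..} \<noteq> \<infinity>"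
    and null: "emeasure M {..0} = 0" "emeasure N {..0} = 0"
  shows "M = N"
proof -
  define cut where "cut K n = density K (indicator {1 / real (Suc n)<..})" for K :: "real measure" and n
  have cut: "emeasure (cut K n) A = emeasure K (A \<inter> {1 / real (Suc n)<..})"
    if "sets K = sets borel" "A \<in> sets borel" for K A n
    using that by (auto simp: cut_def emeasure_density indicator_inter_arith[symmetric] mult.commute
        cong: measurable_cong_sets)
  have cut_eq: "cut M n = cut N n" for n
  proof (rule measure_eqI_generator_eq[where \<Omega> = UNIV and E = "range greaterThan" and A = "\<lambda>i. {- real i<..}"])
    show "Int_stable (range greaterThan :: real set set)"
    proof (rule Int_stableI)
      fix A B :: "real set" assume "A \<in> range greaterThan" "B \<in> range greaterThan"
      then obtain a b where "A = {a<..}" "B = {b<..}" by auto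
      then have "A \<inter> B = {max a b<..}" by auto
      then show "A \<inter> B \<in> range greaterThan" by simp
    qed
    show "sets (cut M n) = sigma_sets UNIV (range greaterThan)" "sets (cut N n) = sigma_sets UNIV (range greaterThan)"
      by (simp_all add: cut_def borel_Ioi)
    fix X :: "real set" assume "X \<in> range greaterThan"
    then obtain c where X: "X = {c<..}" by auto
    have "{c<..} \<inter> {1 / real (Suc n)<..} = {max c (1 / real (Suc n))<..}" by auto
    then show "emeasure (cut M n) X = emeasure (cut N n) X"
      by (simp add: X cut eq less_max_iff_disj)
  next
    fix i
    have "- real i < x" if "1 / real (Suc n) < x" for x
    proof -
      have "0 < 1 / real (Suc n)" by simp
      then show ?thesis using that by linarith
    qed
    then have "{- real i<..} \<inter> {1 / real (Suc n)<..} = {1 / real (Suc n)<..}"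
      by (auto simp del: of_nat_Suc)
    then show "emeasure (cut M n) {- real i<..} \<noteq> \<infinity>"
      using fin by (simp add: cut)
  next
    have "\<exists>i. - real i < x" for x using reals_Archimedean2[of "- x"] by (auto intro: exI simp: minus_less_iff)
    then show "(\<Union>i. {- real i<..}) = UNIV" by auto
  qed auto
  have split: "emeasure K A = (SUP n. emeasure (cut K n) A)"
    if K [simp, measurable_cong]: "sets K = sets borel" and K0: "emeasure K {..0} = 0" and A: "A \<in> sets borel" for K A
  proof -
    have "emeasure K A = emeasure K (A - {..0})"
      using K0 A by (intro emeasure_Diff_null_set[symmetric]) (auto simp: null_sets_def)
    also have "A - {..0} = (\<Union>n. A \<inter> {1 / real (Suc n)<..})"
    proof -
      have ex: "\<exists>n. 1 / real (Suc n) < x" if "x > 0" for x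
        using nat_approx_posE[OF that] by blast
      have pos: "x > 0" if "1 / real (Suc n) < x" for x n
        using that by (rule order.strict_trans[rotated]) simp
      have "{0<..} = (\<Union>n. {1 / real (Suc n)<..})"
      proof (intro equalityI subsetI)
        fix x :: real assume "x \<in> {0<..}"
        then obtain n where "1 / real (Suc n) < x" using ex[of x] by auto
        then show "x \<in> (\<Union>n. {1 / real (Suc n)<..})" by (intro UN_I[of n]) (simp_all del: of_nat_Suc)
      next
        fix x :: real assume "x \<in> (\<Union>n. {1 / real (Suc n)<..})"
        then obtain n where "x \<in> {1 / real (Suc n)<..}" by (rule UN_E)
        then have "1 / real (Suc n) < x" by (simp only: greaterThan_iff)
        then show "x \<in> {0<..}" using pos by simp
      qed
      moreover have "A - {..0} = A \<inter> {0<..}" by auto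
      ultimately show ?thesis by simp
    qed
    also have "emeasure K \<dots> = (SUP n. emeasure K (A \<inter> {1 / real (Suc n)<..}))"
    proof (rule SUP_emeasure_incseq[symmetric])
      have "1 / real (Suc (Suc n)) \<le> 1 / real (Suc n)" for n by (simp add: field_simps)
      then show "incseq (\<lambda>n. A \<inter> {1 / real (Suc n)<..})"
        by (intro incseq_SucI) (meson Int_mono greaterThan_subset_iff order_refl)
    qed (use A in auto)
    finally show ?thesis using A by (simp add: cut)
  qed
  show ?thesis
    by (rule measure_eqI) (simp_all add: split null cut_eq)
qed

lemma norm_vec2: "norm (x::real^2) = sqrt ((x$1)\<^sup>2 + (x$2)\<^sup>2)"
  by (simp add: norm_vec_def L2_set_def UNIV_2)

text \<open>The function exceeds \<open>c\<close> on the punctured disc of radius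
  \<open>1 / sqrt c\<close>, of area \<open>pi / c\<close>, which is also the integral of
  \<open>pi / v\<^sup>2\<close> over \<open>v > c\<close>. At the origin division by zero yields 0,
  which is not above \<open>c\<close>.\<close>

lemma distr_inverse_norm_square:
  "distr lborel borel (\<lambda>x::real^2. 1 / ((x$1)\<^sup>2 + (x$2)\<^sup>2)) =
    density lborel (\<lambda>v. ennreal (pi * indicator {0<..} v / v\<^sup>2))" (is "?M = ?N")
proof (rule measure_eqI_greaterThan_pos)
  have M: "emeasure ?M A = emeasure lborel {x::real^2. 1 / ((x$1)\<^sup>2 + (x$2)\<^sup>2) \<in> A}"
    if "A \<in> sets borel" for A
    using that by (subst emeasure_distr) (auto simp: vimage_def)
  have fin: "emeasure ?M {c<..} = ennreal (pi / c)" if c: "c > 0" for c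
  proof -
    have "{x::real^2. 1 / ((x$1)\<^sup>2 + (x$2)\<^sup>2) \<in> {c<..}} = ball 0 (1 / sqrt c) - {0}"
    proof -
      have "c < 1 / ((x$1)\<^sup>2 + (x$2)\<^sup>2) \<longleftrightarrow> norm x < 1 / sqrt c" if "x \<noteq> 0" for x :: "real^2"
      proof -
        have "norm x < 1 / sqrt c \<longleftrightarrow> sqrt ((x$1)\<^sup>2 + (x$2)\<^sup>2) < sqrt (1 / c)"
          by (simp add: norm_vec2 real_sqrt_divide)
        also have "\<dots> \<longleftrightarrow> (x$1)\<^sup>2 + (x$2)\<^sup>2 < 1 / c" by simp
        also have "\<dots> \<longleftrightarrow> c < 1 / ((x$1)\<^sup>2 + (x$2)\<^sup>2)"
          using c that vec2_nonzero[of x] by (simp add: field_simps)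
        finally show ?thesis by simp
      qed
      then have "x \<in> {x. 1 / ((x$1)\<^sup>2 + (x$2)\<^sup>2) \<in> {c<..}} \<longleftrightarrow> x \<in> ball 0 (1 / sqrt c) - {0}" for x :: "real^2"
        using c by (cases "x = 0") (simp_all add: dist_norm)
      then show ?thesis by blast
    qed
    moreover have "emeasure lborel (ball (0::real^2) (1 / sqrt c) - {0}) = emeasure lborel (ball (0::real^2) (1 / sqrt c))"
      by (rule emeasure_Diff_null_set) auto
    moreover have "emeasure lborel (ball (0::real^2) (1 / sqrt c)) = ennreal (pi / c)"
      using c by (subst emeasure_ball) (simp_all add: unit_ball_vol_2 power_divide)
    ultimately show ?thesis by (simp add: M)
  qed
  show "emeasure ?M {c<..} = emeasure ?N {c<..}" if c: "c > 0" for c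
  proof -
    \<comment> \<open>The endpoint is a null set and is added because the fundamental theorem of
      calculus is available for closed rays.\<close>
    have "emeasure ?N {c<..} = (\<integral>\<^sup>+v. ennreal (pi / v\<^sup>2) * indicator {c..} v \<partial>lborel)"
      using c by (subst emeasure_density)
        (auto intro!: nn_integral_cong_AE eventually_mono[OF AE_lborel_singleton[of c]] simp: indicator_def)
    also have "\<dots> = ennreal (0 - (- pi / c))"
    proof (rule nn_integral_FTC_atLeast)
      show "((\<lambda>v. - pi / v) has_real_derivative pi / v\<^sup>2) (at v)" if "c \<le> v" for v
        using c that by (auto intro!: derivative_eq_intros simp: power2_eq_square)
      show "((\<lambda>v. - pi / v) \<longlongrightarrow> 0) at_top"
        by (intro tendsto_divide_0[OF tendsto_const] filterlim_at_top_imp_at_infinity filterlim_ident)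
    qed simp_all
    finally show ?thesis using fin[OF c] by simp
  qed
  show "emeasure ?M {c<..} \<noteq> \<infinity>" if "c > 0" for c
    using fin[OF that] by simp
  have "{x::real^2. 1 / ((x$1)\<^sup>2 + (x$2)\<^sup>2) \<in> {..0}} = {0}"
    using vec2_nonzero by (auto simp: divide_le_0_iff not_le[symmetric])
  then show "emeasure ?M {..0} = 0" by (subst M) simp_all
  show "emeasure ?N {..0} = 0"
    by (subst emeasure_density) (auto simp: indicator_def nn_integral_0_iff_AE)
qed simp_all

text \<open>By \<open>act_base_point\<close> the real part is \<open>- t\<close>, which is Lebesgue
  distributed, and the imaginary part depends on \<open>x\<close> alone with density
  \<open>pi / v\<^sup>2\<close>. The factor \<open>pi\<close> is thus the area of the unit
  disc.\<close>

theorem haar_hyperbolic_area: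
  assumes [measurable]: "S \<in> sets borel"
  shows "haar (\<lambda>g. indicator S (act (adj2 g) \<i>)) = ennreal pi * emeasure hyperbolic_area S"
proof -
  define h where "h v = (\<integral>\<^sup>+t. indicator S (Complex t v) \<partial>lborel)" for v
  have [measurable]: "h \<in> borel_measurable borel"
    unfolding h_def by measurable
  have "haar (\<lambda>g. indicator S (act (adj2 g) \<i>)) = (\<integral>\<^sup>+x. h (1 / ((x$1)\<^sup>2 + (x$2)\<^sup>2)) \<partial>(lborel::(real^2) measure))"
    unfolding haar_def
  proof (rule nn_integral_cong_AE, use AE_vec2_nonzero in eventually_elim)
    case (elim x)
    have "(\<integral>\<^sup>+t. indicator S (act (adj2 (col_matrix x (t *\<^sub>R x + dual_vec x))) \<i>) \<partial>lborel) =
       (\<integral>\<^sup>+t. indicator S (Complex (- t) (1 / ((x$1)\<^sup>2 + (x$2)\<^sup>2))) \<partial>lborel)"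
      by (simp only: act_base_point[OF elim])
    also have "\<dots> = h (1 / ((x$1)\<^sup>2 + (x$2)\<^sup>2))"
      unfolding h_def by (subst nn_integral_real_affine[of _ "-1" 0]) simp_all
    finally show ?case .
  qed
  also have "\<dots> = (\<integral>\<^sup>+v. h v \<partial>distr lborel borel (\<lambda>x::real^2. 1 / ((x$1)\<^sup>2 + (x$2)\<^sup>2)))"
    by (subst nn_integral_distr) simp_all
  also have "\<dots> = (\<integral>\<^sup>+v. ennreal (pi * indicator {0<..} v / v\<^sup>2) * h v \<partial>lborel)"
    unfolding distr_inverse_norm_square by (subst nn_integral_density) simp_all
  also have "\<dots> = (\<integral>\<^sup>+v. ennreal pi * (ennreal (indicator {0<..} v / v\<^sup>2) * h v) \<partial>lborel)"
    by (simp add: ennreal_mult[symmetric] mult.assoc[symmetric])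
  also have "\<dots> = ennreal pi * (\<integral>\<^sup>+v. ennreal (indicator {0<..} v / v\<^sup>2) * h v \<partial>lborel)"
    by (rule nn_integral_cmult) simp
  also have "(\<integral>\<^sup>+v. ennreal (indicator {0<..} v / v\<^sup>2) * h v \<partial>lborel) = emeasure hyperbolic_area S"
  proof -
    have uh [measurable]: "upper_half_plane \<in> sets borel" unfolding upper_half_plane_def by measurable
    have "emeasure hyperbolic_area S = (\<integral>\<^sup>+z. ennreal (indicator upper_half_plane z / (Im z)\<^sup>2) * indicator S z \<partial>lborel)"
      unfolding hyperbolic_area_def by (rule emeasure_density) simp_all
    also have "\<dots> = (\<integral>\<^sup>+a. \<integral>\<^sup>+b. ennreal (indicator {0<..} b / b\<^sup>2) * indicator S (Complex a b) \<partial>lborel \<partial>lborel)"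
      by (subst nn_integral_complex) (simp_all add: upper_half_plane_def indicator_def)
    also have "\<dots> = (\<integral>\<^sup>+b. \<integral>\<^sup>+a. ennreal (indicator {0<..} b / b\<^sup>2) * indicator S (Complex a b) \<partial>lborel \<partial>lborel)"
      by (intro lborel_pair.Fubini') simp
    also have "\<dots> = (\<integral>\<^sup>+v. ennreal (indicator {0<..} v / v\<^sup>2) * h v \<partial>lborel)"
    proof (rule nn_integral_cong)
      fix b :: real
      show "(\<integral>\<^sup>+a. ennreal (indicator {0<..} b / b\<^sup>2) * indicator S (Complex a b) \<partial>lborel) = ennreal (indicator {0<..} b / b\<^sup>2) * h b"
        unfolding h_def by (rule nn_integral_cmult) simp
    qed
    finally show ?thesis by simp
  qed
  finally show ?thesis .
qed


section \<open>Fundamental domains and elliptic points\<close>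

lemma preorder_min_exists:
  fixes le :: "'a \<Rightarrow> 'a \<Rightarrow> bool"
  assumes "finite S" "S \<noteq> {}" and total: "\<And>x y. le x y \<or> le y x"
    and trans: "\<And>x y z. le x y \<Longrightarrow> le y z \<Longrightarrow> le x z"
  shows "\<exists>m\<in>S. \<forall>x\<in>S. le m x"
  using assms(1,2)
proof (induction rule: finite_ne_induct)
  case (singleton x) then show ?case using total[of x x] by simp
next
  case (insert x S)
  then obtain m where m: "m \<in> S" "\<forall>y\<in>S. le m y" by blast
  show ?case
  proof (cases "le x m")
    case True
    then have "\<forall>y\<in>insert x S. le x y" using m(2) trans[of x m] total[of x x] by auto
    then show ?thesis by blast
  next
    case False
    then have "le m x" using total[of m x] by simp
    then show ?thesis using m by auto
  qed
qed

text \<open>On the upper half-plane this is twice the hyperbolic cosine of the hyperbolic distance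
  from \<open>\<i>\<close> to \<open>z\<close>.\<close>

definition height :: "complex \<Rightarrow> real"
  where "height z = ((cmod z)\<^sup>2 + 1) / Im z"

lemma height_act:
  assumes "det A = 1" "Im z > 0"
  shows "height (act A z) = ((cmod (of_real (A$1$1) * z + of_real (A$1$2)))\<^sup>2 +
    (cmod (of_real (A$2$1) * z + of_real (A$2$2)))\<^sup>2) / Im z"
proof -
  have "cmod (of_real (A$2$1) * z + of_real (A$2$2)) > 0"
    using act_denom_nonzero[OF assms] by simp
  then show ?thesis
    using assms(2) unfolding height_def Im_act[OF assms]
    by (simp add: act_eq norm_divide field_simps)
qed

lemma haar_one: "haar (\<lambda>_. 1) = \<infinity>"
  by (simp add: haar_def)

text \<open>A fixed point solves \<open>c z\<^sup>2 + (d - a) z = b\<close>. Its imaginary part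
  gives \<open>2 c Re z = a - d\<close>, so \<open>c = 0\<close> would make \<open>A\<close> scalar,
  that is \<open>mat 1\<close> or its negative. Otherwise the two parts of the equation determine
  \<open>Re z\<close> and the square of \<open>Im z\<close>.\<close>

lemma fixed_point_unique:
  assumes A: "det A = 1" "A \<noteq> mat 1" "A \<noteq> - mat 1"
    and z: "Im z > 0" "act A z = z" and w: "Im w > 0" "act A w = w"
  shows "z = w"
proof -
  define a b c d where abcd: "a = A$1$1" "b = A$1$2" "c = A$2$1" "d = A$2$2"
  have det: "a * d - b * c = 1" using A(1) by (simp add: det_2 abcd)
  have eq: "2 * c * Re z = a - d \<and> c * (Re z * Re z - Im z * Im z) + (d - a) * Re z = b"
    if z: "Im z > 0" "act A z = z" for z
  proof -
    have "of_real a * z + of_real b = z * (of_real c * z + of_real d)"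
      using z act_denom_nonzero[OF A(1) z(1)] by (simp add: act_eq abcd divide_eq_eq)
    from arg_cong[OF this, of Re] arg_cong[OF this, of Im]
    have re: "a * Re z + b = Re z * (c * Re z + d) - Im z * (c * Im z)"
      and im: "Im z * a = Im z * (2 * c * Re z + d)" by (simp_all add: algebra_simps)
    have "a = 2 * c * Re z + d" using im z by simp
    then show ?thesis using re by (simp add: algebra_simps)
  qed
  have c: "c \<noteq> 0"
  proof
    assume c: "c = 0"
    then have "a = d" "b = 0" using eq[OF z] by auto
    with det c have "a = 1 \<or> a = -1" by (simp add: square_eq_1_iff)
    then show False using A(2,3) c \<open>a = d\<close> \<open>b = 0\<close> by (auto simp: mat2_eq_iff abcd)
  qed
  have re: "Re z = Re w" using eq[OF z] eq[OF w] c by (metis mult_cancel_left mult_eq_0_iff zero_neq_numeral)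
  have "c * (Im z * Im z) = c * (Im w * Im w)"
    using eq[OF z] eq[OF w] by (simp add: re algebra_simps)
  then have "Im z = Im w" using c z(1) w(1) by (simp add: square_eq_iff)
  with re show ?thesis by (simp add: complex_eq_iff)
qed

context lattice_measure
begin

text \<open>By \<open>height_act\<close> a bound on the height bounds \<open>a z + b\<close> for
  both rows \<open>(a, b)\<close> of \<gamma>, and since \<open>Im z > 0\<close> this controls the
  real coefficients. Only finitely many members of \<Gamma> have bounded entries.\<close>

lemma finite_height_le:
  assumes z: "Im z > 0" shows "finite {\<gamma>\<in>\<Gamma>. height (act \<gamma> z) \<le> R}"
proof -
  define K where "K = sqrt (\<bar>R * Im z\<bar>)"
  define B where "B = K / Im z + (K + K / Im z * cmod z)"
  have row: "\<bar>a\<bar> \<le> B \<and> \<bar>b\<bar> \<le> B" if "cmod (of_real a * z + of_real b) \<le> K" for a b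
  proof -
    have "\<bar>a\<bar> * Im z = \<bar>Im (of_real a * z + of_real b)\<bar>" using z by (simp add: abs_mult)
    also have "\<dots> \<le> K" using abs_Im_le_cmod that by (rule order_trans)
    finally have a: "\<bar>a\<bar> \<le> K / Im z" using z by (simp add: field_simps)
    have "\<bar>b\<bar> = cmod ((of_real a * z + of_real b) - of_real a * z)" by simp
    also have "\<dots> \<le> K + \<bar>a\<bar> * cmod z"
      using norm_triangle_ineq4[of "of_real a * z + of_real b" "of_real a * z"] that by (simp add: norm_mult)
    also have "\<dots> \<le> K + K / Im z * cmod z" using a by (intro add_left_mono mult_right_mono) auto
    finally have b: "\<bar>b\<bar> \<le> K + K / Im z * cmod z" .
    have "K \<ge> 0" by (simp add: K_def)
    then have "0 \<le> K / Im z" "0 \<le> K / Im z * cmod z" using z by simp_all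
    with a b \<open>K \<ge> 0\<close> show ?thesis unfolding B_def by linarith
  qed
  have "{\<gamma>\<in>\<Gamma>. height (act \<gamma> z) \<le> R} \<subseteq> \<Gamma> \<inter> cball 0 (4 * B)"
  proof
    fix \<gamma> assume \<gamma>: "\<gamma> \<in> {\<gamma>\<in>\<Gamma>. height (act \<gamma> z) \<le> R}"
    let ?m = "\<lambda>i. cmod (of_real (\<gamma>$i$1) * z + of_real (\<gamma>$i$2))"
    have "height (act \<gamma> z) \<le> R" using \<gamma> by simp
    then have "(?m 1)\<^sup>2 + (?m 2)\<^sup>2 \<le> R * Im z"
      using \<gamma> z by (subst (asm) height_act) (simp_all add: det_Gamma pos_divide_le_eq)
    moreover have "(?m i)\<^sup>2 \<le> (?m 1)\<^sup>2 + (?m 2)\<^sup>2" for i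
      by (cases i rule: exhaust_2[THEN disjE]) auto
    ultimately have "(?m i)\<^sup>2 \<le> \<bar>R * Im z\<bar>" for i
      by (meson abs_ge_self order_trans)
    then have "?m i \<le> K" for i unfolding K_def by (rule real_le_rsqrt)
    then have e: "\<bar>\<gamma>$i$1\<bar> \<le> B \<and> \<bar>\<gamma>$i$2\<bar> \<le> B" for i by (rule row)
    have "norm \<gamma> \<le> norm (\<gamma>$1) + norm (\<gamma>$2)"
      using L2_set_le_sum[of UNIV "\<lambda>i. norm (\<gamma>$i)"] by (simp add: norm_vec_def UNIV_2)
    moreover have "norm (\<gamma>$i) \<le> \<bar>\<gamma>$i$1\<bar> + \<bar>\<gamma>$i$2\<bar>" for i
      using norm_le_l1_cart[of "\<gamma>$i"] by (simp add: UNIV_2)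
    ultimately have "norm \<gamma> \<le> 4 * B" using e[of 1] e[of 2] by (smt (verit))
    then show "\<gamma> \<in> \<Gamma> \<inter> cball 0 (4 * B)" using \<gamma> by simp
  qed
  then show ?thesis using finite_Gamma_bounded[OF bounded_cball] by (rule finite_subset)
qed

text \<open>Lexicographic minimisation over the orbits; the first component \<open>height\<close> makes the
  minimum exist, the other two make it unique also on orbits with nontrivial stabilisers.\<close>

lemma ex_strict_fundamental_domain: "\<exists>F. strict_fundamental_domain \<Gamma> F"
proof -
  define le where "le z w \<longleftrightarrow> height z < height w \<or> (height z = height w \<and>
    (Re z < Re w \<or> (Re z = Re w \<and> Im z \<le> Im w)))" for z w
  have total: "le z w \<or> le w z" and antisym: "le z w \<Longrightarrow> le w z \<Longrightarrow> z = w"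
    and trans: "le z w \<Longrightarrow> le w v \<Longrightarrow> le z v" for z w v
    by (auto simp: le_def complex_eq_iff)
  define F where "F = {z \<in> space borel. 0 < Im z \<and> (\<forall>\<gamma>\<in>\<Gamma>. le z (act \<gamma> z))}"
  have "F \<in> sets borel"
    unfolding F_def le_def height_def using countable_Gamma by measurable
  moreover have "\<exists>!w. w \<in> F \<and> (\<exists>\<gamma>\<in>\<Gamma>. w = act \<gamma> z)" if "z \<in> upper_half_plane" for z
  proof -
    have z: "Im z > 0" using that by (simp add: upper_half_plane_def)
    \<comment> \<open>Points higher than \<open>z\<close> cannot be minimal, so the minimum is
      sought among the finitely many points of the orbit that are at most as high.\<close>
    define S where "S = (\<lambda>\<gamma>. act \<gamma> z) ` {\<gamma>\<in>\<Gamma>. height (act \<gamma> z) \<le> height z}"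
    have finS: "finite S" using finite_height_le[OF z] by (simp add: S_def)
    have zS: "z \<in> S" unfolding S_def using one_Gamma by (intro image_eqI[of _ _ "mat 1"]) auto
    have "\<exists>m\<in>S. \<forall>x\<in>S. le m x"
    proof (rule preorder_min_exists)
      show "le x z" if "le x y" "le y z" for x y z using trans that .
    qed (use finS zS total in auto)
    then obtain m where m: "m \<in> S" "\<And>x. x \<in> S \<Longrightarrow> le m x" by blast
    then obtain \<alpha> where \<alpha>: "\<alpha> \<in> \<Gamma>" "m = act \<alpha> z" "height m \<le> height z" by (auto simp: S_def)
    have min: "le m (act \<gamma> z)" if "\<gamma> \<in> \<Gamma>" for \<gamma>
    proof (cases "height (act \<gamma> z) \<le> height z")
      case True then show ?thesis using that m(2) by (auto simp: S_def)
    next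
      case False then show ?thesis using \<alpha>(3) by (auto simp: le_def)
    qed
    have comp: "act \<gamma> (act \<delta> z) = act (\<gamma> ** \<delta>) z" if "\<gamma> \<in> \<Gamma>" "\<delta> \<in> \<Gamma>" for \<gamma> \<delta>
      using act_mult[OF det_Gamma det_Gamma z] that by simp
    have mF: "m \<in> F"
      using Im_act_pos[OF det_Gamma z] \<alpha> min mult_Gamma by (simp add: F_def comp)
    have reach: "le (act \<beta> z) (act \<delta> z)" if "act \<beta> z \<in> F" "\<beta> \<in> \<Gamma>" "\<delta> \<in> \<Gamma>" for \<beta> \<delta>
    proof -
      have "\<delta> ** adj2 \<beta> \<in> \<Gamma>" using that mult_Gamma adj2_Gamma by blast
      then have "le (act \<beta> z) (act (\<delta> ** adj2 \<beta>) (act \<beta> z))" using that by (simp add: F_def)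
      then show ?thesis
        using that by (simp add: comp mult_Gamma adj2_Gamma cancel_Gamma)
    qed
    show ?thesis
    proof (rule ex1I)
      show "m \<in> F \<and> (\<exists>\<gamma>\<in>\<Gamma>. m = act \<gamma> z)" using mF \<alpha> by blast
      fix w assume "w \<in> F \<and> (\<exists>\<gamma>\<in>\<Gamma>. w = act \<gamma> z)"
      then obtain \<beta> where \<beta>: "w \<in> F" "\<beta> \<in> \<Gamma>" "w = act \<beta> z" by blast
      show "w = m"
        by (rule antisym) (use reach[of \<beta> \<alpha>] reach[of \<alpha> \<beta>] \<beta> \<alpha> mF in simp_all)
    qed
  qed
  ultimately have "strict_fundamental_domain \<Gamma> F"
    by (auto simp: strict_fundamental_domain_def F_def upper_half_plane_def)
  then show ?thesis ..
qed

text \<open>At these points the count behind \<open>gint_fundamental_domain\<close> would exceed 2;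
  they are countable and hence negligible.\<close>

definition elliptic_points :: "complex set"
  where "elliptic_points = {z \<in> upper_half_plane. \<exists>\<gamma>\<in>\<Gamma>. \<gamma> \<noteq> mat 1 \<and> \<gamma> \<noteq> - mat 1 \<and> act \<gamma> z = z}"

lemma countable_elliptic_points: "countable elliptic_points"
proof -
  define E where "E \<gamma> = {z \<in> upper_half_plane. \<gamma> \<noteq> mat 1 \<and> \<gamma> \<noteq> - mat 1 \<and> act \<gamma> z = z}" for \<gamma>
  have "countable (E \<gamma>)" if "\<gamma> \<in> \<Gamma>" for \<gamma>
  proof -
    have "E \<gamma> \<subseteq> {z}" if "z \<in> E \<gamma>" for z
    proof
      fix w assume "w \<in> E \<gamma>"
      then show "w \<in> {z}"
        using that fixed_point_unique[OF det_Gamma[OF \<open>\<gamma> \<in> \<Gamma>\<close>], of w z]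
        by (simp add: E_def upper_half_plane_def)
    qed
    then show ?thesis by (metis all_not_in_conv countable_empty countable_insert countable_subset)
  qed
  moreover have "elliptic_points = (\<Union>\<gamma>\<in>\<Gamma>. E \<gamma>)" by (auto simp: elliptic_points_def E_def)
  ultimately show ?thesis using countable_Gamma by auto
qed

text \<open>Compare with the constant 1 in \<open>gint_haar_unique\<close>: its \<open>haar\<close>
  is infinite and anything times 0 is 0 in \<open>ennreal\<close>, so infinity times
  \<open>gint \<psi>\<close> vanishes.\<close>

lemma gint_haar_null:
  assumes [measurable]: "\<psi> \<in> borel_measurable borel" and "haar \<psi> = 0"
  shows "gint \<psi> = 0"
  using gint_haar_unique[of "\<lambda>_. 1" \<psi>] assms(2) by (simp add: haar_one ennreal_mult_eq_top_iff ennreal_mult_top split: if_splits)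

text \<open>A countable set has hyperbolic area 0, so its pullback to the group is null for
  \<open>haar\<close> and therefore for \<open>gint\<close>. In the vanishing sum over \<Gamma> the
  summand of \<open>mat 1\<close> concerns \<open>sec C\<close> itself.\<close>

lemma AE_not_elliptic: "AE C in \<mu>. act (adj2 (sec C)) \<i> \<notin> elliptic_points"
proof -
  have [measurable]: "elliptic_points \<in> sets borel"
    by (rule sets.countable[OF _ countable_elliptic_points]) simp
  have [measurable]: "upper_half_plane \<in> sets borel" unfolding upper_half_plane_def by measurable
  have "emeasure hyperbolic_area elliptic_points =
      (\<integral>\<^sup>+z. ennreal (indicator upper_half_plane z / (Im z)\<^sup>2) * indicator elliptic_points z \<partial>lborel)"
    unfolding hyperbolic_area_def by (rule emeasure_density) simp_all
  also have "\<dots> = (\<integral>\<^sup>+z. 0 \<partial>(lborel::complex measure))"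
    by (rule nn_integral_cong_AE,
        use AE_not_in[OF countable_imp_null_set_lborel[OF countable_elliptic_points]] in eventually_elim) simp
  finally have "emeasure hyperbolic_area elliptic_points = 0" by simp
  then have "haar (\<lambda>g. indicator elliptic_points (act (adj2 g) \<i>)) = 0"
    by (simp add: haar_hyperbolic_area)
  then have "gint (\<lambda>g. indicator elliptic_points (act (adj2 g) \<i>)) = 0"
    by (intro gint_haar_null) measurable
  then have "AE C in \<mu>. (\<integral>\<^sup>+\<gamma>. indicator elliptic_points (act (adj2 (sec C ** \<gamma>)) \<i>) \<partial>count_space \<Gamma>) = (0::ennreal)"
    unfolding gint_def
    by (subst (asm) nn_integral_0_iff_AE) (auto intro!: fold_measurable)
  then show ?thesis
  proof eventually_elim
    case (elim C)
    then have "AE \<gamma> in count_space \<Gamma>. indicator elliptic_points (act (adj2 (sec C ** \<gamma>)) \<i>) = (0::ennreal)"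
      by (subst (asm) nn_integral_0_iff_AE) auto
    then have "indicator elliptic_points (act (adj2 (sec C ** mat 1)) \<i>) = (0::ennreal)"
      using one_Gamma by (auto simp: AE_count_space)
    then show ?case by (auto simp: indicator_def split: if_splits)
  qed
qed

end

section \<open>The covolume in terms of the hyperbolic area\<close>

locale lattice_measure_minus = lattice_measure +
  assumes minus_one: "- mat 1 \<in> \<Gamma>"
begin

text \<open>Let \<alpha> move the base point \<open>z\<close> into \<open>F\<close>. Then
  \<open>adj2 \<gamma>\<close> does so too exactly if \<open>\<gamma> ** \<alpha>\<close> fixes
  \<open>z\<close>, which off the elliptic points leaves \<open>adj2 \<alpha>\<close> and
  \<open>- adj2 \<alpha>\<close> for \<gamma>. Since \<mu> has mass 1, the integral is this
  count.\<close>

lemma gint_fundamental_domain: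
  assumes F: "strict_fundamental_domain \<Gamma> F"
  shows "gint (\<lambda>g. indicator F (act (adj2 g) \<i>)) = 2"
proof -
  have "gint (\<lambda>g. indicator F (act (adj2 g) \<i>)) = (\<integral>\<^sup>+C. 2 \<partial>\<mu>)"
    unfolding gint_def
  proof (rule nn_integral_cong_AE, use AE_not_elliptic AE_space in eventually_elim)
    case (elim C)
    define z where "z = act (adj2 (sec C)) \<i>"
    have z: "Im z > 0" using elim det_sec by (simp add: z_def Im_act_pos)
    then have "\<exists>!w. w \<in> F \<and> (\<exists>\<gamma>\<in>\<Gamma>. w = act \<gamma> z)"
      using F by (simp add: strict_fundamental_domain_def upper_half_plane_def)
    then obtain w where w0: "w \<in> F \<and> (\<exists>\<gamma>\<in>\<Gamma>. w = act \<gamma> z)"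
      "\<forall>w'. w' \<in> F \<and> (\<exists>\<gamma>\<in>\<Gamma>. w' = act \<gamma> z) \<longrightarrow> w' = w"
      by (rule ex1E)
    then have w: "w \<in> F" "\<And>w' \<gamma>. w' \<in> F \<Longrightarrow> \<gamma> \<in> \<Gamma> \<Longrightarrow> w' = act \<gamma> z \<Longrightarrow> w' = w" by blast+
    obtain \<alpha> where \<alpha>: "\<alpha> \<in> \<Gamma>" "w = act \<alpha> z" using w0(1) by blast
    have neg: "- \<alpha> \<in> \<Gamma>" if "\<alpha> \<in> \<Gamma>" for \<alpha>
    proof -
      have "- mat 1 ** \<alpha> = - \<alpha>" by (simp add: mat2_eq_iff)
      then show ?thesis using mult_Gamma[OF minus_one that] by simp
    qed
    have stab: "\<gamma> ** \<alpha> = mat 1 \<or> \<gamma> ** \<alpha> = - mat 1" if "\<gamma> \<in> \<Gamma>" "act (adj2 \<gamma>) z \<in> F" for \<gamma>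
    proof -
      have "act (adj2 \<gamma>) z = act \<alpha> z" using w(2) that adj2_Gamma \<alpha> by auto
      then have "act \<gamma> (act (adj2 \<gamma>) z) = act (\<gamma> ** \<alpha>) z"
        using act_mult[OF det_Gamma det_Gamma z] that \<alpha> by simp
      moreover have "act \<gamma> (act (adj2 \<gamma>) z) = z"
        using act_mult[OF det_Gamma det_Gamma z, of \<gamma> "adj2 \<gamma>"] that adj2_Gamma det_Gamma by simp
      ultimately show ?thesis
        using elim z mult_Gamma[OF that(1) \<alpha>(1)] by (auto simp: elliptic_points_def z_def[symmetric] upper_half_plane_def)
    qed
    have "{\<gamma>\<in>\<Gamma>. act (adj2 \<gamma>) z \<in> F} = {adj2 \<alpha>, - adj2 \<alpha>}"
    proof (intro equalityI subsetI)
      fix \<gamma> assume \<gamma>: "\<gamma> \<in> {\<gamma>\<in>\<Gamma>. act (adj2 \<gamma>) z \<in> F}"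
      then have "\<gamma> ** \<alpha> ** adj2 \<alpha> = \<gamma>" using \<alpha> by (simp add: cancel_Gamma)
      then show "\<gamma> \<in> {adj2 \<alpha>, - adj2 \<alpha>}"
        using stab[of \<gamma>] \<gamma> by (auto simp: mat2_eq_iff)
    next
      have m: "adj2 (- A) = - adj2 A" for A by (simp add: mat2_eq_iff)
      fix \<gamma> assume "\<gamma> \<in> {adj2 \<alpha>, - adj2 \<alpha>}"
      then show "\<gamma> \<in> {\<gamma>\<in>\<Gamma>. act (adj2 \<gamma>) z \<in> F}"
        using \<alpha> w(1) adj2_Gamma neg by (auto simp: m)
    qed
    moreover have "adj2 \<alpha> \<noteq> - adj2 \<alpha>"
    proof
      assume "adj2 \<alpha> = - adj2 \<alpha>"
      then have "\<alpha> = 0" by (simp add: mat2_eq_iff)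
      then show False using det_Gamma[OF \<alpha>(1)] by (simp add: det_2)
    qed
    ultimately have card: "card {\<gamma>\<in>\<Gamma>. act (adj2 \<gamma>) z \<in> F} = 2" by simp
    have "(\<integral>\<^sup>+\<gamma>. indicator F (act (adj2 (sec C ** \<gamma>)) \<i>) \<partial>count_space \<Gamma>) =
      (\<integral>\<^sup>+\<gamma>. indicator {\<gamma>\<in>\<Gamma>. act (adj2 \<gamma>) z \<in> F} \<gamma> \<partial>count_space \<Gamma>)"
    proof (rule nn_integral_cong)
      fix \<gamma> assume "\<gamma> \<in> space (count_space \<Gamma>)"
      then have \<gamma>: "\<gamma> \<in> \<Gamma>" by simp
      then have "act (adj2 (sec C ** \<gamma>)) \<i> = act (adj2 \<gamma>) z"
        using elim det_sec det_Gamma[OF \<gamma>] by (simp add: adj2_prod act_mult z_def)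
      then show "indicator F (act (adj2 (sec C ** \<gamma>)) \<i>) = (indicator {\<gamma>\<in>\<Gamma>. act (adj2 \<gamma>) z \<in> F} \<gamma> :: ennreal)"
        using \<gamma> by (simp add: indicator_def)
    qed
    also have "\<dots> = emeasure (count_space \<Gamma>) {\<gamma>\<in>\<Gamma>. act (adj2 \<gamma>) z \<in> F}"
      by (rule nn_integral_indicator) auto
    also have "\<dots> = 2"
      using card by (subst emeasure_count_space_finite) (auto intro: card_ge_0_finite)
    finally show ?case .
  qed
  also have "\<dots> = 2" by (simp add: emeasure_space_mu)
  finally show ?thesis .
qed

text \<open>The covolume of \<open>\<Gamma>\<close> with respect to \<open>haar\<close> is \<open>pi V / 2\<close>; the factor \<open>2\<close> is the order of
  \<open>{1, -1}\<close>, the generic stabiliser.\<close>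

theorem gint_eq_haar:
  assumes [measurable]: "\<psi> \<in> borel_measurable borel"
  shows "gint \<psi> = ennreal (c_lattice \<Gamma>) * haar \<psi>" and "c_lattice \<Gamma> > 0"
proof -
  define F where "F = (SOME F. strict_fundamental_domain \<Gamma> F)"
  have F: "strict_fundamental_domain \<Gamma> F"
    unfolding F_def by (rule someI_ex[OF ex_strict_fundamental_domain])
  then have [measurable]: "F \<in> sets borel" by (simp add: strict_fundamental_domain_def)
  define V where "V = emeasure hyperbolic_area F"
  have key: "2 * haar \<psi> = gint \<psi> * (ennreal pi * V)" if [measurable]: "\<psi> \<in> borel_measurable borel" for \<psi>
    using gint_haar_unique[of "\<lambda>g. indicator F (act (adj2 g) \<i>)" \<psi>]
    by (simp add: haar_hyperbolic_area gint_fundamental_domain[OF F] V_def)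
  \<comment> \<open>For the constant 1 the left side of \<open>key\<close> is infinite, so the right
    side cannot vanish.\<close>
  have "V \<noteq> 0"
    using key[of "\<lambda>_. 1"] by (auto simp: haar_one ennreal_mult_top)
  \<comment> \<open>If \<open>V\<close> were infinite, \<open>key\<close> would make
    \<open>gint\<close> vanish on every function with finite \<open>haar\<close>. The boxes
    \<open>K n\<close> have finite area and exhaust the half-plane, so almost every coset would have
    its base point in none of them.\<close>
  have "V \<noteq> \<infinity>"
  proof
    assume V: "V = \<infinity>"
    define K where "K n = cbox (Complex (- real n) (1 / real (Suc n))) (Complex (real n) (real n))" for n
    define \<psi> :: "nat \<Rightarrow> real^2^2 \<Rightarrow> ennreal" where "\<psi> n g = indicator (K n) (act (adj2 g) \<i>)" for n g
    have [measurable]: "K n \<in> sets borel" for n by (simp add: K_def)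
    have [measurable]: "\<psi> n \<in> borel_measurable borel" for n unfolding \<psi>_def by measurable
    have "emeasure hyperbolic_area (K n) \<le> (\<integral>\<^sup>+z. ennreal ((real (Suc n))\<^sup>2) * indicator (K n) z \<partial>lborel)" for n
    proof -
      have [measurable]: "upper_half_plane \<in> sets borel" unfolding upper_half_plane_def by measurable
      have bd: "1 / (Im z)\<^sup>2 \<le> (real (Suc n))\<^sup>2" if "1 / real (Suc n) \<le> Im z" for z
      proof -
        have "0 < 1 / real (Suc n)" by simp
        with that have "0 < Im z" by linarith
        have "inverse (Im z) \<le> inverse (1 / real (Suc n))"
          using that \<open>0 < 1 / real (Suc n)\<close> by (rule le_imp_inverse_le)
        then have "(inverse (Im z))\<^sup>2 \<le> (real (Suc n))\<^sup>2"
          using \<open>0 < Im z\<close> by (intro power_mono) auto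
        then show ?thesis by (simp add: inverse_eq_divide power_divide)
      qed
      have "emeasure hyperbolic_area (K n) = (\<integral>\<^sup>+z. ennreal (indicator upper_half_plane z / (Im z)\<^sup>2) * indicator (K n) z \<partial>lborel)"
        unfolding hyperbolic_area_def by (rule emeasure_density) simp_all
      also have "\<dots> \<le> (\<integral>\<^sup>+z. ennreal ((real (Suc n))\<^sup>2) * indicator (K n) z \<partial>lborel)"
      proof (rule nn_integral_mono)
        fix z
        show "ennreal (indicator upper_half_plane z / (Im z)\<^sup>2) * indicator (K n) z \<le> ennreal ((real (Suc n))\<^sup>2) * indicator (K n) z"
        proof (cases "z \<in> K n")
          case True
          then have "1 / (Im z)\<^sup>2 \<le> (real (Suc n))\<^sup>2"
            by (intro bd) (simp add: K_def in_cbox_complex_iff del: of_nat_Suc)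
          then have "indicator upper_half_plane z / (Im z)\<^sup>2 \<le> (real (Suc n))\<^sup>2"
            by (cases "z \<in> upper_half_plane") (simp_all del: of_nat_Suc)
          then have "ennreal (indicator upper_half_plane z / (Im z)\<^sup>2) \<le> ennreal ((real (Suc n))\<^sup>2)"
            by (rule ennreal_leI)
          then show ?thesis using True by (simp del: of_nat_Suc)
        qed simp
      qed
      finally show ?thesis .
    qed
    moreover have "(\<integral>\<^sup>+z. ennreal ((real (Suc n))\<^sup>2) * indicator (K n) z \<partial>lborel) < \<infinity>" for n
      using emeasure_lborel_cbox_finite[of "Complex (- real n) (1 / real (Suc n))" "Complex (real n) (real n)"]
      by (simp add: nn_integral_cmult_indicator ennreal_mult_eq_top_iff K_def less_top[symmetric])
    ultimately have "emeasure hyperbolic_area (K n) < \<infinity>" for n by (rule le_less_trans)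
    then have "haar (\<psi> n) < \<infinity>" for n
      unfolding \<psi>_def by (simp add: haar_hyperbolic_area ennreal_mult_less_top)
    then have fin: "2 * haar (\<psi> n) < \<infinity>" for n by (simp add: ennreal_mult_less_top)
    have "gint (\<psi> n) = 0" for n
    proof -
      have "gint (\<psi> n) * \<infinity> \<noteq> \<infinity>"
        using key[of "\<psi> n"] V fin[of n] by (simp add: ennreal_mult_top)
      then show ?thesis by (auto simp: ennreal_mult_top split: if_splits)
    qed
    then have "AE C in \<mu>. (\<integral>\<^sup>+\<gamma>. \<psi> n (sec C ** \<gamma>) \<partial>count_space \<Gamma>) = 0" for n
      unfolding gint_def by (subst (asm) nn_integral_0_iff_AE) (auto intro!: fold_measurable)
    then have "AE C in \<mu>. \<forall>n. (\<integral>\<^sup>+\<gamma>. \<psi> n (sec C ** \<gamma>) \<partial>count_space \<Gamma>) = 0"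
      by (subst AE_all_countable) simp
    then show False
    proof (rule AE_obtain)
      fix C assume elim: "\<forall>n. (\<integral>\<^sup>+\<gamma>. \<psi> n (sec C ** \<gamma>) \<partial>count_space \<Gamma>) = 0" "C \<in> space \<mu>"
      have "\<psi> n (sec C) = 0" for n
      proof -
        have "AE \<gamma> in count_space \<Gamma>. \<psi> n (sec C ** \<gamma>) = 0"
          using elim(1)[rule_format, of n] by (subst (asm) nn_integral_0_iff_AE) auto
        then have "\<psi> n (sec C ** mat 1) = 0" using one_Gamma by (auto simp: AE_count_space)
        then show ?thesis by simp
      qed
      moreover define z where "z = act (adj2 (sec C)) \<i>"
      have z: "Im z > 0" using elim det_sec by (simp add: z_def Im_act_pos)
      obtain n1 where n1: "1 / real (Suc n1) < Im z" using nat_approx_posE[OF z] by blast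
      obtain n2 :: nat where n2: "\<bar>Re z\<bar> + \<bar>Im z\<bar> < real n2" using reals_Archimedean2 by blast
      define n where "n = max n1 n2"
      have "1 / real (Suc n) \<le> 1 / real (Suc n1)" by (simp add: n_def frac_le)
      then have "z \<in> K n" using n1 n2 by (auto simp: K_def in_cbox_complex_iff n_def)
      then have "\<psi> n (sec C) = 1" by (simp add: \<psi>_def z_def)
      ultimately show False by simp
    qed
  qed
  define v where "v = quotient_area \<Gamma>"
  have v: "V = ennreal v" "v > 0"
    using \<open>V \<noteq> 0\<close> \<open>V \<noteq> \<infinity>\<close> unfolding v_def quotient_area_def F_def[symmetric]
    by (simp_all add: V_def measure_def enn2real_positive_iff less_top zero_less_iff_neq_zero)
  show "c_lattice \<Gamma> > 0" using v by (simp add: c_lattice_def v_def)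
  have "ennreal (c_lattice \<Gamma>) * haar \<psi> = ennreal (1 / (pi * v)) * (2 * haar \<psi>)"
    using v by (simp add: c_lattice_def v_def[symmetric] mult.assoc[symmetric] ennreal_mult[symmetric] ennreal_numeral[symmetric] del: ennreal_numeral)
  also have "\<dots> = gint \<psi> * (ennreal (1 / (pi * v)) * (ennreal pi * ennreal v))"
    by (simp only: key[OF assms] v(1) mult.left_commute)
  also have "ennreal (1 / (pi * v)) * (ennreal pi * ennreal v) = 1"
    using v by (simp add: ennreal_mult[symmetric])
  finally show "gint \<psi> = ennreal (c_lattice \<Gamma>) * haar \<psi>" by simp
qed

end


section \<open>Discrete orbits\<close>

text \<open>This includes infinitely many hits, where the sum diverges and both
  \<open>infsum\<close> and \<open>card\<close> take the value 0. The local finiteness argument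
  exploits this value.\<close>

lemma infsum_indicator:
  "(\<Sum>\<^sub>\<infinity>x\<in>S. indicator A (f x) :: real) = real (card {x\<in>S. f x \<in> A})"
proof -
  have "(\<Sum>\<^sub>\<infinity>x\<in>S. indicator A (f x) :: real) = (\<Sum>\<^sub>\<infinity>x\<in>{x\<in>S. f x \<in> A}. 1)"
    by (rule infsum_cong_neutral) (auto simp: indicator_def)
  then show ?thesis by simp
qed

text \<open>Lagrange's identity: the difference of the squares is the square of the inner
  product.\<close>

lemma det_cols_le: "\<bar>det_cols x y\<bar> \<le> norm x * norm y"
proof (rule power2_le_imp_le)
  have "(norm x * norm y)\<^sup>2 - \<bar>det_cols x y\<bar>\<^sup>2 = (x$1 * y$1 + x$2 * y$2)\<^sup>2"
    by (simp add: norm_vec2 power_mult_distrib det_cols_eq power2_eq_square algebra_simps)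
  then show "\<bar>det_cols x y\<bar>\<^sup>2 \<le> (norm x * norm y)\<^sup>2"
    using zero_le_power2[of "x$1 * y$1 + x$2 * y$2"] by linarith
qed simp

lemma det_cols_add: "det_cols x (y + z) = det_cols x y + det_cols x z"
  and det_cols_diff: "det_cols x (y - z) = det_cols x y - det_cols x z"
  and det_cols_scale: "det_cols x (r *\<^sub>R y) = r * det_cols x y"
  and det_cols_self [simp]: "det_cols x x = 0"
  by (simp_all add: det_cols_eq algebra_simps)

lemma det_cols_eq_0:
  assumes "x \<noteq> 0" "det_cols x y = 0" obtains t where "y = t *\<^sub>R x"
  using vec2_decomp[OF det_dual_vec[OF assms(1)], of y] assms(2) that by simp

lemma adj2_vec_cancel:
  assumes "det g = 1"
  shows "adj2 g *v (g *v x) = x" "g *v (adj2 g *v x) = x"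
  using assms by (simp_all add: matrix_vector_mul_assoc)

lemma bounded_mat_image:
  fixes g :: "real^2^2"
  shows "bounded S \<Longrightarrow> bounded ((\<lambda>x. g *v x) ` S)"
  by (rule bounded_linear_image) (simp_all add: linear_conv_bounded_linear[symmetric])

lemma integral_indicator_borel:
  "A \<in> sets borel \<Longrightarrow> (\<integral>x. indicator A x \<partial>lborel) = measure lborel A"
  by simp

lemma measure_open_pos:
  fixes U :: "(real^2) set"
  assumes "U \<in> sets borel" "bounded U" "open V" "V \<noteq> {}" "V \<subseteq> U" shows "measure lborel U \<noteq> 0"
proof
  assume "measure lborel U = 0"
  moreover have "emeasure lborel U < \<infinity>" using assms(2) by (rule emeasure_bounded_finite)
  ultimately have "emeasure lborel U = 0" by (simp add: emeasure_eq_ennreal_measure)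
  then have "emeasure lborel V = 0" using emeasure_mono[OF assms(5), of lborel] assms(1) by simp
  then have "V \<in> null_sets lborel" using assms(3) by auto
  then have "negligible V" by (simp add: negligible_iff_null_sets null_sets_completionI)
  then show False using open_not_negligible assms by blast
qed

locale veech_orbit = lattice_measure_minus +
  fixes \<Lambda> :: "(real^2) set"
  assumes orbit: "discrete_orbit \<Gamma> \<Lambda>"
    and veech: "siegel_veech_constant \<Gamma> \<mu> \<Lambda> (c_lattice \<Gamma>)"
begin

lemma ex_point: "\<exists>x. x \<in> \<Lambda>"
  using orbit one_Gamma by (auto simp: discrete_orbit_def)

lemma act_in: "\<gamma> \<in> \<Gamma> \<Longrightarrow> x \<in> \<Lambda> \<Longrightarrow> \<gamma> *v x \<in> \<Lambda>"
  using orbit mult_Gamma by (auto simp: discrete_orbit_def matrix_vector_mul_assoc)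

lemma orbit_eq:
  assumes "x \<in> \<Lambda>" shows "\<Lambda> = (\<lambda>\<gamma>. \<gamma> *v x) ` \<Gamma>"
proof
  show "(\<lambda>\<gamma>. \<gamma> *v x) ` \<Gamma> \<subseteq> \<Lambda>" using act_in assms by auto
  obtain x0 where x0: "\<Lambda> = (\<lambda>\<gamma>. \<gamma> *v x0) ` \<Gamma>" using orbit by (auto simp: discrete_orbit_def)
  then obtain \<alpha> where \<alpha>: "\<alpha> \<in> \<Gamma>" "x = \<alpha> *v x0" using assms by auto
  have "\<gamma> *v x0 = (\<gamma> ** adj2 \<alpha>) *v x" for \<gamma>
    using \<alpha> det_Gamma by (simp add: matrix_vector_mul_assoc[symmetric] adj2_vec_cancel)
  then show "\<Lambda> \<subseteq> (\<lambda>\<gamma>. \<gamma> *v x) ` \<Gamma>"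
    using \<alpha>(1) mult_Gamma adj2_Gamma unfolding x0 by blast
qed

lemma nonzero: "x \<in> \<Lambda> \<Longrightarrow> x \<noteq> 0"
proof
  assume "x \<in> \<Lambda>" "x = 0"
  then have "\<Lambda> = {0}" using orbit_eq[of 0] one_Gamma by auto
  moreover obtain y where y: "y \<noteq> 0" "\<Lambda> = (\<lambda>\<gamma>. \<gamma> *v y) ` \<Gamma>"
    using orbit by (auto simp: discrete_orbit_def)
  have "mat 1 *v y \<in> \<Lambda>" unfolding y(2) using one_Gamma by (rule imageI)
  ultimately show False using y(1) by simp
qed

lemma countable_orbit: "countable \<Lambda>"
  using ex_point orbit_eq countable_Gamma by (metis countable_image)

lemma uminus_in: "x \<in> \<Lambda> \<Longrightarrow> - x \<in> \<Lambda>"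
proof -
  assume "x \<in> \<Lambda>"
  moreover have "- mat 1 *v x = - x" by (simp add: vec2_eq_iff)
  ultimately show ?thesis using act_in[OF minus_one] by metis
qed

lemma coset_sec: "C \<in> space \<mu> \<Longrightarrow> C = sec C <#\<^bsub>SL2\<^esub> \<Gamma>"
  using coset_eq sec_in by (simp add: coset_image)

lemma siegel_transform_sec:
  assumes "C \<in> space \<mu>" shows "siegel_transform \<Lambda> h C = (\<Sum>\<^sub>\<infinity>x\<in>\<Lambda>. h (sec C *v x))"
  using siegel_transform_coset[OF subgroup orbit, of "sec C" h] coset_sec[OF assms] det_sec[OF assms] by simp

definition hits :: "(real^2) set \<Rightarrow> (real^2^2) set \<Rightarrow> real"
  where "hits A C = real (card {x\<in>\<Lambda>. sec C *v x \<in> A})"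

lemma hits_integral:
  assumes [measurable]: "A \<in> sets borel" and "bounded A"
  shows "(\<integral>C. hits A C \<partial>\<mu>) = c_lattice \<Gamma> * measure lborel A"
proof -
  have "(\<integral>C. hits A C \<partial>\<mu>) = (\<integral>C. siegel_transform \<Lambda> (indicator A) C \<partial>\<mu>)"
    by (rule Bochner_Integration.integral_cong) (simp_all add: siegel_transform_sec infsum_indicator hits_def)
  also have "\<dots> = c_lattice \<Gamma> * (\<integral>x. indicator A x \<partial>lborel)"
  proof -
    have "bounded (range (indicator A :: real^2 \<Rightarrow> real))"
      by (rule bounded_subset[of "{0, 1}"]) (auto simp: indicator_def)
    moreover have "{x. indicator A x \<noteq> (0::real)} = A" by (auto simp: indicator_def)
    then have "compactly_supported (indicator A :: real^2 \<Rightarrow> real)"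
      using assms(2) by (simp add: compactly_supported_def)
    ultimately show ?thesis using veech assms(1) unfolding siegel_veech_constant_def by simp
  qed
  finally show ?thesis using integral_indicator_borel[OF assms(1)] by simp
qed

text \<open>The Bochner integral of a nonintegrable function is 0, whereas the mean value formula
  gives a nonzero integral for a set of positive area.\<close>

lemma hits_integrable:
  assumes "A \<in> sets borel" "bounded A" "measure lborel A \<noteq> 0"
  shows "integrable \<mu> (hits A)"
  using hits_integral[OF assms(1,2)] assms(3) gint_eq_haar(2)[of "\<lambda>_. 0"]
  by (metis borel_measurable_const mult_eq_0_iff not_integrable_integral_eq less_irrefl)

text \<open>\<open>hits\<close> is \<open>0\<close> where the orbit has infinitely many points in \<open>A\<close>. Additivity of its integral
  therefore shows that almost everywhere infinitely many points in a ball leave no finite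
  nonzero number of them in a smaller ball.\<close>

lemma hits_additive_AE:
  assumes U: "open U" "U \<noteq> {}" "U \<subseteq> ball 0 (real n)"
  shows "AE C in \<mu>. hits (ball 0 (real n + 1)) C = hits U C + hits (ball 0 (real n + 1) - U) C"
proof -
  let ?B = "ball (0::real^2) (real n + 1)"
  have meas: "U \<in> sets borel" "?B \<in> sets borel" "?B - U \<in> sets borel" using U by auto
  have UB: "U \<subseteq> ?B" using U by (auto simp: subset_iff)
  have bdd: "bounded U" "bounded ?B" "bounded (?B - U)"
    using bounded_subset[OF bounded_ball UB] bounded_subset[OF bounded_ball, of "?B - U" 0 "real n + 1"] by auto
  \<comment> \<open>The annulus between the radii \<open>n\<close> and \<open>n + 1\<close> avoids
    \<open>U\<close>, so \<open>?B - U\<close> has positive area and its hits are integrable. This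
    is why the outer ball is larger than the ball that contains \<open>U\<close>.\<close>
  define V :: "(real^2) set" where "V = ball 0 (real n + 1) - cball 0 (real n)"
  have "open V" by (simp add: V_def open_Diff)
  moreover have "V \<noteq> {}"
  proof -
    have "norm ((real n + 1 / 2) *\<^sub>R axis 1 1 :: real^2) = real n + 1 / 2" by simp
    then have "(real n + 1 / 2) *\<^sub>R axis 1 1 \<in> V" unfolding V_def by simp
    then show ?thesis by blast
  qed
  moreover have "V \<subseteq> ?B - U" using U by (auto simp: V_def subset_iff)
  ultimately have pos: "measure lborel U \<noteq> 0" "measure lborel ?B \<noteq> 0" "measure lborel (?B - U) \<noteq> 0"
    using measure_open_pos[OF meas(1) bdd(1) U(1,2)] measure_open_pos[OF meas(2) bdd(2) U(1,2) UB]
      measure_open_pos[OF meas(3) bdd(3)] by auto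
  note int = hits_integrable[OF meas(1) bdd(1) pos(1)] hits_integrable[OF meas(2) bdd(2) pos(2)] hits_integrable[OF meas(3) bdd(3) pos(3)]
  \<comment> \<open>If \<open>?B\<close> has infinitely many hits, the subtracted term is 0;
    otherwise \<open>card\<close> is subadditive. A nonnegative function with integral 0 vanishes
    almost everywhere.\<close>
  have nonneg: "0 \<le> hits U C + hits (?B - U) C - hits ?B C" for C
  proof (cases "finite {x\<in>\<Lambda>. sec C *v x \<in> ?B}")
    case True
    have "card {x\<in>\<Lambda>. sec C *v x \<in> ?B} \<le> card ({x\<in>\<Lambda>. sec C *v x \<in> U} \<union> {x\<in>\<Lambda>. sec C *v x \<in> ?B - U})"
      using UB by (intro card_mono finite_subset[OF _ True]) auto
    also have "\<dots> \<le> card {x\<in>\<Lambda>. sec C *v x \<in> U} + card {x\<in>\<Lambda>. sec C *v x \<in> ?B - U}" by (rule card_Un_le)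
    finally show ?thesis unfolding hits_def by linarith
  next
    case False then show ?thesis by (simp add: hits_def)
  qed
  have "measure lborel ?B = measure lborel U + measure lborel (?B - U)"
  proof -
    have f: "emeasure lborel ?B \<noteq> \<infinity>" using emeasure_bounded_finite[OF bdd(2)] by simp
    have "measure lborel (?B - U) = measure lborel ?B - measure lborel U"
      using meas UB f by (intro measure_Diff) auto
    then show ?thesis by simp
  qed
  then have "(\<integral>C. hits U C + hits (?B - U) C - hits ?B C \<partial>\<mu>) = 0"
    using int hits_integral[OF meas(1) bdd(1)] hits_integral[OF meas(2) bdd(2)] hits_integral[OF meas(3) bdd(3)]
    by (simp add: algebra_simps)
  then have "AE C in \<mu>. hits U C + hits (?B - U) C - hits ?B C = 0"
    using int nonneg by (subst (asm) integral_nonneg_eq_0_iff_AE) auto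
  then show ?thesis by eventually_elim simp
qed

text \<open>Since the basis is countable, one coset satisfies additivity for all its members. If a
  ball had infinitely many hits, a basic \<open>U\<close> that isolates one of them would have
  \<open>hits U C = 1\<close> while the larger ball has value 0. Finiteness for one \<open>g\<close>
  passes to the orbit because linear maps preserve boundedness.\<close>

lemma finite_orbit_bounded:
  assumes "bounded S" shows "finite (\<Lambda> \<inter> S)"
proof -
  obtain \<B> :: "(real^2) set set" where B: "countable \<B>" "topological_basis \<B>"
    using ex_countable_basis by blast
  have "AE C in \<mu>. \<forall>U\<in>\<B>. \<forall>n. open U \<longrightarrow> U \<noteq> {} \<longrightarrow> U \<subseteq> ball 0 (real n) \<longrightarrow>
      hits (ball 0 (real n + 1)) C = hits U C + hits (ball 0 (real n + 1) - U) C"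
    unfolding AE_ball_countable[OF B(1)] AE_all_countable
  proof (intro ballI allI)
    fix U :: "(real^2) set" and n :: nat
    show "AE C in \<mu>. open U \<longrightarrow> U \<noteq> {} \<longrightarrow> U \<subseteq> ball 0 (real n) \<longrightarrow>
      hits (ball 0 (real n + 1)) C = hits U C + hits (ball 0 (real n + 1) - U) C"
      using hits_additive_AE[of U n] by (cases "open U \<and> U \<noteq> {} \<and> U \<subseteq> ball 0 (real n)") auto
  qed
  then obtain C where C: "C \<in> space \<mu>" and add: "\<And>U n. U \<in> \<B> \<Longrightarrow> open U \<Longrightarrow> U \<noteq> {} \<Longrightarrow> U \<subseteq> ball 0 (real n) \<Longrightarrow>
      hits (ball 0 (real n + 1)) C = hits U C + hits (ball 0 (real n + 1) - U) C"
    by (rule AE_obtain) blast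
  define g where "g = sec C"
  have g: "det g = 1" using C by (simp add: g_def det_sec)
  have fin: "finite {x\<in>\<Lambda>. g *v x \<in> ball 0 (real n)}" for n
  proof (rule ccontr)
    assume inf: "infinite {x\<in>\<Lambda>. g *v x \<in> ball 0 (real n)}"
    then have "{x\<in>\<Lambda>. g *v x \<in> ball 0 (real n)} \<noteq> {}" by (rule infinite_imp_nonempty)
    then obtain x where x: "x \<in> \<Lambda>" "g *v x \<in> ball 0 (real n)" by blast
    have "discrete \<Lambda>" using orbit by (simp add: discrete_orbit_def)
    then have "x isolated_in \<Lambda>" using x(1) by (rule discreteD)
    then obtain T where T: "open T" "T \<inter> \<Lambda> = {x}" unfolding isolated_in_def by blast
    define W where "W = (\<lambda>v. adj2 g *v v) -` T \<inter> ball 0 (real n)"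
    have "open W" unfolding W_def
      by (intro open_Int open_vimage T open_ball matrix_vector_mult_linear_continuous_on)
    moreover have "g *v x \<in> W" using x T g by (auto simp: W_def adj2_vec_cancel)
    ultimately obtain U where U: "U \<in> \<B>" "g *v x \<in> U" "U \<subseteq> W"
      using B(2) by (meson topological_basisE)
    have "{y\<in>\<Lambda>. g *v y \<in> U} = {x}"
    proof (intro equalityI subsetI)
      fix y assume y: "y \<in> {y\<in>\<Lambda>. g *v y \<in> U}"
      then have "g *v y \<in> W" using U(3) by (simp add: subset_iff)
      then have "y \<in> T" using g by (simp add: W_def adj2_vec_cancel)
      then have "y \<in> T \<inter> \<Lambda>" using y by simp
      then show "y \<in> {x}" unfolding T(2) .
    qed (use x U in simp)
    then have "hits U C = 1" by (simp add: hits_def g_def[symmetric])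
    moreover have "{x\<in>\<Lambda>. g *v x \<in> ball 0 (real n)} \<subseteq> {x\<in>\<Lambda>. g *v x \<in> ball 0 (real n + 1)}" by auto
    then have "infinite {x\<in>\<Lambda>. g *v x \<in> ball 0 (real n + 1)}" using inf finite_subset by blast
    then have "hits (ball 0 (real n + 1)) C = 0" by (simp add: hits_def g_def[symmetric])
    moreover have "hits (ball 0 (real n + 1) - U) C \<ge> 0" by (simp add: hits_def)
    moreover have "hits (ball 0 (real n + 1)) C = hits U C + hits (ball 0 (real n + 1) - U) C"
      using U B(2) topological_basis_open by (intro add) (auto simp: W_def)
    ultimately show False by simp
  qed
  have "bounded ((\<lambda>x. g *v x) ` S)" by (rule bounded_mat_image[OF assms])
  then obtain r where r: "\<And>x. x \<in> S \<Longrightarrow> norm (g *v x) \<le> r" by (auto simp: bounded_iff)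
  obtain n :: nat where "r < real n" using reals_Archimedean2 by blast
  then have "\<Lambda> \<inter> S \<subseteq> {x\<in>\<Lambda>. g *v x \<in> ball 0 (real n)}" using r by force
  then show ?thesis using fin finite_subset by blast
qed

lemma finite_hits:
  assumes "det g = 1" "bounded S" shows "finite {x\<in>\<Lambda>. g *v x \<in> S}"
proof -
  have "{x\<in>\<Lambda>. g *v x \<in> S} \<subseteq> \<Lambda> \<inter> (\<lambda>x. adj2 g *v x) ` S"
    using assms(1) by (force simp: adj2_vec_cancel)
  then show ?thesis
    using finite_orbit_bounded[OF bounded_mat_image[OF assms(2)]] finite_subset by blast
qed

text \<open>With a trivial stabiliser the points of the orbit correspond to the members of \<Gamma>,
  so the finite mean of \<open>hits\<close> unfolds to a multiple of the Haar measure of the set of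
  all \<open>g\<close> with \<open>g *v x\<close> in the disc. Over each point of the disc the fibre
  is a whole line, which makes this infinite.\<close>

lemma ex_stabiliser:
  assumes x: "x \<in> \<Lambda>" obtains \<gamma> where "\<gamma> \<in> \<Gamma>" "\<gamma> \<noteq> mat 1" "\<gamma> *v x = x"
proof (rule ccontr)
  assume "\<not> thesis"
  then have triv: "\<gamma> = mat 1" if "\<gamma> \<in> \<Gamma>" "\<gamma> *v x = x" for \<gamma> using that(1,2) \<open>\<And>\<gamma>. \<gamma> \<in> \<Gamma> \<Longrightarrow> \<gamma> \<noteq> mat 1 \<Longrightarrow> \<gamma> *v x = x \<Longrightarrow> thesis\<close> by blast
  have "inj_on (\<lambda>\<gamma>. \<gamma> *v x) \<Gamma>"
  proof (rule inj_onI)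
    fix \<gamma> \<delta> assume *: "\<gamma> \<in> \<Gamma>" "\<delta> \<in> \<Gamma>" "\<gamma> *v x = \<delta> *v x"
    have "(adj2 \<gamma> ** \<delta>) *v x = adj2 \<gamma> *v (\<gamma> *v x)" using *(3) by (simp add: matrix_vector_mul_assoc)
    also have "\<dots> = x" using det_Gamma[OF *(1)] by (rule adj2_vec_cancel)
    finally have "adj2 \<gamma> ** \<delta> = mat 1" by (rule triv[OF mult_Gamma[OF adj2_Gamma[OF *(1)] *(2)]])
    then have "\<gamma> ** (adj2 \<gamma> ** \<delta>) = \<gamma>" by simp
    then show "\<gamma> = \<delta>" using det_Gamma[OF *(1)] by (simp add: adj2_cancel)
  qed
  then have bij: "bij_betw (\<lambda>\<gamma>. \<gamma> *v x) \<Gamma> \<Lambda>" using orbit_eq[OF x] by (simp add: bij_betw_def)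
  let ?B = "ball (0::real^2) 1"
  have [measurable]: "?B \<in> sets borel" by simp
  have B: "measure lborel ?B \<noteq> 0" by (rule measure_open_pos[of _ ?B]) auto
  have "integrable \<mu> (hits ?B)" by (rule hits_integrable) (use B in auto)
  then have "(\<integral>\<^sup>+C. ennreal (hits ?B C) \<partial>\<mu>) < \<infinity>"
    by (subst nn_integral_eq_integral) (auto simp: hits_def)
  also have "(\<integral>\<^sup>+C. ennreal (hits ?B C) \<partial>\<mu>) = gint (\<lambda>g. indicator ?B (g *v x))"
    unfolding gint_def
  proof (rule nn_integral_cong)
    fix C assume C: "C \<in> space \<mu>"
    have fin: "finite {y\<in>\<Lambda>. sec C *v y \<in> ?B}" using det_sec[OF C] by (intro finite_hits) auto
    have "(\<integral>\<^sup>+\<gamma>. indicator ?B ((sec C ** \<gamma>) *v x) \<partial>count_space \<Gamma>) = (\<integral>\<^sup>+\<gamma>. indicator ?B (sec C *v (\<gamma> *v x)) \<partial>count_space \<Gamma>)"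
      by (simp add: matrix_vector_mul_assoc)
    also have "\<dots> = (\<integral>\<^sup>+y. indicator ?B (sec C *v y) \<partial>count_space \<Lambda>)"
      by (rule nn_integral_bij_count_space[OF bij])
    also have "\<dots> = (\<integral>\<^sup>+y. indicator {y\<in>\<Lambda>. sec C *v y \<in> ?B} y \<partial>count_space \<Lambda>)"
      by (rule nn_integral_cong) (simp add: indicator_def)
    also have "\<dots> = ennreal (hits ?B C)"
      using fin by (subst nn_integral_indicator) (auto simp: emeasure_count_space_finite hits_def ennreal_of_nat_eq_real_of_nat)
    finally show "ennreal (hits ?B C) = (\<integral>\<^sup>+\<gamma>. indicator ?B ((sec C ** \<gamma>) *v x) \<partial>count_space \<Gamma>)" by simp
  qed
  also have "\<dots> = ennreal (c_lattice \<Gamma>) * haar (\<lambda>g. indicator ?B (g *v x))"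
    by (rule gint_eq_haar(1)) measurable
  also have "haar (\<lambda>g. indicator ?B (g *v x)) = \<infinity>"
  proof -
    \<comment> \<open>Right translation by \<open>k\<close> replaces \<open>x\<close> by the first
      unit vector, so that the integrand depends on the first column only.\<close>
    define k where "k = col_matrix x (dual_vec x)"
    have k: "det k = 1" "k *v vector [1, 0] = x"
      using det_dual_vec[OF nonzero[OF x]] by (simp_all add: k_def vec2_eq_iff)
    have "haar (\<lambda>g. indicator ?B (g *v x)) = haar (\<lambda>g. indicator ?B ((g ** k) *v vector [1, 0]))"
      by (simp add: matrix_vector_mul_assoc[symmetric] k)
    also have "\<dots> = haar (\<lambda>g. indicator ?B (g *v vector [1, 0]))"
      by (rule haar_right[where F = "\<lambda>g. indicator ?B (g *v vector [1, 0])"]) (measurable, simp add: k)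
    also have "\<dots> = (\<integral>\<^sup>+y. \<infinity> * indicator ?B y \<partial>lborel)"
      unfolding haar_def
    proof (rule nn_integral_cong)
      fix y t
      have "col_matrix y z *v vector [1, 0] = y" for z by (simp add: vec2_eq_iff)
      then show "(\<integral>\<^sup>+t. indicator ?B (col_matrix y (t *\<^sub>R y + dual_vec y) *v vector [1, 0]) \<partial>lborel) = \<infinity> * indicator ?B y"
        by (simp add: mult.commute)
    qed
    also have "\<dots> = \<infinity> * emeasure lborel ?B"
      by (subst nn_integral_cmult_indicator) auto
    also have "\<dots> = \<infinity>" using B by (auto simp: ennreal_top_mult measure_def)
    finally show ?thesis .
  qed
  finally show False using gint_eq_haar(2)[of "\<lambda>_. 0"] by (simp add: ennreal_mult_top)
qed

text \<open>A matrix of determinant 1 that fixes \<open>x\<close> is a transvection in the direction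
  of \<open>x\<close>, and its powers multiply the parameter \<open>w\<close> by integers. It
  differs from the identity, so \<open>w\<close> is nonzero.\<close>

lemma ex_unipotent:
  assumes x: "x \<in> \<Lambda>"
  obtains w where "w \<noteq> 0" "\<And>k::int. \<exists>\<gamma>\<in>\<Gamma>. \<forall>y. \<gamma> *v y = y + (of_int k * w * det_cols x y) *\<^sub>R x"
proof -
  obtain \<gamma> where \<gamma>: "\<gamma> \<in> \<Gamma>" "\<gamma> \<noteq> mat 1" "\<gamma> *v x = x" using ex_stabiliser[OF x] .
  define z where "z = dual_vec x"
  have xz: "det_cols x z = 1" using nonzero[OF x] by (simp add: z_def det_dual_vec)
  define w where "w = det_cols (\<gamma> *v z) z"
  have "det_cols x (\<gamma> *v z) = 1"
    using det_cols_mat[of \<gamma> x z] \<gamma> det_Gamma xz by simp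
  then have \<gamma>z: "\<gamma> *v z = w *\<^sub>R x + z"
    using vec2_decomp[OF xz, of "\<gamma> *v z"] by (simp add: w_def)
  have \<gamma>y: "\<gamma> *v y = y + (w * det_cols x y) *\<^sub>R x" for y
  proof -
    have y: "y = det_cols y z *\<^sub>R x + det_cols x y *\<^sub>R z" by (rule vec2_decomp[OF xz])
    have "\<gamma> *v y = det_cols y z *\<^sub>R (\<gamma> *v x) + det_cols x y *\<^sub>R (\<gamma> *v z)"
      by (subst y) (simp only: matrix_vector_right_distrib matrix_vector_mult_scaleR)
    also have "\<dots> = (det_cols y z *\<^sub>R x + det_cols x y *\<^sub>R z) + (w * det_cols x y) *\<^sub>R x"
      by (simp add: \<gamma>(3) \<gamma>z scaleR_add_right mult.commute)
    finally show ?thesis using y by simp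
  qed
  have pow: "\<exists>\<gamma>\<in>\<Gamma>. \<forall>y. \<gamma> *v y = y + (real n * w * det_cols x y) *\<^sub>R x" for n
  proof (induction n)
    case 0 show ?case using one_Gamma by (intro bexI[of _ "mat 1"]) auto
  next
    case (Suc n)
    then obtain \<delta> where \<delta>: "\<delta> \<in> \<Gamma>" "\<And>y. \<delta> *v y = y + (real n * w * det_cols x y) *\<^sub>R x" by blast
    have "(\<gamma> ** \<delta>) *v y = y + (real (Suc n) * w * det_cols x y) *\<^sub>R x" for y
      by (simp add: matrix_vector_mul_assoc[symmetric] \<delta> \<gamma>y det_cols_add det_cols_scale algebra_simps scaleR_add_left)
    then show ?case using mult_Gamma[OF \<gamma>(1) \<delta>(1)] by blast
  qed
  have "\<exists>\<gamma>\<in>\<Gamma>. \<forall>y. \<gamma> *v y = y + (of_int k * w * det_cols x y) *\<^sub>R x" for k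
  proof (cases "k \<ge> 0")
    case True
    then show ?thesis using pow[of "nat k"] by simp
  next
    case False
    then obtain \<delta> where \<delta>: "\<delta> \<in> \<Gamma>" "\<And>y. \<delta> *v y = y + (- of_int k * w * det_cols x y) *\<^sub>R x"
      using pow[of "nat (- k)"] by auto
    have "adj2 \<delta> *v y = y + (of_int k * w * det_cols x y) *\<^sub>R x" for y
    proof -
      have "\<delta> *v (y + (of_int k * w * det_cols x y) *\<^sub>R x) = y"
        by (simp add: \<delta> det_cols_add det_cols_scale)
      then show ?thesis using adj2_vec_cancel(1)[OF det_Gamma[OF \<delta>(1)]] by metis
    qed
    then show ?thesis using adj2_Gamma[OF \<delta>(1)] by blast
  qed
  moreover have "w \<noteq> 0"
  proof
    assume "w = 0"
    then have "\<gamma> *v y = y" for y using \<gamma>y by simp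
    then have "\<gamma> = mat 1" by (simp add: matrix_eq)
    then show False using \<gamma>(2) by simp
  qed
  ultimately show ?thesis using that by blast
qed

end

section \<open>Collinear points, reduction of pairs and the gap between determinants\<close>

text \<open>From \<open>y = t x\<close> follows \<open>\<Lambda>2 = t \<Lambda>1\<close>, so hits of
  the unit disc by \<Lambda>2 are hits of the disc of radius \<open>1 / \<bar>t\<bar>\<close> by
  \<Lambda>1. Both orbits have the same mean value constant, so the two areas agree and
  \<open>t\<^sup>2 = 1\<close>. The sign is absorbed by
  \<open>- mat 1 \<in> \<Gamma>\<close>.\<close>

lemma veech_collinear:
  assumes 1: "veech_orbit \<Gamma> \<mu> \<Lambda>1" and 2: "veech_orbit \<Gamma> \<mu> \<Lambda>2"
    and xy: "x \<in> \<Lambda>1" "y \<in> \<Lambda>2" "det_cols x y = 0"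
  shows "\<Lambda>1 = \<Lambda>2" "y = x \<or> y = - x"
proof -
  interpret L1: veech_orbit \<Gamma> \<mu> \<Lambda>1 by fact
  interpret L2: veech_orbit \<Gamma> \<mu> \<Lambda>2 by fact
  obtain t where t: "y = t *\<^sub>R x" using det_cols_eq_0[OF L1.nonzero[OF xy(1)] xy(3)] .
  have t0: "t \<noteq> 0" using L2.nonzero[OF xy(2)] t by auto
  have \<Lambda>2: "\<Lambda>2 = (\<lambda>v. t *\<^sub>R v) ` \<Lambda>1"
    unfolding L2.orbit_eq[OF xy(2)] L1.orbit_eq[OF xy(1)] t by (simp add: image_image matrix_vector_mult_scaleR)
  have "L2.hits (ball 0 1) C = L1.hits (ball 0 (1 / \<bar>t\<bar>)) C" for C
  proof -
    have "{y\<in>\<Lambda>2. L1.sec C *v y \<in> ball 0 1} = (\<lambda>v. t *\<^sub>R v) ` {y\<in>\<Lambda>1. L1.sec C *v y \<in> ball 0 (1 / \<bar>t\<bar>)}"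
      using t0 unfolding \<Lambda>2 by (auto simp: matrix_vector_mult_scaleR field_simps)
    moreover have "inj_on (\<lambda>v. t *\<^sub>R v) S" for S :: "(real^2) set" using t0 by (simp add: inj_on_def)
    ultimately show ?thesis unfolding L1.hits_def L2.hits_def by (simp add: card_image)
  qed
  then have "(\<integral>C. L2.hits (ball 0 1) C \<partial>\<mu>) = (\<integral>C. L1.hits (ball 0 (1 / \<bar>t\<bar>)) C \<partial>\<mu>)" by simp
  then have "measure lborel (ball (0::real^2) 1) = measure lborel (ball (0::real^2) (1 / \<bar>t\<bar>))"
    using L1.gint_eq_haar(2)[of "\<lambda>_. 0"] by (simp add: L1.hits_integral L2.hits_integral)
  then have "pi = pi * (1 / \<bar>t\<bar>)\<^sup>2" using t0 by (simp add: content_ball unit_ball_vol_2)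
  then have "t\<^sup>2 = 1" using t0 by (simp add: field_simps)
  then have "t = 1 \<or> t = -1" by (simp add: power2_eq_1_iff)
  then show "y = x \<or> y = - x" using t by auto
  show "\<Lambda>1 = \<Lambda>2"
  proof -
    have "uminus ` \<Lambda>1 = \<Lambda>1" using L1.uminus_in by force
    then show ?thesis using \<Lambda>2 \<open>t = 1 \<or> t = -1\<close> by auto
  qed
qed

text \<open>A point and its multiple by the ratio are collinear, so \<open>veech_collinear\<close>
  applies.\<close>

lemma homothetic_iff_eq:
  assumes 1: "veech_orbit \<Gamma> \<mu> \<Lambda>1" and 2: "veech_orbit \<Gamma> \<mu> \<Lambda>2"
  shows "homothetic \<Lambda>1 \<Lambda>2 \<longleftrightarrow> \<Lambda>1 = \<Lambda>2"
proof
  interpret L1: veech_orbit \<Gamma> \<mu> \<Lambda>1 by fact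
  obtain x where x: "x \<in> \<Lambda>1" using L1.ex_point by blast
  assume "homothetic \<Lambda>1 \<Lambda>2"
  then obtain r where r: "\<Lambda>2 = (\<lambda>x. r *\<^sub>R x) ` \<Lambda>1" by (auto simp: homothetic_def)
  show "\<Lambda>1 = \<Lambda>2"
    by (rule veech_collinear(1)[OF 1 2 x, of "r *\<^sub>R x"]) (use r x in \<open>auto simp: det_cols_scale\<close>)
next
  assume "\<Lambda>1 = \<Lambda>2"
  then show "homothetic \<Lambda>1 \<Lambda>2" unfolding homothetic_def by (intro exI[of _ 1]) auto
qed

text \<open>Once \<open>x\<close> is moved to \<open>x0\<close>, the second coordinate of
  \<open>y\<close> in the basis \<open>x0\<close>, \<open>z\<close> is the determinant, which
  \<open>D\<close> bounds, and the unipotent stabiliser of \<open>x0\<close> shifts the first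
  coordinate by multiples of \<open>w\<close> times the determinant. After reduction
  \<open>y\<close> lies in a ball of radius \<open>R\<close> that depends only on \<open>x0\<close>,
  \<open>w\<close> and \<open>D\<close>, where \<Lambda>2 is finite.\<close>

lemma veech_reduction:
  assumes 1: "veech_orbit \<Gamma> \<mu> \<Lambda>1" and 2: "veech_orbit \<Gamma> \<mu> \<Lambda>2" and x0: "x0 \<in> \<Lambda>1"
  obtains Y where "finite Y" "Y \<subseteq> \<Lambda>2"
    "\<forall>x\<in>\<Lambda>1. \<forall>y\<in>\<Lambda>2. det_cols x y \<noteq> 0 \<longrightarrow> \<bar>det_cols x y\<bar> \<le> D \<longrightarrow>
      (\<exists>\<gamma>\<in>\<Gamma>. \<gamma> *v x = x0 \<and> \<gamma> *v y \<in> Y)"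
proof -
  interpret L1: veech_orbit \<Gamma> \<mu> \<Lambda>1 by fact
  interpret L2: veech_orbit \<Gamma> \<mu> \<Lambda>2 by fact
  obtain w where w: "w \<noteq> 0" "\<And>k::int. \<exists>\<gamma>\<in>\<Gamma>. \<forall>y. \<gamma> *v y = y + (of_int k * w * det_cols x0 y) *\<^sub>R x0"
    using L1.ex_unipotent[OF x0] by blast
  define z where "z = dual_vec x0"
  have xz: "det_cols x0 z = 1" using L1.nonzero[OF x0] by (simp add: z_def det_dual_vec)
  define R where "R = \<bar>w\<bar> * D * norm x0 + D * norm z"
  show ?thesis
  proof (rule that[of "\<Lambda>2 \<inter> cball 0 R"])
    show "finite (\<Lambda>2 \<inter> cball 0 R)" by (intro L2.finite_orbit_bounded bounded_cball)
    show "\<forall>x\<in>\<Lambda>1. \<forall>y\<in>\<Lambda>2. det_cols x y \<noteq> 0 \<longrightarrow> \<bar>det_cols x y\<bar> \<le> D \<longrightarrow>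
      (\<exists>\<gamma>\<in>\<Gamma>. \<gamma> *v x = x0 \<and> \<gamma> *v y \<in> \<Lambda>2 \<inter> cball 0 R)"
    proof (intro ballI impI)
      fix x y assume x: "x \<in> \<Lambda>1" and y: "y \<in> \<Lambda>2" and d: "det_cols x y \<noteq> 0" "\<bar>det_cols x y\<bar> \<le> D"
      obtain \<alpha> where \<alpha>: "\<alpha> \<in> \<Gamma>" "x0 = \<alpha> *v x" using L1.orbit_eq[OF x] x0 by auto
      define y' where "y' = \<alpha> *v y"
      have y': "y' \<in> \<Lambda>2" using L2.act_in[OF \<alpha>(1) y] by (simp add: y'_def)
      have det: "det_cols x0 y' = det_cols x y"
        using det_cols_mat[of \<alpha> x y] L1.det_Gamma[OF \<alpha>(1)] by (simp add: \<alpha>(2) y'_def)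
      define e where "e = w * det_cols x y"
      have e: "e \<noteq> 0" using w d by (simp add: e_def)
      \<comment> \<open>This removes the integer part in units of \<open>e\<close>; the remaining
        first coordinate is \<open>e\<close> times a fractional part.\<close>
      define k where "k = - \<lfloor>det_cols y' z / e\<rfloor>"
      obtain \<delta> where \<delta>: "\<delta> \<in> \<Gamma>" "\<And>y. \<delta> *v y = y + (of_int k * w * det_cols x0 y) *\<^sub>R x0" using w(2)[of k] by blast
      have "\<delta> *v y' = (det_cols y' z + of_int k * e) *\<^sub>R x0 + det_cols x y *\<^sub>R z"
        using vec2_decomp[OF xz, of y'] by (simp add: \<delta>(2) det e_def scaleR_add_left mult.assoc)
      moreover have "\<bar>det_cols y' z + of_int k * e\<bar> \<le> \<bar>e\<bar>"
      proof -
        have "det_cols y' z + of_int k * e = e * (det_cols y' z / e - of_int \<lfloor>det_cols y' z / e\<rfloor>)"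
          using e by (simp add: k_def field_simps)
        also have "\<bar>\<dots>\<bar> = \<bar>e\<bar> * frac (det_cols y' z / e)" by (simp add: abs_mult frac_def[symmetric])
        also have "\<dots> \<le> \<bar>e\<bar> * 1" by (intro mult_left_mono) (auto intro: less_imp_le[OF frac_lt_1])
        finally show ?thesis by simp
      qed
      moreover have "\<bar>e\<bar> \<le> \<bar>w\<bar> * D" using d by (simp add: e_def abs_mult mult_left_mono)
      ultimately have "norm (\<delta> *v y') \<le> R"
        unfolding R_def using d(2)
        by (auto intro!: order_trans[OF norm_triangle_ineq] add_mono mult_right_mono)
      moreover have "\<delta> *v y' \<in> \<Lambda>2" by (rule L2.act_in[OF \<delta>(1) y'])
      moreover have "(\<delta> ** \<alpha>) *v x = x0"
        by (simp add: matrix_vector_mul_assoc[symmetric] \<alpha>(2)[symmetric] \<delta>(2))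
      moreover have "(\<delta> ** \<alpha>) *v y = \<delta> *v y'" by (simp add: matrix_vector_mul_assoc y'_def)
      ultimately show "\<exists>\<gamma>\<in>\<Gamma>. \<gamma> *v x = x0 \<and> \<gamma> *v y \<in> \<Lambda>2 \<inter> cball 0 R"
        using L1.mult_Gamma[OF \<delta>(1) \<alpha>(1)] by (intro bexI[of _ "\<delta> ** \<alpha>"]) auto
    qed
  qed simp
qed

context veech_orbit
begin

lemma det_gap: obtains d where "d > 0"
  "\<forall>x\<in>\<Lambda>. \<forall>y\<in>\<Lambda>. det_cols x y \<noteq> 0 \<longrightarrow> d \<le> \<bar>det_cols x y\<bar>"
proof -
  obtain x0 where x0: "x0 \<in> \<Lambda>" using ex_point by blast
  obtain Y where Y: "finite Y" "Y \<subseteq> \<Lambda>" "\<forall>x\<in>\<Lambda>. \<forall>y\<in>\<Lambda>. det_cols x y \<noteq> 0 \<longrightarrow> \<bar>det_cols x y\<bar> \<le> 1 \<longrightarrow>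
      (\<exists>\<gamma>\<in>\<Gamma>. \<gamma> *v x = x0 \<and> \<gamma> *v y \<in> Y)"
    by (rule veech_reduction[OF veech_orbit_axioms veech_orbit_axioms x0, of 1])
  \<comment> \<open>The element 1 accounts for determinants above 1 and keeps the set
    nonempty.\<close>
  define D where "D = insert 1 ((\<lambda>y. \<bar>det_cols x0 y\<bar>) ` Y - {0})"
  have D: "finite D" "D \<noteq> {}" "\<And>d. d \<in> D \<Longrightarrow> d > 0" using Y(1) by (auto simp: D_def)
  show ?thesis
  proof (rule that[of "Min D"])
    show "Min D > 0" using D by simp
    show "\<forall>x\<in>\<Lambda>. \<forall>y\<in>\<Lambda>. det_cols x y \<noteq> 0 \<longrightarrow> Min D \<le> \<bar>det_cols x y\<bar>"
    proof (intro ballI impI)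
      fix x y assume xy: "x \<in> \<Lambda>" "y \<in> \<Lambda>" "det_cols x y \<noteq> 0"
      show "Min D \<le> \<bar>det_cols x y\<bar>"
      proof (cases "\<bar>det_cols x y\<bar> \<le> 1")
        case True
        then obtain \<gamma> where \<gamma>: "\<gamma> \<in> \<Gamma>" "\<gamma> *v x = x0" "\<gamma> *v y \<in> Y" using Y(3) xy by blast
        have "det_cols x0 (\<gamma> *v y) = det_cols x y"
          using det_cols_mat[of \<gamma> x y] det_Gamma[OF \<gamma>(1)] by (simp add: \<gamma>(2))
        then have "\<bar>det_cols x y\<bar> \<in> D" using \<gamma>(3) xy(3) by (force simp: D_def)
        then show ?thesis using D by (intro Min_le)
      next
        case False
        have "Min D \<le> 1" using D(1) by (intro Min_le) (auto simp: D_def)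
        then show ?thesis using False by linarith
      qed
    qed
  qed
qed

text \<open>Two points of \<open>g \<Lambda>\<close> in a ball that are closer to each other than the gap between
  determinants allows are collinear, so that a small set contains at most two of them.\<close>

lemma hits_bounded:
  obtains N where "\<forall>g. det g = 1 \<longrightarrow> card {x\<in>\<Lambda>. norm (g *v x) \<le> R} \<le> N"
proof -
  obtain d where d: "d > 0" "\<forall>x\<in>\<Lambda>. \<forall>y\<in>\<Lambda>. det_cols x y \<noteq> 0 \<longrightarrow> d \<le> \<bar>det_cols x y\<bar>"
    by (rule det_gap)
  \<comment> \<open>Two points in a ball of radius \<open>e\<close> differ by less than
    \<open>2 * e\<close>, so their determinant is at most \<open>2 * e * \<bar>R\<bar>\<close> in
    absolute value, which is below \<open>d\<close>; the summand 1 keeps the denominator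
    positive.\<close>
  define e where "e = d / (2 * (\<bar>R\<bar> + 1))"
  have e: "e > 0" using d by (simp add: e_def)
  obtain K where K: "finite K" "cball (0::real^2) R \<subseteq> (\<Union>k\<in>K. ball k e)"
    using compact_cball[of "0::real^2" R] e unfolding compact_eq_totally_bounded by blast
  show ?thesis
  proof (rule that[of "2 * card K"], intro allI impI)
    fix g :: "real^2^2" assume g: "det g = 1"
    define S where "S k = {x\<in>\<Lambda>. norm (g *v x) \<le> R \<and> g *v x \<in> ball k e}" for k
    have S: "card (S k) \<le> 2" "finite (S k)" for k
    proof -
      have "S k \<subseteq> {x, - x}" if x: "x \<in> S k" for x
      proof
        fix y assume y: "y \<in> S k"
        have "dist (g *v x) (g *v y) < 2 * e"
          using x y dist_triangle_half_r[of k "g *v x" "2 * e" "g *v y"] by (auto simp: S_def)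
        then have n: "norm (g *v y - g *v x) < 2 * e" by (simp add: dist_norm norm_minus_commute)
        have "\<bar>det_cols x y\<bar> = \<bar>det_cols (g *v x) (g *v y - g *v x)\<bar>"
          using det_cols_mat[of g x y] g by (simp add: det_cols_diff)
        also have "\<dots> \<le> norm (g *v x) * norm (g *v y - g *v x)" by (rule det_cols_le)
        also have "\<dots> \<le> \<bar>R\<bar> * (2 * e)"
          using x n by (intro mult_mono) (auto simp: S_def)
        also have "\<dots> < d"
          using d(1) by (simp add: e_def field_simps)
        finally have "det_cols x y = 0" using d(2) x y by (force simp: S_def)
        then show "y \<in> {x, - x}"
          using veech_collinear(2)[OF veech_orbit_axioms veech_orbit_axioms, of x y] x y by (simp add: S_def)
      qed
      then obtain x where sub: "S k \<subseteq> {x, - x}" by (cases "S k = {}") blast+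
      then show "finite (S k)" by (rule finite_subset) simp
      have "card (S k) \<le> card {x, - x}" using sub by (intro card_mono) simp_all
      also have "\<dots> \<le> 2" by (simp add: card_insert_if)
      finally show "card (S k) \<le> 2" .
    qed
    have "{x\<in>\<Lambda>. norm (g *v x) \<le> R} \<subseteq> (\<Union>k\<in>K. S k)" using K(2) by (force simp: S_def)
    then have "card {x\<in>\<Lambda>. norm (g *v x) \<le> R} \<le> card (\<Union>k\<in>K. S k)"
      using K(1) S by (intro card_mono) auto
    also have "\<dots> \<le> (\<Sum>k\<in>K. card (S k))" by (rule card_UN_le[OF K(1)])
    also have "\<dots> \<le> (\<Sum>k\<in>K. 2)" by (intro sum_mono S)
    finally show "card {x\<in>\<Lambda>. norm (g *v x) \<le> R} \<le> 2 * card K" by simp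
  qed
qed

end


section \<open>Sums over pairs\<close>

text \<open>The bridge from counting integrals in \<open>ennreal\<close>, where the unfolding takes
  place, to the \<open>infsum\<close> of the final formula.\<close>

lemma count_space_infsum:
  fixes f :: "'a \<Rightarrow> real"
  assumes nonneg: "\<And>x. x \<in> A \<Longrightarrow> 0 \<le> f x" and fin: "(\<integral>\<^sup>+x. ennreal (f x) \<partial>count_space A) < \<infinity>"
  shows "f summable_on A" and "infsum f A = enn2real (\<integral>\<^sup>+x. ennreal (f x) \<partial>count_space A)"
proof -
  have "integrable (count_space A) f"
    using nonneg fin by (intro integrableI_nonneg) (auto simp: AE_count_space)
  then have abs: "Infinite_Set_Sum.abs_summable_on f A"
    by (simp add: Infinite_Set_Sum.abs_summable_on_def)
  then show "f summable_on A"
    using abs_summable_equivalent abs_summable_summable by blast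
  have "infsum f A = infsetsum f A" by (rule infsetsum_infsum[OF abs, symmetric])
  also have "\<dots> = enn2real (\<integral>\<^sup>+x. ennreal (f x) \<partial>count_space A)"
    using fin nonneg by (intro infsetsum_conv_nn_integral) auto
  finally show "infsum f A = enn2real (\<integral>\<^sup>+x. ennreal (f x) \<partial>count_space A)" .
qed

lemma nn_integral_count_space_finite_Union:
  assumes "finite \<K>" and disj: "\<And>K L. K \<in> \<K> \<Longrightarrow> L \<in> \<K> \<Longrightarrow> K \<noteq> L \<Longrightarrow> K \<inter> L = {}"
  shows "(\<integral>\<^sup>+p. F p \<partial>count_space (\<Union>\<K>)) = (\<Sum>K\<in>\<K>. \<integral>\<^sup>+p. F p \<partial>count_space K)"
proof -
  have ind: "(\<integral>\<^sup>+p. F p \<partial>count_space K) = (\<integral>\<^sup>+p. F p * indicator K p \<partial>count_space UNIV)" for K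
    by (rule nn_integral_count_space_indicator) simp
  have "indicator (\<Union>\<K>) p = (\<Sum>K\<in>\<K>. indicator K p :: ennreal)" for p
    using indicator_UN_disjoint[OF assms(1), of id p] disj by (auto simp: disjoint_family_on_def)
  then show ?thesis
    unfolding ind by (simp add: nn_integral_sum[symmetric] sum_distrib_left)
qed

text \<open>The indicator of \<open>c = D p\<close> sums to 1 over \<open>c\<close>; insert it and
  exchange the two summations.\<close>

lemma nn_integral_count_space_fibers:
  assumes "countable P"
  shows "(\<integral>\<^sup>+p. F p \<partial>count_space P) = (\<integral>\<^sup>+c. (\<integral>\<^sup>+p. F p \<partial>count_space {p\<in>P. D p = c}) \<partial>count_space (D ` P))"
proof -
  interpret p: sigma_finite_measure "count_space P"
    by (rule sigma_finite_measure_count_space_countable[OF assms])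
  interpret d: sigma_finite_measure "count_space (D ` P)"
    by (rule sigma_finite_measure_count_space_countable) (simp add: assms)
  interpret pair_sigma_finite "count_space P" "count_space (D ` P)" ..
  have "(\<integral>\<^sup>+p. F p \<partial>count_space P) = (\<integral>\<^sup>+p. \<integral>\<^sup>+c. F p * indicator {D p} c \<partial>count_space (D ` P) \<partial>count_space P)"
    by (rule nn_integral_cong) (subst nn_integral_cmult_indicator, auto)
  also have "\<dots> = (\<integral>\<^sup>+c. \<integral>\<^sup>+p. F p * indicator {D p} c \<partial>count_space P \<partial>count_space (D ` P))"
    by (rule Fubini'[symmetric]) (simp add: pair_measure_countable assms)
  also have "\<dots> = (\<integral>\<^sup>+c. (\<integral>\<^sup>+p. F p \<partial>count_space {p\<in>P. D p = c}) \<partial>count_space (D ` P))"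
  proof (rule nn_integral_cong)
    fix c
    have "(\<integral>\<^sup>+p. F p * indicator {D p} c \<partial>count_space P) = (\<integral>\<^sup>+p. F p * indicator {D p} c \<partial>count_space {p\<in>P. D p = c})"
      by (rule nn_integral_count_space_eq) auto
    also have "\<dots> = (\<integral>\<^sup>+p. F p \<partial>count_space {p\<in>P. D p = c})"
      by (rule nn_integral_cong) auto
    finally show "(\<integral>\<^sup>+p. F p * indicator {D p} c \<partial>count_space P) = (\<integral>\<^sup>+p. F p \<partial>count_space {p\<in>P. D p = c})" .
  qed
  finally show ?thesis .
qed

text \<open>The order of integration is inherited from \<open>haar\<close>. The final formula has
  the opposite one, and \<open>transverse_integral_nonneg\<close> passes between them by Tonelli's
  theorem.\<close>

definition star_integral :: "(real^2 \<Rightarrow> real^2) \<Rightarrow> real \<Rightarrow> ((real^2) \<times> (real^2) \<Rightarrow> ennreal) \<Rightarrow> ennreal"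
  where "star_integral star c F = (\<integral>\<^sup>+x. \<integral>\<^sup>+t. F (x, t *\<^sub>R x + c *\<^sub>R star x) \<partial>lborel \<partial>lborel)"

text \<open>The matrix \<open>k\<close> with columns \<open>x\<close> and \<open>y / c\<close> has
  determinant 1, and right invariance replaces the pair by the first unit vector and
  \<open>c\<close> times the second. The factor \<open>1 / \<bar>c\<bar>\<close> is the Jacobian of
  the substitution \<open>c * t\<close> for \<open>t\<close>.\<close>

lemma haar_pair:
  assumes F [measurable]: "F \<in> borel_measurable borel" and c: "c \<noteq> 0"
    and [measurable]: "star \<in> borel_measurable borel"
    and star: "\<And>x. x \<noteq> 0 \<Longrightarrow> det_cols x (star x) = 1"
    and xy: "det_cols x y = c"
  shows "haar (\<lambda>A. F (A *v x, A *v y)) = ennreal (1 / \<bar>c\<bar>) * star_integral star c F"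
proof -
  let ?e1 = "vector [1, 0] :: real^2" and ?e2 = "vector [0, 1] :: real^2"
  define k where "k = col_matrix x ((1 / c) *\<^sub>R y)"
  have k: "det k = 1" "k *v ?e1 = x" "c *\<^sub>R (k *v ?e2) = y"
    using xy c by (simp_all add: k_def det_cols_scale vec2_eq_iff)
  have "haar (\<lambda>A. F (A *v x, A *v y)) = haar (\<lambda>A. F ((A ** k) *v ?e1, c *\<^sub>R ((A ** k) *v ?e2)))"
    using k(2,3) by (simp add: matrix_vector_mul_assoc[symmetric] matrix_vector_mult_scaleR[symmetric])
  also have "\<dots> = haar (\<lambda>A. F (A *v ?e1, c *\<^sub>R (A *v ?e2)))"
    by (rule haar_right[where F = "\<lambda>A. F (A *v ?e1, c *\<^sub>R (A *v ?e2))"]) (measurable, simp add: k)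
  also have "\<dots> = (\<integral>\<^sup>+x. \<integral>\<^sup>+t. F (x, c *\<^sub>R (t *\<^sub>R x + star x)) \<partial>lborel \<partial>lborel)"
  proof -
    have col: "col_matrix u v *v ?e1 = u" "col_matrix u v *v ?e2 = v" for u v
      by (simp_all add: vec2_eq_iff)
    have "haar (\<lambda>A. F (A *v ?e1, c *\<^sub>R (A *v ?e2))) = (\<integral>\<^sup>+x. \<integral>\<^sup>+t. F (col_matrix x (t *\<^sub>R x + star x) *v ?e1, c *\<^sub>R (col_matrix x (t *\<^sub>R x + star x) *v ?e2)) \<partial>lborel \<partial>lborel)"
    proof (rule haar_dual_indep)
      show "AE x in lborel. det_cols x (star x) = 1"
        using AE_vec2_nonzero by eventually_elim (rule star)
    qed measurable
    then show ?thesis unfolding col .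
  qed
  also have "\<dots> = (\<integral>\<^sup>+x. ennreal (1 / \<bar>c\<bar>) * (\<integral>\<^sup>+t. F (x, t *\<^sub>R x + c *\<^sub>R star x) \<partial>lborel) \<partial>lborel)"
  proof (rule nn_integral_cong)
    fix x :: "real^2"
    have "(\<integral>\<^sup>+t. F (x, t *\<^sub>R x + c *\<^sub>R star x) \<partial>lborel) =
        ennreal \<bar>c\<bar> * (\<integral>\<^sup>+t. F (x, (0 + c * t) *\<^sub>R x + c *\<^sub>R star x) \<partial>lborel)"
      by (rule nn_integral_real_affine[OF _ c]) measurable
    then show "(\<integral>\<^sup>+t. F (x, c *\<^sub>R (t *\<^sub>R x + star x)) \<partial>lborel) =
        ennreal (1 / \<bar>c\<bar>) * (\<integral>\<^sup>+t. F (x, t *\<^sub>R x + c *\<^sub>R star x) \<partial>lborel)"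
      using c by (simp add: scaleR_add_right mult.assoc[symmetric] ennreal_mult[symmetric])
  qed
  also have "\<dots> = ennreal (1 / \<bar>c\<bar>) * star_integral star c F"
    unfolding star_integral_def by (rule nn_integral_cmult) measurable
  finally show ?thesis .
qed

section \<open>Orbits of pairs and their unfolding\<close>

definition act_pair :: "real^2^2 \<Rightarrow> (real^2) \<times> (real^2) \<Rightarrow> (real^2) \<times> (real^2)"
  where "act_pair g p = (g *v fst p, g *v snd p)"

lemma act_pair_mult: "act_pair g (act_pair h p) = act_pair (g ** h) p"
  by (simp add: act_pair_def matrix_vector_mul_assoc)

lemma act_pair_one [simp]: "act_pair (mat 1) p = p"
  by (simp add: act_pair_def)

definition det_pair :: "(real^2) \<times> (real^2) \<Rightarrow> real"
  where "det_pair p = det_cols (fst p) (snd p)"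

lemma det_act_pair: "det_pair (act_pair g p) = det g * det_pair p"
  by (simp add: det_pair_def act_pair_def det_cols_mat)

lemma act_pair_inj:
  assumes "det_pair p \<noteq> 0" "act_pair g p = act_pair h p" shows "g = h"
proof -
  have eq: "g *v fst p = h *v fst p" "g *v snd p = h *v snd p"
    using assms(2) by (simp_all add: act_pair_def)
  let ?c = "det_pair p"
  have "det_cols (fst p) ((1 / ?c) *\<^sub>R snd p) = 1"
    using assms(1) by (simp add: det_cols_scale det_pair_def[symmetric])
  note d = vec2_decomp[OF this]
  have "g *v z = h *v z" for z
    by (subst (1 2) d[of z]) (simp only: matrix_vector_right_distrib matrix_vector_mult_scaleR eq)
  then show ?thesis by (simp add: matrix_eq)
qed

locale veech_pair = L1: veech_orbit \<Gamma> \<mu> \<Lambda>1 + L2: veech_orbit \<Gamma> \<mu> \<Lambda>2 for \<Gamma> \<mu> \<Lambda>1 \<Lambda>2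
begin

definition pair_orbit :: "(real^2) \<times> (real^2) \<Rightarrow> ((real^2) \<times> (real^2)) set"
  where "pair_orbit p = (\<lambda>\<gamma>. act_pair \<gamma> p) ` \<Gamma>"

definition level :: "real \<Rightarrow> ((real^2) \<times> (real^2)) set"
  where "level c = {p \<in> \<Lambda>1 \<times> \<Lambda>2. det_pair p = c}"

lemma pair_orbit_self: "p \<in> pair_orbit p"
  using L1.one_Gamma by (auto simp: pair_orbit_def intro!: image_eqI[of _ _ "mat 1"])

lemma pair_orbit_subset: "p \<in> level c \<Longrightarrow> pair_orbit p \<subseteq> level c"
  using L1.act_in L2.act_in
  by (auto simp: pair_orbit_def level_def det_act_pair L1.det_Gamma) (auto simp: act_pair_def)

lemma pair_orbit_mem_eq:
  assumes "q \<in> pair_orbit p" shows "pair_orbit q = pair_orbit p"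
proof -
  obtain \<gamma> where \<gamma>: "\<gamma> \<in> \<Gamma>" "q = act_pair \<gamma> p" using assms by (auto simp: pair_orbit_def)
  have "pair_orbit q = (\<lambda>\<delta>. act_pair \<delta> p) ` ((\<lambda>\<delta>. \<delta> ** \<gamma>) ` \<Gamma>)"
    by (simp add: pair_orbit_def \<gamma>(2) act_pair_mult image_image)
  also have "(\<lambda>\<delta>. \<delta> ** \<gamma>) ` \<Gamma> = \<Gamma>"
  proof (intro equalityI subsetI)
    fix \<delta> assume "\<delta> \<in> \<Gamma>"
    then have "\<delta> ** adj2 \<gamma> \<in> \<Gamma>" using \<gamma>(1) L1.mult_Gamma L1.adj2_Gamma by simp
    then show "\<delta> \<in> (\<lambda>\<delta>. \<delta> ** \<gamma>) ` \<Gamma>"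
      using L1.cancel_Gamma(2)[OF \<gamma>(1), symmetric] by (rule rev_image_eqI)
  qed (use \<gamma>(1) L1.mult_Gamma in auto)
  finally show ?thesis by (simp add: pair_orbit_def)
qed

text \<open>The relation is the orbit relation up to inverting \<gamma>. As images of \<Gamma> the
  classes become accessible to unfolding.\<close>

lemma quotient_level: "{(x, y). (x, y) \<in> \<Lambda>1 \<times> \<Lambda>2 \<and> det_cols x y = c} // pair_equiv \<Gamma> \<Lambda>1 \<Lambda>2 = pair_orbit ` level c"
proof -
  have "pair_equiv \<Gamma> \<Lambda>1 \<Lambda>2 `` {p} = pair_orbit p" if "p \<in> level c" for p
  proof (intro equalityI subsetI)
    fix q assume "q \<in> pair_equiv \<Gamma> \<Lambda>1 \<Lambda>2 `` {p}"
    then obtain \<gamma> where \<gamma>: "\<gamma> \<in> \<Gamma>" "p = act_pair \<gamma> q"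
      by (auto simp: pair_equiv_def act_pair_def)
    then have "q = act_pair (adj2 \<gamma>) p" by (simp add: act_pair_mult L1.det_Gamma)
    then show "q \<in> pair_orbit p" using L1.adj2_Gamma[OF \<gamma>(1)] by (auto simp: pair_orbit_def)
  next
    fix q assume q: "q \<in> pair_orbit p"
    then have "q \<in> level c" using pair_orbit_subset that by blast
    moreover obtain \<gamma> where \<gamma>: "\<gamma> \<in> \<Gamma>" "p = act_pair \<gamma> q"
      using pair_orbit_mem_eq[OF q] pair_orbit_self[of p] by (auto simp: pair_orbit_def)
    ultimately show "q \<in> pair_equiv \<Gamma> \<Lambda>1 \<Lambda>2 `` {p}"
      using that by (auto simp: pair_equiv_def level_def act_pair_def intro!: bexI[of _ \<gamma>])
  qed
  moreover have "{(x, y). (x, y) \<in> \<Lambda>1 \<times> \<Lambda>2 \<and> det_cols x y = c} = level c"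
    by (auto simp: level_def det_pair_def)
  ultimately show ?thesis by (auto simp: quotient_def)
qed

lemma pair_count_eq: "pair_count \<Gamma> \<Lambda>1 \<Lambda>2 c = card (pair_orbit ` level c)"
  unfolding pair_count_def quotient_level ..

text \<open>\<open>pair_count\<close> is a \<open>card\<close>, which would be 0 for infinitely many
  classes, so finiteness is what makes it a multiplicity. Every class at level \<open>c\<close>
  contains a pair \<open>(x0, y)\<close> with \<open>y\<close> in the finite set of
  \<open>veech_reduction\<close>.\<close>

lemma finite_pair_orbits:
  assumes "c \<noteq> 0" shows "finite (pair_orbit ` level c)"
proof -
  obtain x0 where x0: "x0 \<in> \<Lambda>1" using L1.ex_point by blast
  obtain Y where Y: "finite Y" "Y \<subseteq> \<Lambda>2" "\<forall>x\<in>\<Lambda>1. \<forall>y\<in>\<Lambda>2. det_cols x y \<noteq> 0 \<longrightarrow> \<bar>det_cols x y\<bar> \<le> \<bar>c\<bar> \<longrightarrow>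
      (\<exists>\<gamma>\<in>\<Gamma>. \<gamma> *v x = x0 \<and> \<gamma> *v y \<in> Y)"
    by (rule veech_reduction[OF L1.veech_orbit_axioms L2.veech_orbit_axioms x0, of "\<bar>c\<bar>"])
  have "pair_orbit ` level c \<subseteq> (\<lambda>y. pair_orbit (x0, y)) ` Y"
  proof
    fix K assume "K \<in> pair_orbit ` level c"
    then obtain x y where K: "K = pair_orbit (x, y)" "x \<in> \<Lambda>1" "y \<in> \<Lambda>2" "det_cols x y = c"
      by (auto simp: level_def det_pair_def)
    then obtain \<gamma> where \<gamma>: "\<gamma> \<in> \<Gamma>" "\<gamma> *v x = x0" "\<gamma> *v y \<in> Y" using Y(3) assms by force
    then have "(x0, \<gamma> *v y) \<in> pair_orbit (x, y)"
      by (auto simp: pair_orbit_def act_pair_def)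
    then have "K = pair_orbit (x0, \<gamma> *v y)" using pair_orbit_mem_eq K(1) by blast
    then show "K \<in> (\<lambda>y. pair_orbit (x0, y)) ` Y" using \<gamma>(3) by (rule image_eqI)
  qed
  then show ?thesis using Y(1) finite_surj by blast
qed

text \<open>Values in \<open>ennreal\<close> let sums and integrals be exchanged before convergence
  is known; \<open>part\<close> is the real counterpart.\<close>

definition nn_part :: "((real^2) \<times> (real^2)) set \<Rightarrow> ((real^2) \<times> (real^2) \<Rightarrow> ennreal) \<Rightarrow> (real^2^2) set \<Rightarrow> ennreal"
  where "nn_part P F C = (\<integral>\<^sup>+p. F (act_pair (L1.sec C) p) \<partial>count_space P)"

lemma countable_pairs: "P \<subseteq> \<Lambda>1 \<times> \<Lambda>2 \<Longrightarrow> countable P"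
  by (rule countable_subset) (auto intro: countable_SIGMA L1.countable_orbit L2.countable_orbit)

lemma nn_part_measurable:
  assumes [measurable]: "F \<in> borel_measurable borel" and "P \<subseteq> \<Lambda>1 \<times> \<Lambda>2"
  shows "nn_part P F \<in> borel_measurable \<mu>"
proof -
  interpret sigma_finite_measure "count_space P"
    by (rule sigma_finite_measure_count_space_countable[OF countable_pairs[OF assms(2)]])
  have [measurable]: "(\<lambda>z. fst (snd z)) \<in> borel_measurable (\<mu> \<Otimes>\<^sub>M count_space P)" "(\<lambda>z. snd (snd z)) \<in> borel_measurable (\<mu> \<Otimes>\<^sub>M count_space P)"
    by (rule measurable_compose[OF measurable_snd[of \<mu> "count_space P"]]; simp)+
  have "(\<lambda>z. F (act_pair (L1.sec (fst z)) (snd z))) \<in> borel_measurable (\<mu> \<Otimes>\<^sub>M count_space P)"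
    unfolding act_pair_def by measurable
  then show ?thesis
    unfolding nn_part_def[abs_def] by (intro borel_measurable_nn_integral) (simp add: split_def)
qed

lemma nn_part_pair_orbit:
  assumes [measurable]: "F \<in> borel_measurable borel" and c: "c \<noteq> 0" "p \<in> level c"
    and star: "star \<in> borel_measurable borel" "\<And>x. x \<noteq> 0 \<Longrightarrow> det_cols x (star x) = 1"
  shows "(\<integral>\<^sup>+C. nn_part (pair_orbit p) F C \<partial>\<mu>) = ennreal (c_lattice \<Gamma> / \<bar>c\<bar>) * star_integral star c F"
proof -
  have d: "det_pair p = c" using c by (simp add: level_def)
  have "inj_on (\<lambda>\<gamma>. act_pair \<gamma> p) \<Gamma>"
    using act_pair_inj[of p] c(1) d by (intro inj_onI) auto
  then have bij: "bij_betw (\<lambda>\<gamma>. act_pair \<gamma> p) \<Gamma> (pair_orbit p)"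
    by (simp add: bij_betw_def pair_orbit_def)
  have "(\<integral>\<^sup>+C. nn_part (pair_orbit p) F C \<partial>\<mu>) = L1.gint (\<lambda>A. F (A *v fst p, A *v snd p))"
    unfolding L1.gint_def nn_part_def
    by (subst nn_integral_bij_count_space[OF bij, symmetric]) (simp add: act_pair_mult, simp add: act_pair_def)
  also have "\<dots> = ennreal (c_lattice \<Gamma>) * haar (\<lambda>A. F (A *v fst p, A *v snd p))"
    by (rule L1.gint_eq_haar(1)) measurable
  also have "\<dots> = ennreal (c_lattice \<Gamma>) * (ennreal (1 / \<bar>c\<bar>) * star_integral star c F)"
    using d by (subst haar_pair[OF assms(1) c(1) star]) (simp_all add: det_pair_def)
  also have "\<dots> = ennreal (c_lattice \<Gamma> / \<bar>c\<bar>) * star_integral star c F"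
    using L1.gint_eq_haar(2)[of "\<lambda>_. 0"] by (simp add: mult.assoc[symmetric] ennreal_mult[symmetric])
  finally show ?thesis .
qed

lemma nn_part_level:
  assumes F: "F \<in> borel_measurable borel" and c: "c \<noteq> 0"
    and star: "star \<in> borel_measurable borel" "\<And>x. x \<noteq> 0 \<Longrightarrow> det_cols x (star x) = 1"
  shows "(\<integral>\<^sup>+C. nn_part (level c) F C \<partial>\<mu>) =
    ennreal (real (pair_count \<Gamma> \<Lambda>1 \<Lambda>2 c) * (c_lattice \<Gamma> / \<bar>c\<bar>)) * star_integral star c F"
proof -
  have U: "\<Union>(pair_orbit ` level c) = level c"
    using pair_orbit_subset pair_orbit_self by blast
  have disj: "K \<inter> L = {}" if KL: "K \<in> pair_orbit ` level c" "L \<in> pair_orbit ` level c" "K \<noteq> L" for K L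
  proof (rule ccontr)
    assume "K \<inter> L \<noteq> {}"
    then obtain q where q: "q \<in> K" "q \<in> L" by blast
    obtain p p' where p: "K = pair_orbit p" "L = pair_orbit p'" using KL by blast
    have "K = L" using pair_orbit_mem_eq q unfolding p by metis
    then show False using KL by simp
  qed
  have sub: "K \<subseteq> \<Lambda>1 \<times> \<Lambda>2" if "K \<in> pair_orbit ` level c" for K
    using that pair_orbit_subset by (auto simp: level_def)
  have "(\<integral>\<^sup>+C. nn_part (level c) F C \<partial>\<mu>) = (\<integral>\<^sup>+C. (\<Sum>K\<in>pair_orbit ` level c. nn_part K F C) \<partial>\<mu>)"
    unfolding nn_part_def
    by (subst nn_integral_count_space_finite_Union[OF finite_pair_orbits[OF c] disj, symmetric]) (simp_all add: U)
  also have "\<dots> = (\<Sum>K\<in>pair_orbit ` level c. \<integral>\<^sup>+C. nn_part K F C \<partial>\<mu>)"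
    by (rule nn_integral_sum) (rule nn_part_measurable[OF F sub])
  also have "\<dots> = (\<Sum>K\<in>pair_orbit ` level c. ennreal (c_lattice \<Gamma> / \<bar>c\<bar>) * star_integral star c F)"
    using nn_part_pair_orbit[OF F c _ star] by (intro sum.cong) auto
  also have "\<dots> = ennreal (real (pair_count \<Gamma> \<Lambda>1 \<Lambda>2 c) * (c_lattice \<Gamma> / \<bar>c\<bar>)) * star_integral star c F"
  proof -
    have "ennreal (real n * (c_lattice \<Gamma> / \<bar>c\<bar>)) = of_nat n * ennreal (c_lattice \<Gamma> / \<bar>c\<bar>)" for n
      by (simp only: ennreal_mult'[OF of_nat_0_le_iff] ennreal_of_nat_eq_real_of_nat)
    then show ?thesis by (simp only: sum_constant pair_count_eq mult.assoc)
  qed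
  finally show ?thesis .
qed

definition transverse :: "((real^2) \<times> (real^2)) set"
  where "transverse = {p \<in> \<Lambda>1 \<times> \<Lambda>2. det_pair p \<noteq> 0}"

lemma det_values_eq: "det_values \<Lambda>1 \<Lambda>2 - {0} = det_pair ` transverse"
  by (force simp: det_values_def transverse_def det_pair_def)

theorem nn_part_transverse:
  assumes F: "F \<in> borel_measurable borel"
    and star: "star \<in> borel_measurable borel" "\<And>x. x \<noteq> 0 \<Longrightarrow> det_cols x (star x) = 1"
  shows "(\<integral>\<^sup>+C. nn_part transverse F C \<partial>\<mu>) = (\<integral>\<^sup>+c. ennreal (real (pair_count \<Gamma> \<Lambda>1 \<Lambda>2 c) * (c_lattice \<Gamma> / \<bar>c\<bar>)) *
    star_integral star c F \<partial>count_space (det_values \<Lambda>1 \<Lambda>2 - {0}))"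
proof -
  let ?N = "det_values \<Lambda>1 \<Lambda>2 - {0}"
  have cT: "countable transverse" by (rule countable_pairs) (auto simp: transverse_def)
  then have cN: "countable ?N" by (simp add: det_values_eq)
  interpret N: sigma_finite_measure "count_space ?N"
    by (rule sigma_finite_measure_count_space_countable[OF cN])
  interpret NM: pair_sigma_finite "count_space ?N" \<mu> ..
  have lev: "{p \<in> transverse. det_pair p = c} = level c" if "c \<in> ?N" for c
    using that by (auto simp: transverse_def level_def)
  have "nn_part transverse F C = (\<integral>\<^sup>+c. nn_part (level c) F C \<partial>count_space ?N)" for C
    unfolding nn_part_def nn_integral_count_space_fibers[OF cT, of _ det_pair] det_values_eq[symmetric]
    by (rule nn_integral_cong) (simp add: lev del: Diff_iff)
  then have "(\<integral>\<^sup>+C. nn_part transverse F C \<partial>\<mu>) = (\<integral>\<^sup>+C. \<integral>\<^sup>+c. nn_part (level c) F C \<partial>count_space ?N \<partial>\<mu>)"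
    by simp
  also have "\<dots> = (\<integral>\<^sup>+c. \<integral>\<^sup>+C. nn_part (level c) F C \<partial>\<mu> \<partial>count_space ?N)"
    by (intro NM.Fubini' measurable_pair_measure_countable1[OF cN])
      (simp, rule nn_part_measurable[OF F], auto simp: level_def)
  also have "\<dots> = (\<integral>\<^sup>+c. ennreal (real (pair_count \<Gamma> \<Lambda>1 \<Lambda>2 c) * (c_lattice \<Gamma> / \<bar>c\<bar>)) *
    star_integral star c F \<partial>count_space ?N)"
    by (rule nn_integral_cong) (simp add: nn_part_level[OF F _ star])
  finally show ?thesis .
qed

end


section \<open>Bounded functions of compact support and convergence\<close>

definition supported_in_box :: "((real^2) \<times> (real^2) \<Rightarrow> real) \<Rightarrow> real \<Rightarrow> bool"
  where "supported_in_box f R \<longleftrightarrow> (\<forall>x y. f (x, y) \<noteq> 0 \<longrightarrow> norm x \<le> R \<and> norm y \<le> R)"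

lemma pos_part:
  fixes f :: "(real^2) \<times> (real^2) \<Rightarrow> real"
  assumes [measurable]: "f \<in> borel_measurable borel" and f: "supported_in_box f R" "\<And>p. \<bar>f p\<bar> \<le> M"
  shows "(\<lambda>p. max (f p) 0) \<in> borel_measurable borel" "supported_in_box (\<lambda>p. max (f p) 0) R"
    "0 \<le> max (f p) 0" "\<bar>max (f p) 0\<bar> \<le> M"
proof -
  show "supported_in_box (\<lambda>p. max (f p) 0) R"
    unfolding supported_in_box_def
  proof (intro allI impI)
    fix x y assume "max (f (x, y)) 0 \<noteq> 0"
    then have "f (x, y) \<noteq> 0" by auto
    then show "norm x \<le> R \<and> norm y \<le> R" using f(1) unfolding supported_in_box_def by blast
  qed
  show "\<bar>max (f p) 0\<bar> \<le> M" using f(2)[of p] by (auto simp: max_def)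
qed auto

lemma pos_neg_parts:
  fixes f :: "(real^2) \<times> (real^2) \<Rightarrow> real"
  assumes f: "f \<in> borel_measurable borel" "supported_in_box f R" "\<And>p. \<bar>f p\<bar> \<le> M"
    and u: "u = (\<lambda>p. max (f p) 0)" and v: "v = (\<lambda>p. max (- f p) 0)"
  shows "f = (\<lambda>p. u p - v p)"
    "u \<in> borel_measurable borel" "supported_in_box u R" "\<And>p. 0 \<le> u p" "\<And>p. \<bar>u p\<bar> \<le> M"
    "v \<in> borel_measurable borel" "supported_in_box v R" "\<And>p. 0 \<le> v p" "\<And>p. \<bar>v p\<bar> \<le> M"
proof -
  have g: "(\<lambda>p. - f p) \<in> borel_measurable borel" "supported_in_box (\<lambda>p. - f p) R" "\<bar>- f p\<bar> \<le> M" for p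
    using f by (simp_all add: supported_in_box_def)
  show "u \<in> borel_measurable borel" "supported_in_box u R" "\<And>p. 0 \<le> u p" "\<And>p. \<bar>u p\<bar> \<le> M"
    unfolding u by (rule pos_part[OF f])+
  show "v \<in> borel_measurable borel" "supported_in_box v R" "\<And>p. 0 \<le> v p" "\<And>p. \<bar>v p\<bar> \<le> M"
    unfolding v by (rule pos_part[OF g])+
  show "f = (\<lambda>p. u p - v p)" unfolding u v by (auto simp: max_def)
qed

context veech_pair
begin

definition near_pairs :: "real \<Rightarrow> real^2^2 \<Rightarrow> ((real^2) \<times> (real^2)) set"
  where "near_pairs R g = {x\<in>\<Lambda>1. norm (g *v x) \<le> R} \<times> {y\<in>\<Lambda>2. norm (g *v y) \<le> R}"

lemma finite_near:
  assumes "det g = 1"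
  shows "finite {x\<in>\<Lambda>1. norm (g *v x) \<le> R}" "finite {y\<in>\<Lambda>2. norm (g *v y) \<le> R}"
  using L1.finite_hits[OF assms bounded_cball[of 0 R]] L2.finite_hits[OF assms bounded_cball[of 0 R]] by simp_all

lemma near_pairs_bounded:
  obtains N where "\<forall>g. det g = 1 \<longrightarrow> finite (near_pairs R g) \<and> card (near_pairs R g) \<le> N"
proof -
  obtain N1 where N1: "\<forall>g. det g = 1 \<longrightarrow> card {x\<in>\<Lambda>1. norm (g *v x) \<le> R} \<le> N1"
    by (rule L1.hits_bounded)
  obtain N2 where N2: "\<forall>g. det g = 1 \<longrightarrow> card {y\<in>\<Lambda>2. norm (g *v y) \<le> R} \<le> N2"
    by (rule L2.hits_bounded)
  show ?thesis
  proof (rule that[of "N1 * N2"], intro allI impI)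
    fix g :: "real^2^2" assume g: "det g = 1"
    show "finite (near_pairs R g) \<and> card (near_pairs R g) \<le> N1 * N2"
      using finite_near[OF g] N1 N2 g by (auto simp: near_pairs_def card_cartesian_product intro!: mult_le_mono)
  qed
qed

text \<open>Meant for \<open>f\<close> supported in a box of radius \<open>R\<close>: only the
  finitely many near pairs contribute, and a finite sum tolerates signs.\<close>

definition part :: "((real^2) \<times> (real^2)) set \<Rightarrow> real \<Rightarrow> ((real^2) \<times> (real^2) \<Rightarrow> real) \<Rightarrow> (real^2^2) set \<Rightarrow> real"
  where "part P R f C = (\<Sum>p\<in>near_pairs R (L1.sec C) \<inter> P. f (act_pair (L1.sec C) p))"

lemma finite_near_pairs: "C \<in> space \<mu> \<Longrightarrow> finite (near_pairs R (L1.sec C))"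
  using finite_near[OF L1.det_sec] by (simp add: near_pairs_def)

text \<open>Outside the box all summands vanish, so both nested \<open>infsum\<close> expressions
  are finite sums and can be merged into one.\<close>

lemma transform_eq_part:
  assumes C: "C \<in> space \<mu>" and f: "supported_in_box f R"
  shows "siegel_veech_transform \<Lambda>1 \<Lambda>2 f C = part (\<Lambda>1 \<times> \<Lambda>2) R f C"
proof -
  define g where "g = L1.sec C"
  have g: "det g = 1" using C by (simp add: g_def L1.det_sec)
  let ?A = "{x\<in>\<Lambda>1. norm (g *v x) \<le> R}" and ?B = "{y\<in>\<Lambda>2. norm (g *v y) \<le> R}"
  have "siegel_veech_transform \<Lambda>1 \<Lambda>2 f C = (\<Sum>\<^sub>\<infinity>x\<in>\<Lambda>1. \<Sum>\<^sub>\<infinity>y\<in>\<Lambda>2. f (g *v x, g *v y))"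
    using siegel_veech_transform_coset[OF L1.subgroup L1.orbit L2.orbit, of g f] L1.coset_sec[OF C] g
    by (simp add: g_def)
  also have "\<dots> = (\<Sum>\<^sub>\<infinity>x\<in>\<Lambda>1. \<Sum>y\<in>?B. f (g *v x, g *v y))"
  proof (rule infsum_cong)
    fix x
    have "(\<Sum>\<^sub>\<infinity>y\<in>\<Lambda>2. f (g *v x, g *v y)) = (\<Sum>\<^sub>\<infinity>y\<in>?B. f (g *v x, g *v y))"
      using f by (intro infsum_cong_neutral) (auto simp: supported_in_box_def)
    then show "(\<Sum>\<^sub>\<infinity>y\<in>\<Lambda>2. f (g *v x, g *v y)) = (\<Sum>y\<in>?B. f (g *v x, g *v y))"
      using finite_near(2)[OF g] by simp
  qed
  also have "\<dots> = (\<Sum>\<^sub>\<infinity>x\<in>?A. \<Sum>y\<in>?B. f (g *v x, g *v y))"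
    using f by (intro infsum_cong_neutral) (auto simp: supported_in_box_def intro!: sum.neutral)
  also have "\<dots> = (\<Sum>x\<in>?A. \<Sum>y\<in>?B. f (g *v x, g *v y))"
    using finite_near(1)[OF g] by simp
  also have "\<dots> = (\<Sum>p\<in>?A \<times> ?B. f (act_pair g p))"
    by (simp add: sum.cartesian_product act_pair_def split_def)
  also have "?A \<times> ?B = near_pairs R g \<inter> (\<Lambda>1 \<times> \<Lambda>2)" by (auto simp: near_pairs_def)
  finally show ?thesis by (simp add: part_def g_def)
qed

lemma part_eq_nn_part:
  assumes C: "C \<in> space \<mu>" and f: "supported_in_box f R" "\<And>p. 0 \<le> f p" and P: "P \<subseteq> \<Lambda>1 \<times> \<Lambda>2"
  shows "ennreal (part P R f C) = nn_part P (\<lambda>p. ennreal (f p)) C"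
proof -
  have "nn_part P (\<lambda>p. ennreal (f p)) C = (\<Sum>p\<in>near_pairs R (L1.sec C) \<inter> P. ennreal (f (act_pair (L1.sec C) p)))"
    unfolding nn_part_def
  proof (rule nn_integral_count_space')
    fix p assume "p \<in> P" "p \<notin> near_pairs R (L1.sec C) \<inter> P"
    then have "\<not> (norm (L1.sec C *v fst p) \<le> R \<and> norm (L1.sec C *v snd p) \<le> R)"
      using P by (auto simp: near_pairs_def)
    then have "f (act_pair (L1.sec C) p) = 0"
      using f(1) by (auto simp: supported_in_box_def act_pair_def)
    then show "ennreal (f (act_pair (L1.sec C) p)) = 0" by simp
  qed (use finite_near_pairs[OF C] in auto)
  also have "\<dots> = ennreal (part P R f C)"
    unfolding part_def by (rule sum_ennreal) (rule f(2))
  finally show ?thesis by simp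
qed

lemma part_diff: "part P R (\<lambda>p. f p - h p) C = part P R f C - part P R h C"
  by (simp add: part_def sum_subtractf)

lemma part_measurable_nonneg:
  assumes [measurable]: "f \<in> borel_measurable borel" and f: "supported_in_box f R" "\<And>p. 0 \<le> f p" and P: "P \<subseteq> \<Lambda>1 \<times> \<Lambda>2"
  shows "part P R f \<in> borel_measurable \<mu>"
proof -
  have [measurable]: "nn_part P (\<lambda>p. ennreal (f p)) \<in> borel_measurable \<mu>"
    by (rule nn_part_measurable[OF _ P]) measurable
  have "part P R f C = enn2real (nn_part P (\<lambda>p. ennreal (f p)) C)" if "C \<in> space \<mu>" for C
  proof -
    have "0 \<le> part P R f C" using f(2) by (simp add: part_def sum_nonneg)
    then show ?thesis using part_eq_nn_part[OF that f P] by (metis enn2real_ennreal)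
  qed
  then show ?thesis by (subst measurable_cong) auto
qed

lemma part_measurable:
  assumes f: "f \<in> borel_measurable borel" "supported_in_box f R" "\<And>p. \<bar>f p\<bar> \<le> M" and P: "P \<subseteq> \<Lambda>1 \<times> \<Lambda>2"
  shows "part P R f \<in> borel_measurable \<mu>"
proof -
  define u where "u = (\<lambda>p. max (f p) 0)"
  define v where "v = (\<lambda>p. max (- f p) 0)"
  note uv = pos_neg_parts[OF f u_def v_def]
  show ?thesis
    by (subst uv(1), unfold part_diff[abs_def])
      (use part_measurable_nonneg[OF uv(2-4) P] part_measurable_nonneg[OF uv(6-8) P] in simp)
qed

lemma part_bounded:
  assumes "\<And>p. \<bar>f p\<bar> \<le> M"
  obtains B where "\<forall>C\<in>space \<mu>. \<bar>part P R f C\<bar> \<le> B"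
proof -
  obtain N where N: "\<forall>g. det g = 1 \<longrightarrow> finite (near_pairs R g) \<and> card (near_pairs R g) \<le> N"
    by (rule near_pairs_bounded)
  have M: "0 \<le> M" using assms[of 0] by linarith
  show ?thesis
  proof (rule that[of "real N * M"], intro ballI)
    fix C assume C: "C \<in> space \<mu>"
    then have fin: "finite (near_pairs R (L1.sec C))" and card: "card (near_pairs R (L1.sec C)) \<le> N"
      using N L1.det_sec by auto
    have "\<bar>part P R f C\<bar> \<le> (\<Sum>p\<in>near_pairs R (L1.sec C) \<inter> P. M)"
      unfolding part_def by (rule order_trans[OF sum_abs sum_mono]) (rule assms)
    also have "\<dots> = real (card (near_pairs R (L1.sec C) \<inter> P)) * M" by simp
    also have "\<dots> \<le> real N * M"
      using card card_mono[OF fin, of "near_pairs R (L1.sec C) \<inter> P"] M by (intro mult_right_mono) auto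
    finally show "\<bar>part P R f C\<bar> \<le> real N * M" .
  qed
qed

lemma part_integrable:
  assumes f: "f \<in> borel_measurable borel" "supported_in_box f R" "\<And>p. \<bar>f p\<bar> \<le> M" and P: "P \<subseteq> \<Lambda>1 \<times> \<Lambda>2"
  shows "integrable \<mu> (part P R f)"
proof -
  obtain B where "\<forall>C\<in>space \<mu>. \<bar>part P R f C\<bar> \<le> B" using part_bounded[OF f(3)] .
  then show ?thesis
    using part_measurable[OF f P] by (intro L1.integrable_const_bound[of _ B]) (auto intro: AE_I2)
qed

lemma transverse_subset: "transverse \<subseteq> \<Lambda>1 \<times> \<Lambda>2"
  by (auto simp: transverse_def)

definition level_term :: "(real^2 \<Rightarrow> real^2) \<Rightarrow> ((real^2) \<times> (real^2) \<Rightarrow> real) \<Rightarrow> real \<Rightarrow> real"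
  where "level_term star f c = real (pair_count \<Gamma> \<Lambda>1 \<Lambda>2 c) / \<bar>c\<bar> *
          (\<integral>t. (\<integral>x. f (x, t *\<^sub>R x + c *\<^sub>R star x) \<partial>lborel) \<partial>lborel)"

text \<open>Positive weights let finiteness of the whole series pass to each single
  integral.\<close>

lemma pair_count_pos:
  assumes "c \<in> det_values \<Lambda>1 \<Lambda>2 - {0}" shows "pair_count \<Gamma> \<Lambda>1 \<Lambda>2 c > 0"
proof -
  have "level c \<noteq> {}" using assms by (auto simp: det_values_eq transverse_def level_def)
  then show ?thesis using finite_pair_orbits assms by (auto simp: pair_count_eq card_gt_0_iff)
qed

text \<open>Convergence is transported from the group to the formula: a bounded function on a
  probability space has a finite mean, so the equal series in \<open>ennreal\<close> is finite. This
  yields its summability and the integrability behind each term.\<close>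

lemma transverse_integral_nonneg:
  assumes f [measurable]: "f \<in> borel_measurable borel" and fs: "supported_in_box f R" "\<And>p. \<bar>f p\<bar> \<le> M"
    and nonneg: "\<And>p. 0 \<le> f p"
    and star [measurable]: "star \<in> borel_measurable borel" and dstar0: "\<forall>x. x \<noteq> 0 \<longrightarrow> det_cols x (star x) = 1"
  shows "\<And>c. c \<in> det_values \<Lambda>1 \<Lambda>2 - {0} \<Longrightarrow>
      integrable (lborel \<Otimes>\<^sub>M lborel) (\<lambda>(t::real, x). f (x, t *\<^sub>R x + c *\<^sub>R star x))"
    and "level_term star f summable_on (det_values \<Lambda>1 \<Lambda>2 - {0})"
    and "(\<integral>C. part transverse R f C \<partial>\<mu>) = c_lattice \<Gamma> * infsum (level_term star f) (det_values \<Lambda>1 \<Lambda>2 - {0})"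
proof -
  let ?N = "det_values \<Lambda>1 \<Lambda>2 - {0}"
  let ?F = "\<lambda>p. ennreal (f p)"
  let ?w = "\<lambda>c. real (pair_count \<Gamma> \<Lambda>1 \<Lambda>2 c) * (c_lattice \<Gamma> / \<bar>c\<bar>)"
  have dstar: "\<And>x. x \<noteq> 0 \<Longrightarrow> det_cols x (star x) = 1" using dstar0 by simp
  have cpos: "c_lattice \<Gamma> > 0" using L1.gint_eq_haar(2)[of "\<lambda>_. 0"] by simp
  have int: "integrable \<mu> (part transverse R f)"
    by (rule part_integrable[OF f fs transverse_subset])
  have pnn: "0 \<le> part transverse R f C" for C using nonneg by (simp add: part_def sum_nonneg)
  have total: "(\<integral>\<^sup>+C. ennreal (part transverse R f C) \<partial>\<mu>) = (\<integral>\<^sup>+c. ennreal (?w c) * star_integral star c ?F \<partial>count_space ?N)"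
  proof -
    have "(\<integral>\<^sup>+C. ennreal (part transverse R f C) \<partial>\<mu>) = (\<integral>\<^sup>+C. nn_part transverse ?F C \<partial>\<mu>)"
      by (rule nn_integral_cong) (rule part_eq_nn_part[OF _ fs(1) nonneg transverse_subset])
    also have "\<dots> = (\<integral>\<^sup>+c. ennreal (?w c) * star_integral star c ?F \<partial>count_space ?N)"
      by (rule nn_part_transverse[OF _ star dstar]) measurable
    finally show ?thesis .
  qed
  have int_eq: "(\<integral>\<^sup>+C. ennreal (part transverse R f C) \<partial>\<mu>) = ennreal (\<integral>C. part transverse R f C \<partial>\<mu>)"
    using int pnn by (intro nn_integral_eq_integral) auto
  have fin: "(\<integral>\<^sup>+c. ennreal (?w c) * star_integral star c ?F \<partial>count_space ?N) < \<infinity>"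
    unfolding total[symmetric] int_eq by simp
  have fin_c: "star_integral star c ?F < \<infinity>" if c: "c \<in> ?N" for c
  proof -
    have "AE c in count_space ?N. ennreal (?w c) * star_integral star c ?F \<noteq> \<infinity>"
      using fin by (intro nn_integral_PInf_AE) auto
    then have "ennreal (?w c) * star_integral star c ?F \<noteq> \<infinity>"
      using c by (simp add: AE_count_space)
    moreover have "?w c > 0" using pair_count_pos[OF c] cpos c by simp
    moreover have "b < \<infinity>" if "ennreal a * b \<noteq> \<infinity>" "a > 0" for a b
      using that by (auto simp: ennreal_mult_eq_top_iff less_top ennreal_eq_0_iff)
    ultimately show ?thesis by blast
  qed
  have swap: "(\<integral>\<^sup>+z. ennreal (case z of (t, x) \<Rightarrow> f (x, t *\<^sub>R x + c *\<^sub>R star x)) \<partial>(lborel \<Otimes>\<^sub>M lborel)) = star_integral star c ?F" for c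
  proof -
    have m: "(\<lambda>(x, t). ennreal (f (x, t *\<^sub>R x + c *\<^sub>R star x))) \<in> borel_measurable (lborel \<Otimes>\<^sub>M lborel)"
      by measurable
    have "(\<integral>\<^sup>+z. ennreal (case z of (t, x) \<Rightarrow> f (x, t *\<^sub>R x + c *\<^sub>R star x)) \<partial>(lborel \<Otimes>\<^sub>M lborel)) =
        (\<integral>\<^sup>+t. \<integral>\<^sup>+x. ennreal (f (x, t *\<^sub>R x + c *\<^sub>R star x)) \<partial>lborel \<partial>lborel)"
      by (subst lborel.nn_integral_fst[symmetric]) simp_all
    also have "\<dots> = star_integral star c ?F"
      unfolding star_integral_def by (rule lborel_pair.Fubini'[OF m])
    finally show ?thesis .
  qed
  show int_c: "integrable (lborel \<Otimes>\<^sub>M lborel) (\<lambda>(t::real, x). f (x, t *\<^sub>R x + c *\<^sub>R star x))" if c: "c \<in> ?N" for c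
  proof (rule integrableI_nonneg)
    show "(\<integral>\<^sup>+z. ennreal (case z of (t, x) \<Rightarrow> f (x, t *\<^sub>R x + c *\<^sub>R star x)) \<partial>(lborel \<Otimes>\<^sub>M lborel)) < \<infinity>"
      unfolding swap by (rule fin_c[OF c])
  qed (auto simp: nonneg split_def)
  have term_eq: "ennreal (?w c) * star_integral star c ?F = ennreal (c_lattice \<Gamma> * level_term star f c)" if c: "c \<in> ?N" for c
  proof -
    let ?J = "\<integral>t. (\<integral>x. f (x, t *\<^sub>R x + c *\<^sub>R star x) \<partial>lborel) \<partial>lborel"
    have J: "?J = (\<integral>z. (case z of (t, x) \<Rightarrow> f (x, t *\<^sub>R x + c *\<^sub>R star x)) \<partial>(lborel \<Otimes>\<^sub>M lborel))"
      using lborel_pair.integral_fst'[OF int_c[OF c]] by simp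
    have "star_integral star c ?F = ennreal ?J"
      unfolding swap[symmetric] J using int_c[OF c] nonneg by (intro nn_integral_eq_integral) auto
    moreover have "?J \<ge> 0" using nonneg by (intro Bochner_Integration.integral_nonneg) auto
    ultimately show ?thesis
      using cpos by (simp add: level_term_def ennreal_mult[symmetric] mult_ac)
  qed
  have tnn: "0 \<le> level_term star f c" for c
    using nonneg by (auto simp: level_term_def intro!: mult_nonneg_nonneg Bochner_Integration.integral_nonneg)
  have total': "(\<integral>\<^sup>+c. ennreal (?w c) * star_integral star c ?F \<partial>count_space ?N) = (\<integral>\<^sup>+c. ennreal (c_lattice \<Gamma> * level_term star f c) \<partial>count_space ?N)"
    by (rule nn_integral_cong, rule term_eq) simp
  have s: "(\<lambda>c. c_lattice \<Gamma> * level_term star f c) summable_on ?N"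
    "infsum (\<lambda>c. c_lattice \<Gamma> * level_term star f c) ?N = enn2real (\<integral>\<^sup>+c. ennreal (c_lattice \<Gamma> * level_term star f c) \<partial>count_space ?N)"
    using count_space_infsum[of ?N "\<lambda>c. c_lattice \<Gamma> * level_term star f c"] fin cpos tnn unfolding total' by auto
  then show "level_term star f summable_on ?N"
    using cpos by (simp add: summable_on_cmult_right')
  have "(\<integral>C. part transverse R f C \<partial>\<mu>) = enn2real (\<integral>\<^sup>+c. ennreal (c_lattice \<Gamma> * level_term star f c) \<partial>count_space ?N)"
    using int_eq pnn unfolding total total' by (simp add: Bochner_Integration.integral_nonneg)
  also have "\<dots> = c_lattice \<Gamma> * infsum (level_term star f) ?N"
    unfolding s(2)[symmetric] by (rule infsum_cmult_right')
  finally show "(\<integral>C. part transverse R f C \<partial>\<mu>) = c_lattice \<Gamma> * infsum (level_term star f) ?N" .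
qed

text \<open>Positive and negative parts may be subtracted inside the integrals and the series
  because the nonnegative case supplies integrability and summability for each of them.\<close>

lemma transverse_integral:
  assumes f: "f \<in> borel_measurable borel" "supported_in_box f R" "\<And>p. \<bar>f p\<bar> \<le> M"
    and star: "star \<in> borel_measurable borel" "\<forall>x. x \<noteq> 0 \<longrightarrow> det_cols x (star x) = 1"
  shows "(\<integral>C. part transverse R f C \<partial>\<mu>) = c_lattice \<Gamma> * infsum (level_term star f) (det_values \<Lambda>1 \<Lambda>2 - {0})"
proof -
  let ?N = "det_values \<Lambda>1 \<Lambda>2 - {0}"
  define u where "u = (\<lambda>p. max (f p) 0)"
  define v where "v = (\<lambda>p. max (- f p) 0)"
  note uv = pos_neg_parts[OF f u_def v_def]
  note u = transverse_integral_nonneg[OF uv(2,3,5,4) star] and v = transverse_integral_nonneg[OF uv(6,7,9,8) star]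
  have lt: "level_term star f c = level_term star u c + - level_term star v c" if c: "c \<in> ?N" for c
  proof -
    have iu: "(\<integral>t. (\<integral>x. u (x, t *\<^sub>R x + c *\<^sub>R star x) \<partial>lborel) \<partial>lborel) = (\<integral>(t, x). u (x, t *\<^sub>R x + c *\<^sub>R star x) \<partial>(lborel \<Otimes>\<^sub>M lborel))"
      using lborel_pair.integral_fst'[OF u(1)[OF c]] by simp
    have iv: "(\<integral>t. (\<integral>x. v (x, t *\<^sub>R x + c *\<^sub>R star x) \<partial>lborel) \<partial>lborel) = (\<integral>(t, x). v (x, t *\<^sub>R x + c *\<^sub>R star x) \<partial>(lborel \<Otimes>\<^sub>M lborel))"
      using lborel_pair.integral_fst'[OF v(1)[OF c]] by simp
    have "integrable (lborel \<Otimes>\<^sub>M lborel) (\<lambda>(t, x). f (x, t *\<^sub>R x + c *\<^sub>R star x))"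
      using Bochner_Integration.integrable_diff[OF u(1)[OF c] v(1)[OF c]] by (subst uv(1)) (simp add: split_def)
    from lborel_pair.integral_fst'[OF this]
    have "(\<integral>t. (\<integral>x. f (x, t *\<^sub>R x + c *\<^sub>R star x) \<partial>lborel) \<partial>lborel) = (\<integral>(t, x). f (x, t *\<^sub>R x + c *\<^sub>R star x) \<partial>(lborel \<Otimes>\<^sub>M lborel))"
      by simp
    also have "\<dots> = (\<integral>(t, x). u (x, t *\<^sub>R x + c *\<^sub>R star x) \<partial>(lborel \<Otimes>\<^sub>M lborel)) - (\<integral>(t, x). v (x, t *\<^sub>R x + c *\<^sub>R star x) \<partial>(lborel \<Otimes>\<^sub>M lborel))"
      using Bochner_Integration.integral_diff[OF u(1)[OF c] v(1)[OF c]] by (subst uv(1)) (simp add: split_def)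
    finally have J: "(\<integral>t. (\<integral>x. f (x, t *\<^sub>R x + c *\<^sub>R star x) \<partial>lborel) \<partial>lborel) =
       (\<integral>t. (\<integral>x. u (x, t *\<^sub>R x + c *\<^sub>R star x) \<partial>lborel) \<partial>lborel) - (\<integral>t. (\<integral>x. v (x, t *\<^sub>R x + c *\<^sub>R star x) \<partial>lborel) \<partial>lborel)"
      unfolding iu iv .
    show ?thesis unfolding level_term_def J
      by (simp only: distrib_left mult_minus_right diff_conv_add_uminus)
  qed
  have "infsum (level_term star f) ?N = infsum (\<lambda>c. level_term star u c + - level_term star v c) ?N"
    by (rule infsum_cong) (rule lt)
  also have "\<dots> = infsum (level_term star u) ?N + infsum (\<lambda>c. - level_term star v c) ?N"
    using u(2) v(2) by (intro infsum_add) (simp_all add: summable_on_uminus)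
  also have "\<dots> = infsum (level_term star u) ?N - infsum (level_term star v) ?N"
    by (simp add: infsum_uminus)
  finally have inf: "infsum (level_term star f) ?N = infsum (level_term star u) ?N - infsum (level_term star v) ?N" .
  have "(\<integral>C. part transverse R f C \<partial>\<mu>) = (\<integral>C. part transverse R u C \<partial>\<mu>) - (\<integral>C. part transverse R v C \<partial>\<mu>)"
    by (subst uv(1), unfold part_diff, intro Bochner_Integration.integral_diff part_integrable[OF uv(2,3,5) transverse_subset] part_integrable[OF uv(6,7,9) transverse_subset])
  also have "\<dots> = c_lattice \<Gamma> * infsum (level_term star f) ?N"
    unfolding inf u(3) v(3) by (simp only: right_diff_distrib)
  finally show ?thesis .
qed

section \<open>Pairs of determinant zero and the mean value\<close>

definition collinear_pairs :: "((real^2) \<times> (real^2)) set"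
  where "collinear_pairs = {p \<in> \<Lambda>1 \<times> \<Lambda>2. det_pair p = 0}"

lemma collinear_pairs_eq:
  "collinear_pairs = (if \<Lambda>1 = \<Lambda>2 then (\<lambda>x. (x, x)) ` \<Lambda>1 \<union> (\<lambda>x. (x, - x)) ` \<Lambda>1 else {})"
proof -
  have c: "\<Lambda>1 = \<Lambda>2 \<and> (y = x \<or> y = - x)" if "(x, y) \<in> collinear_pairs" for x y
    using veech_collinear[OF L1.veech_orbit_axioms L2.veech_orbit_axioms, of x y] that
    by (auto simp: collinear_pairs_def det_pair_def)
  show ?thesis
  proof (cases "\<Lambda>1 = \<Lambda>2")
    case True
    have mem: "(x, x) \<in> collinear_pairs" "(x, - x) \<in> collinear_pairs" if "x \<in> \<Lambda>1" for x
      using that L1.uminus_in[OF that] det_cols_scale[of x "-1" x]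
      unfolding collinear_pairs_def unfolding True[symmetric] by (simp_all add: det_pair_def)
    have "collinear_pairs = (\<lambda>x. (x, x)) ` \<Lambda>1 \<union> (\<lambda>x. (x, - x)) ` \<Lambda>1"
    proof
      show "collinear_pairs \<subseteq> (\<lambda>x. (x, x)) ` \<Lambda>1 \<union> (\<lambda>x. (x, - x)) ` \<Lambda>1"
      proof
        fix p assume p: "p \<in> collinear_pairs"
        obtain x y where xy: "p = (x, y)" by (cases p)
        then have "x \<in> \<Lambda>1" using p by (simp add: collinear_pairs_def)
        then show "p \<in> (\<lambda>x. (x, x)) ` \<Lambda>1 \<union> (\<lambda>x. (x, - x)) ` \<Lambda>1" using c[of x y] p xy by blast
      qed
      show "(\<lambda>x. (x, x)) ` \<Lambda>1 \<union> (\<lambda>x. (x, - x)) ` \<Lambda>1 \<subseteq> collinear_pairs" using mem by blast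
    qed
    then show ?thesis unfolding if_P[OF True] .
  next
    case False
    then show ?thesis using c by auto
  qed
qed

lemma part_collinear:
  assumes C: "C \<in> space \<mu>" and f: "supported_in_box f R"
  shows "part collinear_pairs R f C = (if \<Lambda>1 = \<Lambda>2 then siegel_transform \<Lambda>1 (\<lambda>x. f (x, - x) + f (x, x)) C else 0)"
proof (cases "\<Lambda>1 = \<Lambda>2")
  case True
  define g where "g = L1.sec C"
  have g: "det g = 1" using C by (simp add: g_def L1.det_sec)
  let ?A = "{x\<in>\<Lambda>1. norm (g *v x) \<le> R}"
  have neg: "g *v (- x) = - (g *v x)" for x by (simp add: vec2_eq_iff)
  have n: "near_pairs R g = ?A \<times> ?A"
    unfolding near_pairs_def unfolding True[symmetric] ..
  have c: "collinear_pairs = (\<lambda>x. (x, x)) ` \<Lambda>1 \<union> (\<lambda>x. (x, - x)) ` \<Lambda>1"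
    unfolding collinear_pairs_eq by (rule if_P[OF True])
  have "near_pairs R g \<inter> collinear_pairs = (\<lambda>x. (x, x)) ` ?A \<union> (\<lambda>x. (x, - x)) ` ?A"
    unfolding n c using L1.uminus_in by (auto simp: neg)
  then have "part collinear_pairs R f C = (\<Sum>p\<in>(\<lambda>x. (x, x)) ` ?A \<union> (\<lambda>x. (x, - x)) ` ?A. f (act_pair g p))"
    by (simp add: part_def g_def[symmetric])
  also have "\<dots> = (\<Sum>p\<in>(\<lambda>x. (x, x)) ` ?A. f (act_pair g p)) + (\<Sum>p\<in>(\<lambda>x. (x, - x)) ` ?A. f (act_pair g p))"
  proof (rule sum.union_disjoint)
    \<comment> \<open>Points of the orbit are nonzero, so the pairs \<open>(x, x)\<close> and
      \<open>(x, - x)\<close> are distinct and nothing is counted twice.\<close>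
    have "x \<noteq> - x" if "x \<in> \<Lambda>1" for x
    proof
      assume "x = - x"
      then have "x = 0" by (simp add: vec2_eq_iff)
      then show False using L1.nonzero[OF that] by simp
    qed
    then show "(\<lambda>x. (x, x)) ` ?A \<inter> (\<lambda>x. (x, - x)) ` ?A = {}" by auto
  qed (use finite_near(1)[OF g] in auto)
  also have "\<dots> = (\<Sum>x\<in>?A. f (g *v x, - (g *v x)) + f (g *v x, g *v x))"
    by (subst (1 2) sum.reindex) (auto simp: inj_on_def act_pair_def neg sum.distrib)
  also have "\<dots> = (\<Sum>\<^sub>\<infinity>x\<in>?A. f (g *v x, - (g *v x)) + f (g *v x, g *v x))"
    using finite_near(1)[OF g] by simp
  also have "\<dots> = (\<Sum>\<^sub>\<infinity>x\<in>\<Lambda>1. f (g *v x, - (g *v x)) + f (g *v x, g *v x))"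
  proof (rule infsum_cong_neutral)
    fix x assume "x \<in> \<Lambda>1 - ?A"
    then have "\<not> norm (g *v x) \<le> R" by simp
    then have "f (g *v x, - (g *v x)) = 0" "f (g *v x, g *v x) = 0"
      using f unfolding supported_in_box_def by blast+
    then show "f (g *v x, - (g *v x)) + f (g *v x, g *v x) = 0" by simp
  qed auto
  also have "\<dots> = siegel_transform \<Lambda>1 (\<lambda>x. f (x, - x) + f (x, x)) C"
    by (simp add: L1.siegel_transform_sec[OF C] g_def)
  finally show ?thesis using True by simp
next
  case False
  then show ?thesis by (simp add: part_def collinear_pairs_eq)
qed

lemma collinear_integral:
  assumes f [measurable]: "f \<in> borel_measurable borel" and fs: "supported_in_box f R" "\<And>p. \<bar>f p\<bar> \<le> M"
  shows "(\<integral>C. part collinear_pairs R f C \<partial>\<mu>) =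
    (if \<Lambda>1 = \<Lambda>2 then 1 else 0) * c_lattice \<Gamma> * (\<integral>x. f (x, - x) + f (x, x) \<partial>lborel)"
proof (cases "\<Lambda>1 = \<Lambda>2")
  case True
  let ?h = "\<lambda>x. f (x, - x) + f (x, x)"
  have "(\<integral>C. part collinear_pairs R f C \<partial>\<mu>) = (\<integral>C. siegel_transform \<Lambda>1 ?h C \<partial>\<mu>)"
    by (rule Bochner_Integration.integral_cong[OF refl]) (simp only: part_collinear[OF _ fs(1)] if_P[OF True])
  also have "\<dots> = c_lattice \<Gamma> * (\<integral>x. ?h x \<partial>lborel)"
  proof -
    have "?h \<in> borel_measurable borel" by measurable
    moreover have "bounded (range ?h)"
    proof (rule boundedI)
      fix y assume "y \<in> range ?h"
      then obtain x where "y = ?h x" by auto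
      then show "norm y \<le> 2 * M" using fs(2)[of "(x, - x)"] fs(2)[of "(x, x)"] by simp
    qed
    moreover have "compactly_supported ?h"
    proof -
      have "{x. ?h x \<noteq> 0} \<subseteq> cball 0 R"
      proof
        fix x assume "x \<in> {x. ?h x \<noteq> 0}"
        then have "f (x, - x) \<noteq> 0 \<or> f (x, x) \<noteq> 0" by auto
        then have "norm x \<le> R" using fs(1) unfolding supported_in_box_def by blast
        then show "x \<in> cball 0 R" by simp
      qed
      then have "bounded {x. ?h x \<noteq> 0}" using bounded_cball bounded_subset by blast
      then show ?thesis by (simp add: compactly_supported_def)
    qed
    ultimately show ?thesis using L1.veech unfolding siegel_veech_constant_def by blast
  qed
  finally show ?thesis using True by simp
next
  case False
  then show ?thesis by (simp add: part_def collinear_pairs_eq)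
qed

lemma collinear_subset: "collinear_pairs \<subseteq> \<Lambda>1 \<times> \<Lambda>2"
  by (auto simp: collinear_pairs_def)

theorem mean_value:
  assumes f: "f \<in> borel_measurable borel" "supported_in_box f R" "\<And>p. \<bar>f p\<bar> \<le> M"
    and star: "star \<in> borel_measurable borel" "\<forall>x. x \<noteq> 0 \<longrightarrow> det_cols x (star x) = 1"
  shows "siegel_veech_transform \<Lambda>1 \<Lambda>2 f \<in> L_infinity \<mu>"
    and "(\<integral>C. siegel_veech_transform \<Lambda>1 \<Lambda>2 f C \<partial>\<mu>) =
      c_lattice \<Gamma> * infsum (level_term star f) (det_values \<Lambda>1 \<Lambda>2 - {0}) +
      (if \<Lambda>1 = \<Lambda>2 then 1 else 0) * c_lattice \<Gamma> * (\<integral>x. f (x, - x) + f (x, x) \<partial>lborel)"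
proof -
  have eq: "siegel_veech_transform \<Lambda>1 \<Lambda>2 f C = part (\<Lambda>1 \<times> \<Lambda>2) R f C" if "C \<in> space \<mu>" for C
    by (rule transform_eq_part[OF that f(2)])
  have "siegel_veech_transform \<Lambda>1 \<Lambda>2 f \<in> borel_measurable \<mu> \<longleftrightarrow> part (\<Lambda>1 \<times> \<Lambda>2) R f \<in> borel_measurable \<mu>"
    by (rule measurable_cong) (rule eq)
  then have "siegel_veech_transform \<Lambda>1 \<Lambda>2 f \<in> borel_measurable \<mu>"
    using part_measurable[OF f order_refl] by simp
  moreover obtain B where B: "\<forall>C\<in>space \<mu>. \<bar>part (\<Lambda>1 \<times> \<Lambda>2) R f C\<bar> \<le> B" using part_bounded[OF f(3)] .
  then have "AE C in \<mu>. \<bar>siegel_veech_transform \<Lambda>1 \<Lambda>2 f C\<bar> \<le> B" by (intro AE_I2) (simp add: eq)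
  ultimately show "siegel_veech_transform \<Lambda>1 \<Lambda>2 f \<in> L_infinity \<mu>"
    unfolding L_infinity_def by blast
  have "part (\<Lambda>1 \<times> \<Lambda>2) R f C = part transverse R f C + part collinear_pairs R f C" if "C \<in> space \<mu>" for C
  proof -
    have "near_pairs R (L1.sec C) \<inter> (\<Lambda>1 \<times> \<Lambda>2) = (near_pairs R (L1.sec C) \<inter> transverse) \<union> (near_pairs R (L1.sec C) \<inter> collinear_pairs)"
      by (auto simp: transverse_def collinear_pairs_def)
    then show ?thesis
      unfolding part_def using finite_near_pairs[OF that]
      by (simp only:) (intro sum.union_disjoint, auto simp: transverse_def collinear_pairs_def)
  qed
  then have "(\<integral>C. siegel_veech_transform \<Lambda>1 \<Lambda>2 f C \<partial>\<mu>) = (\<integral>C. part transverse R f C + part collinear_pairs R f C \<partial>\<mu>)"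
    by (intro Bochner_Integration.integral_cong) (simp_all add: eq)
  also have "\<dots> = (\<integral>C. part transverse R f C \<partial>\<mu>) + (\<integral>C. part collinear_pairs R f C \<partial>\<mu>)"
    by (intro Bochner_Integration.integral_add part_integrable[OF f transverse_subset] part_integrable[OF f collinear_subset])
  finally show "(\<integral>C. siegel_veech_transform \<Lambda>1 \<Lambda>2 f C \<partial>\<mu>) =
      c_lattice \<Gamma> * infsum (level_term star f) (det_values \<Lambda>1 \<Lambda>2 - {0}) +
      (if \<Lambda>1 = \<Lambda>2 then 1 else 0) * c_lattice \<Gamma> * (\<integral>x. f (x, - x) + f (x, x) \<partial>lborel)"
    unfolding transverse_integral[OF f star] collinear_integral[OF f] .
qed

end

lemma borel_semicontinuous:
  fixes f :: "'a::topological_space \<Rightarrow> real"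
  assumes "lower_semicontinuous f \<or> upper_semicontinuous f"
  shows "f \<in> borel_measurable borel"
  using assms
proof
  assume "lower_semicontinuous f"
  then show ?thesis unfolding borel_measurable_iff_greater lower_semicontinuous_def by simp
next
  assume "upper_semicontinuous f"
  then show ?thesis unfolding borel_measurable_iff_less upper_semicontinuous_def by simp
qed

theorem theorem1p8:
  fixes \<Gamma> :: "(real^2^2) set"
    and \<mu> :: "(real^2^2) set measure"
    and \<Lambda>1 \<Lambda>2 :: "(real^2) set"
    and f :: "(real^2) \<times> (real^2) \<Rightarrow> real"
    and star :: "real^2 \<Rightarrow> real^2"
  assumes "lattice_SL2 \<Gamma>"
    and "nonuniform \<Gamma>"
    and "- mat 1 \<in> \<Gamma>"
    and "invariant_probability \<Gamma> \<mu>"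
    and "scaled_orbit \<Gamma> \<mu> \<Lambda>1"
    and "scaled_orbit \<Gamma> \<mu> \<Lambda>2"
    and "bounded (range f)"
    and "lower_semicontinuous f \<or> upper_semicontinuous f"
    and "compactly_supported f"
    and "star \<in> borel_measurable borel"
    and "\<And>x. x \<noteq> 0 \<Longrightarrow> det_cols x (star x) = 1"
  shows "siegel_veech_transform \<Lambda>1 \<Lambda>2 f \<in> L_infinity \<mu> \<and>
    (\<integral>C. siegel_veech_transform \<Lambda>1 \<Lambda>2 f C \<partial>\<mu>) =
      c_lattice \<Gamma> * (\<Sum>\<^sub>\<infinity>c \<in> det_values \<Lambda>1 \<Lambda>2 - {0}.
        real (pair_count \<Gamma> \<Lambda>1 \<Lambda>2 c) / \<bar>c\<bar> *
          (\<integral>t. (\<integral>x. f (x, t *\<^sub>R x + c *\<^sub>R star x) \<partial>lborel) \<partial>lborel)) +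
      (if homothetic \<Lambda>1 \<Lambda>2 then 1 else 0) * c_lattice \<Gamma> *
        (\<integral>x. f (x, - x) + f (x, x) \<partial>lborel)"
proof -
  have "lattice_measure_minus \<Gamma> \<mu>"
    using assms(1,3,4)
    by (simp add: lattice_measure_minus_def lattice_measure_def lattice_measure_minus_axioms_def lattice_SL2_def)
  then have 1: "veech_orbit \<Gamma> \<mu> \<Lambda>1" and 2: "veech_orbit \<Gamma> \<mu> \<Lambda>2"
    using assms(5,6) by (simp_all add: veech_orbit_def veech_orbit_axioms_def scaled_orbit_def)
  interpret veech_pair \<Gamma> \<mu> \<Lambda>1 \<Lambda>2 by (intro veech_pair.intro 1 2)
  obtain M where M: "\<And>p. \<bar>f p\<bar> \<le> M" using assms(7) by (auto simp: bounded_iff)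
  have "bounded {p. f p \<noteq> 0}"
    using assms(9) by (auto simp: compactly_supported_def dest: compact_imp_bounded intro: bounded_subset[OF _ closure_subset])
  then obtain R where R: "\<forall>p\<in>{p. f p \<noteq> 0}. norm p \<le> R" unfolding bounded_iff by blast
  have "supported_in_box f R"
    unfolding supported_in_box_def
  proof (intro allI impI)
    fix x y assume "f (x, y) \<noteq> 0"
    then have "norm (x, y) \<le> R" using R by blast
    then show "norm x \<le> R \<and> norm y \<le> R"
      using norm_fst_le[of x y] norm_snd_le[of y x] by linarith
  qed
  moreover have "\<forall>x. x \<noteq> 0 \<longrightarrow> det_cols x (star x) = 1" using assms(11) by simp
  ultimately have "siegel_veech_transform \<Lambda>1 \<Lambda>2 f \<in> L_infinity \<mu>"
    "(\<integral>C. siegel_veech_transform \<Lambda>1 \<Lambda>2 f C \<partial>\<mu>) =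
      c_lattice \<Gamma> * infsum (level_term star f) (det_values \<Lambda>1 \<Lambda>2 - {0}) +
      (if \<Lambda>1 = \<Lambda>2 then 1 else 0) * c_lattice \<Gamma> * (\<integral>x. f (x, - x) + f (x, x) \<partial>lborel)"
    using mean_value[OF borel_semicontinuous[OF assms(8)] _ M assms(10)] by simp_all
  then show ?thesis
    unfolding homothetic_iff_eq[OF 1 2] level_term_def by blast
qed

end
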